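(* Let $\mu(a,b)$ (for integers $2 \leq a \leq b$) denote the smallest possible order of a graph $G$ with $\mathrm{mp}(G) = a$ and $\mathrm{gp}(G) = b$. Then: (1) For $a \geq 2$, $\mu(a,a) = a$. (2) $\mu(2,3) = 5$, and for $b \geq 4$ we have $\mu(2,b) \leq \lceil \frac{3b}{2} \rceil + 1$, with equality for $4 \leq b \leq 8$. (3) For $3 \leq a < b$ with $\frac{b}{2} \leq a$ we have $\mu(a,b) = b+2$. (4) For $3 \leq a < \frac{b}{2}$ we have $\mu(a,b) \leq b - a + 2 + \lceil \frac{b}{2} \rceil$.
   Context: All graphs are finite, simple and undirected; the order of a graph is its number of vertices. A geodesic is a shortest path between two vertices; a monophonic path is an induced (chordless) path. A set $S$ of vertices of a graph $G$ is in general position if no geodesic of $G$ contains more than two elements of $S$, and in monophonic position if no monophonic path of $G$ contains more than two elements of $S$. The general position number $\mathrm{gp}(G)$ is the largest size of a set in general position, and the monophonic position number $\mathrm{mp}(G)$ is the largest size of a set in monophonic position. *)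

theory Defs
  imports "Graph_Theory.Graph_Theory" "HOL-Library.Extended_Nat" Complex_Main
begin

text \<open>
  Finite simple undirected graphs are the digraphs satisfying the locale predicate
  \<open>pair_graph\<close>: finite and loop-free, with a symmetric arc relation. A path is a
  \<open>vpath\<close>, given by its nonempty list of distinct vertices. Graphs need not be connected.
\<close>

definition geodesic :: "'a pair_pre_digraph \<Rightarrow> 'a list \<Rightarrow> bool" where
  "geodesic G p \<longleftrightarrow> vpath p (with_proj G) \<and>
     (\<forall>q. vpath q (with_proj G) \<and> hd q = hd p \<and> last q = last p \<longrightarrow>
        vwalk_length p \<le> vwalk_length q)"

definition monophonic_path :: "'a pair_pre_digraph \<Rightarrow> 'a list \<Rightarrow> bool" where
  "monophonic_path G p \<longleftrightarrow> vpath p (with_proj G) \<and>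
     (\<forall>i < length p. \<forall>j < length p.
        (p ! i, p ! j) \<in> parcs G \<longrightarrow> j = Suc i \<or> i = Suc j)"

definition general_position :: "'a pair_pre_digraph \<Rightarrow> 'a set \<Rightarrow> bool" where
  "general_position G S \<longleftrightarrow> S \<subseteq> pverts G \<and>
     (\<forall>p. geodesic G p \<longrightarrow> card (S \<inter> set p) \<le> 2)"

definition monophonic_position :: "'a pair_pre_digraph \<Rightarrow> 'a set \<Rightarrow> bool" where
  "monophonic_position G S \<longleftrightarrow> S \<subseteq> pverts G \<and>
     (\<forall>p. monophonic_path G p \<longrightarrow> card (S \<inter> set p) \<le> 2)"

definition gp :: "'a pair_pre_digraph \<Rightarrow> nat" where
  "gp G = Max (card ` {S. general_position G S})"

definition mp :: "'a pair_pre_digraph \<Rightarrow> nat" where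
  "mp G = Max (card ` {S. monophonic_position G S})"

text \<open>
  Every finite graph is isomorphic to one whose vertices are natural numbers, so fixing the
  vertex type loses nothing. The infimum is taken in \<^typ>\<open>enat\<close>, where it is \<open>\<infinity>\<close> if
  no graph has the prescribed parameters: a finite upper bound on \<open>\<mu> a b\<close> thus includes
  the existence of such a graph, and a finite infimum is attained. The name \<open>\<mu>\<close> is
  unrelated to the shortest-path distance \<open>wf_digraph.\<mu>\<close>.
\<close>

definition \<mu> :: "nat \<Rightarrow> nat \<Rightarrow> enat" where
  "\<mu> a b = (INF G \<in> {G :: nat pair_pre_digraph. pair_graph G \<and> mp G = a \<and> gp G = b}.
     enat (card (pverts G)))"

end

theory Submission
  imports Defs "HOL-Library.Countable"
begin

text \<open>
  Upper bounds are graphs with the required parameters. For \<open>a = b\<close> take the complete graph, and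
  for \<open>3 \<le> a < b\<close> a subdivided star with \<open>a\<close> legs together with a hub adjacent to all but every
  third vertex of one leg. For \<open>a = 2\<close> take a graph in which \<open>b\<close> vertices are pairwise at distance at most
  two and any three vertices lie on an explicit induced path.

  For the lower bounds let \<open>S\<close> be a largest set in general position. If at most one vertex is
  outside \<open>S\<close>, then \<open>S\<close> is also in monophonic position, so \<open>a < b\<close> forces two more vertices. If
  \<open>mp G = 2\<close>, any three vertices lie on an induced path; hence \<open>G\<close> is triangle-free, \<open>S\<close> induces a
  matching, and distinct vertices of \<open>S\<close> have distinct, nonempty sets of neighbours in the
  complement \<open>T\<close> of \<open>S\<close>. An edge inside \<open>S\<close> almost determines how the other vertices attach to
  \<open>T\<close>; without such an edge, no neighbourhood is contained in two others. Both cases bound the size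
  of \<open>S\<close> in terms of the size of \<open>T\<close>.
\<close>

section \<open>Paths and position numbers\<close>

text \<open>The hub brings all its neighbours within distance two of each other. Such a set is in
  general position as soon as it induces no path on three vertices, which is why every third vertex
  of the leg is left out. For monophonic position the hub gains nothing, and the value is still that
  of the underlying tree, its number of leaves. For \<open>a = 2\<close> the range in which equality
  holds comes from counting the vertices outside \<open>S\<close>. Complements of size 2, 3, 4 are
  shown to allow at most 3, 4, 6 vertices in \<open>S\<close>. The upper bound uses complements of
  size 3, 4, 4, 5, 5 for \<open>b\<close> from 4 to 8, so both sides agree there; at
  \<open>b = 9\<close> it uses 6, and agreement would require that five vertices allow at most
  eight. The number of subsets of the complement alone is far too weak a bound from size 3 on, so
  the admissible families of neighbourhoods have to be restricted. The hardest configuration is an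
  edge in \<open>S\<close> whose ends split a complement of size 4 into two pairs.\<close>

lemma vwalk_arcs_subset_iff:
  "set (vwalk_arcs p) \<subseteq> A \<longleftrightarrow> successively (\<lambda>u v. (u, v) \<in> A) p"
  by (induction p rule: vwalk_arcs.induct) auto

lemma vpath_iff:
  "vpath p (with_proj G) \<longleftrightarrow> p \<noteq> [] \<and> distinct p \<and> set p \<subseteq> pverts G \<and>
     successively (\<lambda>u v. (u, v) \<in> parcs G) p"
  by (auto simp: vpath_def vwalk_def vwalk_arcs_subset_iff)

lemma monophonic_path_iff:
  "monophonic_path G p \<longleftrightarrow> p \<noteq> [] \<and> distinct p \<and> set p \<subseteq> pverts G \<and>
     successively (\<lambda>u v. (u, v) \<in> parcs G) p \<and>
     (\<forall>i < length p. \<forall>j < length p. (p ! i, p ! j) \<in> parcs G \<longrightarrow> j = Suc i \<or> i = Suc j)"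
  by (auto simp: monophonic_path_def vpath_iff)

lemma geodesic_iff:
  "geodesic G p \<longleftrightarrow> vpath p (with_proj G) \<and>
     (\<forall>q. vpath q (with_proj G) \<and> hd q = hd p \<and> last q = last p \<longrightarrow> length p \<le> length q)"
proof -
  have "vwalk_length p \<le> vwalk_length q \<longleftrightarrow> length p \<le> length q"
    if "vpath p (with_proj G)" "vpath q (with_proj G)" for p q
    using that by (cases p; cases q) (auto simp: vpath_iff)
  then show ?thesis
    unfolding geodesic_def by blast
qed

lemma ex_three_distinct:
  assumes "3 \<le> card A"
  obtains x y z where "x \<in> A" "y \<in> A" "z \<in> A" "x \<noteq> y" "x \<noteq> z" "y \<noteq> z"
proof -
  obtain B where "B \<subseteq> A" "card B = 3"
    using assms by (meson obtain_subset_with_card_n)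
  then show thesis
    using that by (auto simp: card_3_iff)
qed

lemma three_le_card:
  assumes "finite A" "{x, y, z} \<subseteq> A" "x \<noteq> y" "x \<noteq> z" "y \<noteq> z"
  shows "3 \<le> card A"
proof -
  have "card {x, y, z} = 3"
    using assms by simp
  then show ?thesis
    using card_mono[OF assms(1,2)] by simp
qed

lemma card_Int_le_2D:
  assumes "card (S \<inter> set p) \<le> 2" "x \<in> S" "y \<in> S" "z \<in> S" "{x, y, z} \<subseteq> set p"
  shows "x = y \<or> x = z \<or> y = z"
  using three_le_card[of "S \<inter> set p" x y z] assms by auto

text \<open>Allows arguments on three vertices of a path to assume their order along it.\<close>

lemma ex_sorted_indices:
  assumes "{x, y, z} \<subseteq> set p" "x \<noteq> y" "x \<noteq> z" "y \<noteq> z"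
  obtains i j k where "i < j" "j < k" "k < length p" "{p ! i, p ! j, p ! k} = {x, y, z}"
proof -
  obtain i j k where "i < length p" "j < length p" "k < length p" "p ! i = x" "p ! j = y" "p ! k = z"
    using assms(1) by (auto simp: in_set_conv_nth)
  note ijk = this
  then have "i \<noteq> j" "i \<noteq> k" "j \<noteq> k"
    using assms by auto
  then consider "i < j \<and> j < k" | "i < k \<and> k < j" | "j < i \<and> i < k"
    | "j < k \<and> k < i" | "k < i \<and> i < j" | "k < j \<and> j < i"
    by linarith
  then show thesis
    using that[of i j k] that[of i k j] that[of j i k] that[of j k i] that[of k i j] that[of k j i] ijk
    by cases (simp_all add: insert_commute)
qed

context pair_graph
begin

lemma arc_sym: "(u, v) \<in> parcs G \<Longrightarrow> (v, u) \<in> parcs G"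
  using pair_sym_arcs by (auto simp: symmetric_def symD)

lemma arc_irrefl: "(u, u) \<notin> parcs G"
  using pair_no_loops by fastforce

lemma general_position_finite: "finite {S. general_position G S}"
  by (rule finite_subset[of _ "Pow (pverts G)"]) (auto simp: general_position_def pair_finite_verts)

lemma monophonic_position_finite: "finite {S. monophonic_position G S}"
  by (rule finite_subset[of _ "Pow (pverts G)"]) (auto simp: monophonic_position_def pair_finite_verts)

lemma card_le_gp: "general_position G S \<Longrightarrow> card S \<le> gp G"
  unfolding gp_def using general_position_finite by (intro Max_ge) auto

lemma card_le_mp: "monophonic_position G S \<Longrightarrow> card S \<le> mp G"
  unfolding mp_def using monophonic_position_finite by (intro Max_ge) auto

lemma gp_attained: obtains S where "general_position G S" "card S = gp G"
proof -
  have "general_position G {}"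
    by (simp add: general_position_def)
  then have "gp G \<in> card ` {S. general_position G S}"
    unfolding gp_def using general_position_finite by (intro Max_in) auto
  then show thesis
    using that by auto
qed

lemma mp_attained: obtains S where "monophonic_position G S" "card S = mp G"
proof -
  have "monophonic_position G {}"
    by (simp add: monophonic_position_def)
  then have "mp G \<in> card ` {S. monophonic_position G S}"
    unfolding mp_def using monophonic_position_finite by (intro Max_in) auto
  then show thesis
    using that by auto
qed

lemma gp_le_card: "gp G \<le> card (pverts G)"
proof -
  obtain S where "general_position G S" "card S = gp G"
    by (rule gp_attained)
  then show ?thesis
    using card_mono[OF pair_finite_verts, of S] by (simp add: general_position_def)
qed

lemma mp_le_card: "mp G \<le> card (pverts G)"
proof -
  obtain S where "monophonic_position G S" "card S = mp G"
    by (rule mp_attained)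
  then show ?thesis
    using card_mono[OF pair_finite_verts, of S] by (simp add: monophonic_position_def)
qed

lemma position_finite:
  "general_position G S \<Longrightarrow> finite S" "monophonic_position G S \<Longrightarrow> finite S"
  using pair_finite_verts
  by (auto simp: general_position_def monophonic_position_def intro: finite_subset)

lemma general_positionD:
  assumes "general_position G S" "geodesic G p" "x \<in> S" "y \<in> S" "z \<in> S" "{x, y, z} \<subseteq> set p"
  shows "x = y \<or> x = z \<or> y = z"
  using assms by (intro card_Int_le_2D) (auto simp: general_position_def)

lemma monophonic_positionD:
  assumes "monophonic_position G S" "monophonic_path G p"
    "x \<in> S" "y \<in> S" "z \<in> S" "{x, y, z} \<subseteq> set p"
  shows "x = y \<or> x = z \<or> y = z"
  using assms by (intro card_Int_le_2D) (auto simp: monophonic_position_def)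

lemma monophonic_positionI:
  assumes "S \<subseteq> pverts G"
    "\<And>p x y z. \<lbrakk>monophonic_path G p; {x, y, z} \<subseteq> set p; {x, y, z} \<subseteq> S; x \<noteq> y; x \<noteq> z; y \<noteq> z\<rbrakk> \<Longrightarrow> False"
  shows "monophonic_position G S"
  unfolding monophonic_position_def
proof (intro conjI allI impI)
  fix p assume p: "monophonic_path G p"
  show "card (S \<inter> set p) \<le> 2"
  proof (rule ccontr)
    assume "\<not> ?thesis"
    then have "3 \<le> card (S \<inter> set p)" by simp
    then obtain x y z where "x \<in> S \<inter> set p" "y \<in> S \<inter> set p" "z \<in> S \<inter> set p"
      "x \<noteq> y" "x \<noteq> z" "y \<noteq> z"
      by (rule ex_three_distinct)
    then show False
      using assms(2)[OF p, of x y z] by auto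
  qed
qed (use assms(1) in auto)

lemma general_positionI:
  assumes "S \<subseteq> pverts G"
    "\<And>p x y z. \<lbrakk>geodesic G p; {x, y, z} \<subseteq> set p; {x, y, z} \<subseteq> S; x \<noteq> y; x \<noteq> z; y \<noteq> z\<rbrakk> \<Longrightarrow> False"
  shows "general_position G S"
  unfolding general_position_def
proof (intro conjI allI impI)
  fix p assume p: "geodesic G p"
  show "card (S \<inter> set p) \<le> 2"
  proof (rule ccontr)
    assume "\<not> ?thesis"
    then have "3 \<le> card (S \<inter> set p)" by simp
    then obtain x y z where "x \<in> S \<inter> set p" "y \<in> S \<inter> set p" "z \<in> S \<inter> set p"
      "x \<noteq> y" "x \<noteq> z" "y \<noteq> z"
      by (rule ex_three_distinct)
    then show False
      using assms(2)[OF p, of x y z] by auto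
  qed
qed (use assms(1) in auto)

lemma monophonic_pair:
  assumes "S \<subseteq> pverts G" "card S \<le> 2"
  shows "monophonic_position G S"
proof -
  have "finite S"
    using assms(1) pair_finite_verts by (rule finite_subset)
  then have "card (S \<inter> set p) \<le> 2" for p
    using card_mono[of S "S \<inter> set p"] assms(2) by simp
  then show ?thesis
    using assms(1) by (simp add: monophonic_position_def)
qed

text \<open>A triple on no induced path is itself in monophonic position. The hypothesis on the
  order supplies a pair of vertices, and pairs are always in monophonic position.\<close>

lemma mp_eq_2_iff:
  assumes "2 \<le> card (pverts G)"
  shows "mp G = 2 \<longleftrightarrow>
    (\<forall>x\<in>pverts G. \<forall>y\<in>pverts G. \<forall>z\<in>pverts G. x \<noteq> y \<and> x \<noteq> z \<and> y \<noteq> z \<longrightarrow>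
       (\<exists>p. monophonic_path G p \<and> {x, y, z} \<subseteq> set p))" (is "_ \<longleftrightarrow> ?R")
proof
  assume mp: "mp G = 2"
  show ?R
  proof (intro ballI impI, rule ccontr)
    fix x y z assume xyz: "x \<in> pverts G" "y \<in> pverts G" "z \<in> pverts G"
      and d: "x \<noteq> y \<and> x \<noteq> z \<and> y \<noteq> z"
      and no: "\<nexists>p. monophonic_path G p \<and> {x, y, z} \<subseteq> set p"
    have "monophonic_position G {x, y, z}"
    proof (rule monophonic_positionI)
      fix p a b c assume "monophonic_path G p" "{a, b, c} \<subseteq> set p" "{a, b, c} \<subseteq> {x, y, z}"
        "a \<noteq> b" "a \<noteq> c" "b \<noteq> c"
      moreover from this have "{x, y, z} = {a, b, c}" by auto
      ultimately show False using no by metis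
    qed (use xyz in auto)
    then show False
      using card_le_mp[of "{x, y, z}"] mp d by simp
  qed
next
  assume R: ?R
  obtain T where "T \<subseteq> pverts G" "card T = 2"
    using assms by (meson obtain_subset_with_card_n)
  then have "2 \<le> mp G"
    using card_le_mp[of T] monophonic_pair[of T] by simp
  moreover have "mp G \<le> 2"
  proof (rule ccontr)
    assume "\<not> mp G \<le> 2"
    obtain S where S: "monophonic_position G S" "card S = mp G"
      by (rule mp_attained)
    then have "3 \<le> card S" using \<open>\<not> mp G \<le> 2\<close> by simp
    then obtain x y z where xyz: "x \<in> S" "y \<in> S" "z \<in> S" "x \<noteq> y" "x \<noteq> z" "y \<noteq> z"
      by (rule ex_three_distinct)
    then have "x \<in> pverts G" "y \<in> pverts G" "z \<in> pverts G"
      using S by (auto simp: monophonic_position_def)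
    then obtain p where "monophonic_path G p" "{x, y, z} \<subseteq> set p"
      using R xyz by blast
    then show False
      using monophonic_positionD[OF S(1), of p x y z] xyz by blast
  qed
  ultimately show "mp G = 2" by simp
qed

lemma vpath_rev: "vpath p (with_proj G) \<Longrightarrow> vpath (rev p) (with_proj G)"
  using arc_sym by (auto simp: vpath_iff successively_rev intro: successively_mono)

lemma geodesic_3:
  assumes "(x, y) \<in> parcs G" "(y, z) \<in> parcs G" "x \<noteq> z" "(x, z) \<notin> parcs G"
  shows "geodesic G [x, y, z]"
proof -
  have "x \<in> pverts G" "y \<in> pverts G" "z \<in> pverts G" "x \<noteq> y" "y \<noteq> z"
    using assms in_arcsD1 in_arcsD2 arc_irrefl by auto
  moreover have "3 \<le> length q" if "vpath q (with_proj G)" "hd q = x" "last q = z" for q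
  proof -
    have "q \<noteq> []" using that by (simp add: vpath_iff)
    then consider a where "q = [a]" | a b where "q = [a, b]" | "3 \<le> length q"
      by (cases q; cases "tl q"; cases "tl (tl q)") (auto simp: vpath_iff)
    then show ?thesis
      using that assms by cases (auto simp: vpath_iff)
  qed
  moreover from calculation assms have "vpath [x, y, z] (with_proj G)"
    by (simp add: vpath_iff)
  ultimately show ?thesis
    by (simp add: geodesic_iff eval_nat_numeral)
qed

lemma geodesic_4:
  assumes "(x, y) \<in> parcs G" "(y, z) \<in> parcs G" "(z, w) \<in> parcs G" "x \<noteq> w"
    "(x, w) \<notin> parcs G" "\<And>u. (x, u) \<in> parcs G \<Longrightarrow> (u, w) \<notin> parcs G"
  shows "geodesic G [x, y, z, w]"
proof -
  have "x \<in> pverts G" "y \<in> pverts G" "z \<in> pverts G" "w \<in> pverts G"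
    "x \<noteq> y" "y \<noteq> z" "z \<noteq> w" "x \<noteq> z" "y \<noteq> w"
    using assms in_arcsD1 in_arcsD2 arc_irrefl by auto
  moreover have "4 \<le> length q" if "vpath q (with_proj G)" "hd q = x" "last q = w" for q
  proof -
    have "q \<noteq> []" using that by (simp add: vpath_iff)
    then consider a where "q = [a]" | a b where "q = [a, b]" | a b c where "q = [a, b, c]"
      | "4 \<le> length q"
      by (cases q; cases "tl q"; cases "tl (tl q)"; cases "tl (tl (tl q))") auto
    then show ?thesis
      using that assms by cases (auto simp: vpath_iff)
  qed
  moreover from calculation assms have "vpath [x, y, z, w] (with_proj G)"
    by (simp add: vpath_iff)
  ultimately show ?thesis
    by (simp add: geodesic_iff eval_nat_numeral)
qed

text \<open>The assumptions from \<open>x \<noteq> v\<close> on exclude connections of length zero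
  to three; they also force the five vertices to be distinct, since a repetition would give a
  shorter connection.\<close>

lemma geodesic_5:
  assumes "(x, y) \<in> parcs G" "(y, z) \<in> parcs G" "(z, w) \<in> parcs G" "(w, v) \<in> parcs G" "x \<noteq> v"
    "(x, v) \<notin> parcs G" "\<And>u. (x, u) \<in> parcs G \<Longrightarrow> (u, v) \<notin> parcs G"
    "\<And>u t. (x, u) \<in> parcs G \<Longrightarrow> (t, v) \<in> parcs G \<Longrightarrow> (u, t) \<notin> parcs G"
  shows "geodesic G [x, y, z, w, v]"
proof -
  have "x \<in> pverts G" "y \<in> pverts G" "z \<in> pverts G" "w \<in> pverts G" "v \<in> pverts G"
    "x \<noteq> y" "y \<noteq> z" "z \<noteq> w" "x \<noteq> z" "y \<noteq> w" "x \<noteq> w" "w \<noteq> v" "z \<noteq> v" "y \<noteq> v"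
    using assms in_arcsD1 in_arcsD2 arc_irrefl by auto
  moreover have "5 \<le> length q" if "vpath q (with_proj G)" "hd q = x" "last q = v" for q
  proof -
    have "q \<noteq> []" using that by (simp add: vpath_iff)
    then consider a where "q = [a]" | a b where "q = [a, b]" | a b c where "q = [a, b, c]"
      | a b c d where "q = [a, b, c, d]" | "5 \<le> length q"
      by (cases q; cases "tl q"; cases "tl (tl q)"; cases "tl (tl (tl q))"; cases "tl (tl (tl (tl q)))")
        auto
    then show ?thesis
      using that assms by cases (auto simp: vpath_iff)
  qed
  moreover from calculation assms have "vpath [x, y, z, w, v] (with_proj G)"
    by (simp add: vpath_iff)
  ultimately show ?thesis
    by (simp add: geodesic_iff eval_nat_numeral)
qed

end

section \<open>Bounds on the minimum order\<close>

context
  fixes f :: "'a \<Rightarrow> 'b" and G :: "'a pair_pre_digraph" and H :: "'b pair_pre_digraph"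
  assumes inj: "inj f"
    and H: "H = \<lparr>pverts = f ` pverts G, parcs = map_prod f f ` parcs G\<rparr>"
begin

lemma image_verts: "pverts H = f ` pverts G"
  by (simp add: H)

lemma image_arc_iff: "(f u, f v) \<in> parcs H \<longleftrightarrow> (u, v) \<in> parcs G"
  using inj by (auto simp: H inj_eq)

lemma image_pair_graph:
  assumes "pair_graph G"
  shows "pair_graph H"
proof -
  interpret G: pair_graph G by fact
  show ?thesis
  proof
    show "finite (pverts H)" "finite (parcs H)"
      using G.pair_finite_verts G.pair_finite_arcs by (auto simp: H)
    show "fst e \<in> pverts H" "snd e \<in> pverts H" if "e \<in> parcs H" for e
      using that G.in_arcsD1 G.in_arcsD2 by (auto simp: H)
    show "fst e \<noteq> snd e" if "e \<in> parcs H" for e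
      using that G.arc_irrefl inj by (auto simp: H inj_eq)
    show "symmetric (with_proj H)"
      using G.arc_sym by (auto simp: H symmetric_def sym_def)
  qed
qed

lemma image_vpath: "vpath (map f p) (with_proj H) \<longleftrightarrow> vpath p (with_proj G)"
  using inj inj_on_subset[OF inj subset_UNIV, of "set p"]
  by (simp add: vpath_iff image_arc_iff image_verts successively_map distinct_map inj_image_subset_iff)

text \<open>Lets quantifiers over paths of \<open>H\<close> be replaced by quantifiers over lists of
  vertices of \<open>G\<close>.\<close>

lemma image_vpathD:
  assumes "vpath q (with_proj H)"
  obtains p where "q = map f p"
proof -
  have "q \<in> lists (f ` UNIV)"
    using assms by (auto simp: vpath_iff image_verts)
  then show thesis
    using that by (auto simp: lists_image)
qed

lemma image_monophonic: "monophonic_path H (map f p) \<longleftrightarrow> monophonic_path G p"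
  by (auto simp: monophonic_path_def image_vpath image_arc_iff)

lemma image_geodesic: "geodesic H (map f p) \<longleftrightarrow> geodesic G p"
proof
  assume H: "geodesic H (map f p)"
  show "geodesic G p"
    unfolding geodesic_iff
  proof (intro conjI allI impI)
    show "vpath p (with_proj G)" using H by (simp add: geodesic_iff image_vpath)
    fix q assume q: "vpath q (with_proj G) \<and> hd q = hd p \<and> last q = last p"
    then have "q \<noteq> []" "p \<noteq> []" using H by (auto simp: geodesic_iff vpath_iff)
    then have "length (map f p) \<le> length (map f q)"
      using H q by (simp add: geodesic_iff image_vpath hd_map last_map del: length_map)
    then show "length p \<le> length q" by simp
  qed
next
  assume G: "geodesic G p"
  show "geodesic H (map f p)"
    unfolding geodesic_iff
  proof (intro conjI allI impI)
    show "vpath (map f p) (with_proj H)" using G by (simp add: geodesic_iff image_vpath)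
    fix q assume q: "vpath q (with_proj H) \<and> hd q = hd (map f p) \<and> last q = last (map f p)"
    then obtain r where r: "q = map f r" by (meson image_vpathD)
    then have "vpath r (with_proj G)" using q by (simp add: image_vpath)
    moreover from this have "r \<noteq> []" "p \<noteq> []" using G by (auto simp: geodesic_iff vpath_iff)
    ultimately show "length (map f p) \<le> length q"
      using G q r inj by (simp add: geodesic_iff hd_map last_map inj_eq)
  qed
qed

lemma image_card_Int: "card (f ` S \<inter> set (map f p)) = card (S \<inter> set p)"
  using inj by (metis card_image image_Int inj_on_subset set_map subset_UNIV)

lemma image_general_position: "general_position H (f ` S) \<longleftrightarrow> general_position G S"
proof -
  have "(\<forall>q. geodesic H q \<longrightarrow> card (f ` S \<inter> set q) \<le> 2) \<longleftrightarrow>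
    (\<forall>p. geodesic H (map f p) \<longrightarrow> card (f ` S \<inter> set (map f p)) \<le> 2)"
    by (metis geodesic_iff image_vpathD)
  also have "\<dots> \<longleftrightarrow> (\<forall>p. geodesic G p \<longrightarrow> card (S \<inter> set p) \<le> 2)"
    unfolding image_geodesic image_card_Int ..
  finally have "(\<forall>q. geodesic H q \<longrightarrow> card (f ` S \<inter> set q) \<le> 2) \<longleftrightarrow>
    (\<forall>p. geodesic G p \<longrightarrow> card (S \<inter> set p) \<le> 2)" .
  then show ?thesis
    using inj by (auto simp: general_position_def image_verts inj_image_subset_iff)
qed

lemma image_monophonic_position: "monophonic_position H (f ` S) \<longleftrightarrow> monophonic_position G S"
proof -
  have "(\<forall>q. monophonic_path H q \<longrightarrow> card (f ` S \<inter> set q) \<le> 2) \<longleftrightarrow>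
    (\<forall>p. monophonic_path H (map f p) \<longrightarrow> card (f ` S \<inter> set (map f p)) \<le> 2)"
    by (metis monophonic_path_def image_vpathD)
  also have "\<dots> \<longleftrightarrow> (\<forall>p. monophonic_path G p \<longrightarrow> card (S \<inter> set p) \<le> 2)"
    unfolding image_monophonic image_card_Int ..
  finally have "(\<forall>q. monophonic_path H q \<longrightarrow> card (f ` S \<inter> set q) \<le> 2) \<longleftrightarrow>
    (\<forall>p. monophonic_path G p \<longrightarrow> card (S \<inter> set p) \<le> 2)" .
  then show ?thesis
    using inj by (auto simp: monophonic_position_def image_verts inj_image_subset_iff)
qed

lemma image_gp: "gp H = gp G"
proof -
  have "{S. general_position H S} = (`) f ` {S. general_position G S}"
  proof (intro set_eqI iffI)
    fix S assume "S \<in> {S. general_position H S}"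
    moreover from this obtain T where "S = f ` T"
      by (auto simp: general_position_def image_verts subset_image_iff)
    ultimately show "S \<in> (`) f ` {S. general_position G S}"
      by (simp add: image_general_position)
  qed (auto simp: image_general_position)
  then show ?thesis
    using inj by (simp add: gp_def image_image card_image[OF inj_on_subset[OF inj]])
qed

lemma image_mp: "mp H = mp G"
proof -
  have "{S. monophonic_position H S} = (`) f ` {S. monophonic_position G S}"
  proof (intro set_eqI iffI)
    fix S assume "S \<in> {S. monophonic_position H S}"
    moreover from this obtain T where "S = f ` T"
      by (auto simp: monophonic_position_def image_verts subset_image_iff)
    ultimately show "S \<in> (`) f ` {S. monophonic_position G S}"
      by (simp add: image_monophonic_position)
  qed (auto simp: image_monophonic_position)
  then show ?thesis
    using inj by (simp add: mp_def image_image card_image[OF inj_on_subset[OF inj]])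
qed

end

text \<open>The infimum ranges over graphs on the natural numbers. Relabelling by
  \<open>to_nat\<close> permits constructions over a datatype with one constructor for each kind of
  vertex.\<close>

lemma \<mu>_le_order:
  fixes G :: "'a::countable pair_pre_digraph"
  assumes "pair_graph G" "mp G = a" "gp G = b"
  shows "\<mu> a b \<le> enat (card (pverts G))"
proof -
  define H where "H = \<lparr>pverts = to_nat ` pverts G, parcs = map_prod to_nat to_nat ` parcs G\<rparr>"
  note H = inj_to_nat H_def
  have "card (pverts H) = card (pverts G)"
    by (simp add: H_def card_image)
  moreover have "H \<in> {H. pair_graph H \<and> mp H = a \<and> gp H = b}"
    using image_pair_graph[OF H] image_gp[OF H] image_mp[OF H] assms by simp
  ultimately show ?thesis
    unfolding \<mu>_def by (metis (mono_tags, lifting) INF_lower)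
qed

lemma \<mu>_ge:
  assumes "\<And>G :: nat pair_pre_digraph. \<lbrakk>pair_graph G; mp G = a; gp G = b\<rbrakk> \<Longrightarrow> n \<le> card (pverts G)"
  shows "enat n \<le> \<mu> a b"
  unfolding \<mu>_def using assms by (auto intro!: INF_greatest)

text \<open>
  With one vertex \<open>v\<close> outside \<open>S\<close>, an induced path with three vertices in \<open>S\<close> has either three
  consecutive ones or consecutive vertices \<open>x, y, v, z\<close>. In the latter case the path is a geodesic
  or \<open>x\<close> and \<open>z\<close> have a common neighbour in \<open>S\<close>.
\<close>

lemma (in pair_graph) order_ge_if_mp_less_gp:
  assumes "mp G < gp G"
  shows "gp G + 2 \<le> card (pverts G)"
proof (rule ccontr)
  assume *: "\<not> ?thesis"
  obtain S where S: "general_position G S" "card S = gp G"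
    by (rule gp_attained)
  have SV: "S \<subseteq> pverts G" using S by (simp add: general_position_def)
  have "card (pverts G - S) \<le> 1"
    using * S(2) SV by (simp add: card_Diff_subset finite_subset[OF SV pair_finite_verts])
  then have outside: "u = v" if "u \<in> pverts G - S" "v \<in> pverts G - S" for u v
    using that pair_finite_verts by (metis card_le_Suc0_iff_eq One_nat_def finite_Diff)
  have "monophonic_position G S"
  proof (rule monophonic_positionI[OF SV])
    fix p a b c
    assume p: "monophonic_path G p" and abc: "{a, b, c} \<subseteq> set p" "{a, b, c} \<subseteq> S"
      "a \<noteq> b" "a \<noteq> c" "b \<noteq> c"
    have V: "set p \<subseteq> pverts G" and dist: "distinct p"
      and arc: "\<And>i. Suc i < length p \<Longrightarrow> (p ! i, p ! Suc i) \<in> parcs G"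
      and ind: "\<And>i j. \<lbrakk>i < length p; j < length p; (p ! i, p ! j) \<in> parcs G\<rbrakk> \<Longrightarrow> j = Suc i \<or> i = Suc j"
      using p by (auto simp: monophonic_path_iff successively_conv_nth)
    have neq: "p ! i \<noteq> p ! j" if "i < length p" "j < length p" "i \<noteq> j" for i j
      using dist that by (simp add: nth_eq_iff_index_eq)
    have out: "p ! i \<in> S \<or> p ! j \<in> S" if "i < length p" "j < length p" "i \<noteq> j" for i j
      using outside[of "p ! i" "p ! j"] neq[OF that] V that by (auto dest: nth_mem)
    have no3: "\<not> (x \<in> S \<and> y \<in> S \<and> z \<in> S)"
      if "(x, y) \<in> parcs G" "(y, z) \<in> parcs G" "x \<noteq> z" "(x, z) \<notin> parcs G" for x y z
      using general_positionD[OF S(1) geodesic_3[OF that], of x y z] that arc_irrefl by auto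
    have no3': "\<not> (p ! i \<in> S \<and> p ! Suc i \<in> S \<and> p ! Suc (Suc i) \<in> S)" if "Suc (Suc i) < length p" for i
    proof (rule no3[of "p ! i" "p ! Suc i" "p ! Suc (Suc i)"])
      show "(p ! i, p ! Suc (Suc i)) \<notin> parcs G"
        using ind[of i "Suc (Suc i)"] that by auto
    qed (use that arc neq in auto)
    have no4: False
      if "(x, y) \<in> parcs G" "(y, v) \<in> parcs G" "(v, z) \<in> parcs G" "x \<noteq> z" "(x, z) \<notin> parcs G"
        "x \<in> S" "y \<in> S" "z \<in> S" "v \<notin> S" "(x, v) \<notin> parcs G" "y \<noteq> z" for x y v z
    proof (cases "\<exists>u. (x, u) \<in> parcs G \<and> (u, z) \<in> parcs G")
      case True
      then obtain u where u: "(x, u) \<in> parcs G" "(u, z) \<in> parcs G" by blast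
      then have "u \<noteq> v" using that by blast
      then have "u \<in> S"
        using outside[of u v] that u in_arcsD1 in_arcsD2 by blast
      then show False using no3[OF u] that by blast
    next
      case False
      then show False
        using general_positionD[OF S(1) geodesic_4[OF that(1-5)], of x y z] that arc_irrefl by auto
    qed
    have no4': False
      if "Suc (Suc (Suc i)) < length p" "p ! i \<in> S" "p ! Suc i \<in> S" "p ! Suc (Suc (Suc i)) \<in> S" for i
    proof (rule no4[of "p ! i" "p ! Suc i" "p ! Suc (Suc i)" "p ! Suc (Suc (Suc i))"])
      show "p ! Suc (Suc i) \<notin> S" using no3'[of i] that by simp
      show "(p ! i, p ! Suc (Suc (Suc i))) \<notin> parcs G" "(p ! i, p ! Suc (Suc i)) \<notin> parcs G"
        using ind[of i "Suc (Suc (Suc i))"] ind[of i "Suc (Suc i)"] that by auto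
    qed (use that arc neq in auto)
    have no4'': False
      if "Suc (Suc (Suc i)) < length p" "p ! i \<in> S" "p ! Suc (Suc i) \<in> S" "p ! Suc (Suc (Suc i)) \<in> S" for i
    proof (rule no4[of "p ! Suc (Suc (Suc i))" "p ! Suc (Suc i)" "p ! Suc i" "p ! i"])
      show "p ! Suc i \<notin> S" using no3'[of i] that by auto
      show "(p ! Suc (Suc (Suc i)), p ! i) \<notin> parcs G" "(p ! Suc (Suc (Suc i)), p ! Suc i) \<notin> parcs G"
        using ind[of "Suc (Suc (Suc i))" i] ind[of "Suc (Suc (Suc i))" "Suc i"] that by auto
    qed (use that arc arc_sym neq in auto)
    obtain i j k where ijk: "i < j" "j < k" "k < length p" "p ! i \<in> S" "p ! j \<in> S" "p ! k \<in> S"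
      using ex_sorted_indices[OF abc(1,3,4,5)] abc(2) by (metis insert_subset)
    \<comment> \<open>Three consecutive members of \<open>S\<close> are excluded by
      \<open>no3'\<close>, so the only vertex outside \<open>S\<close> is at \<open>Suc i\<close> or
      \<open>Suc (Suc i)\<close>. The path then reaches position \<open>Suc (Suc (Suc i))\<close>,
      which is again in \<open>S\<close>.\<close>
    show False
    proof (cases "p ! Suc i \<in> S")
      case i1: True
      show False
      proof (cases "p ! Suc (Suc i) \<in> S")
        case True
        then show False using no3'[of i] ijk i1 by simp
      next
        case False
        then have "k \<noteq> Suc (Suc i)" using ijk by auto
        then have "Suc (Suc (Suc i)) < length p" using ijk by simp
        then show False using out[of "Suc (Suc i)" "Suc (Suc (Suc i))"] False no4'[of i] ijk i1 by simp
      qed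
    next
      case False
      then have "j \<noteq> Suc i" using ijk by auto
      then have "Suc (Suc (Suc i)) < length p" using ijk by simp
      then show False
        using out[of "Suc i" "Suc (Suc i)"] out[of "Suc i" "Suc (Suc (Suc i))"] False no4''[of i] ijk
        by simp
    qed
  qed
  then show False
    using card_le_mp[of S] S assms by simp
qed

lemma complete_graph_numbers:
  assumes "finite V"
  defines "G \<equiv> \<lparr>pverts = V, parcs = {(u, v). u \<in> V \<and> v \<in> V \<and> u \<noteq> v}\<rparr>"
  shows "pair_graph G" "mp G = card V" "gp G = card V"
proof -
  show G: "pair_graph G"
  proof
    show "finite (parcs G)"
      by (rule finite_subset[of _ "V \<times> V"]) (auto simp: G_def assms(1))
  qed (use assms(1) in \<open>auto simp: G_def symmetric_def sym_def\<close>)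
  interpret pair_graph G by fact
  have mono: "monophonic_position G V"
  proof (rule monophonic_positionI)
    fix p x y z assume p: "monophonic_path G p" "{x, y, z} \<subseteq> set p" "x \<noteq> y" "x \<noteq> z" "y \<noteq> z"
    then have "3 \<le> length p"
      using three_le_card[of "set p" x y z] card_length[of p] by (auto intro: order_trans)
    have "p ! 0 \<in> V" "p ! 2 \<in> V" "p ! 0 \<noteq> p ! 2"
      using p(1) nth_mem[of 0 p] nth_mem[of 2 p] \<open>3 \<le> length p\<close>
      by (auto simp: monophonic_path_iff G_def nth_eq_iff_index_eq simp del: nth_mem)
    then have "(p ! 0, p ! 2) \<in> parcs G"
      by (simp add: G_def)
    moreover have "0 < length p" "2 < length p" using \<open>3 \<le> length p\<close> by auto
    ultimately have "(2::nat) = Suc 0 \<or> (0::nat) = Suc 2"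
      using p(1) unfolding monophonic_path_iff by blast
    then show False by simp
  qed (simp add: G_def)
  moreover have "general_position G V"
  proof (rule general_positionI)
    fix p x y z assume p: "geodesic G p" "{x, y, z} \<subseteq> set p" "x \<noteq> y" "x \<noteq> z" "y \<noteq> z"
    then have "3 \<le> length p"
      using three_le_card[of "set p" x y z] card_length[of p] by (auto intro: order_trans)
    moreover have "length p \<le> 2"
    proof -
      have "p \<noteq> []" "distinct p" "set p \<subseteq> V" using p(1) by (auto simp: geodesic_iff vpath_iff G_def)
      then have "vpath [hd p, last p] (with_proj G)"
        using \<open>3 \<le> length p\<close> by (cases p) (auto simp: vpath_iff G_def)
      then show ?thesis using p(1) by (auto simp: geodesic_iff)
    qed
    ultimately show False by simp
  qed (simp add: G_def)
  ultimately show "gp G = card V" "mp G = card V"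
    using card_le_gp[of V] card_le_mp[of V] gp_le_card mp_le_card
    by (simp_all add: G_def antisym)
qed

lemma \<mu>_diag: "\<mu> a a = enat a"
proof (rule antisym)
  show "\<mu> a a \<le> enat a"
    using \<mu>_le_order[OF complete_graph_numbers, of "{..<a}"] by simp
  show "enat a \<le> \<mu> a a"
    by (rule \<mu>_ge) (metis pair_graph.gp_le_card)
qed

section \<open>Recognising paths and positions\<close>

lemma length_vwalk_to_vpath: "length (vwalk_to_vpath p) \<le> length p"
proof (induction p rule: vwalk_to_vpath_induct3)
  case (in_set x xs)
  then show ?case
    using length_dropWhile_le[of "\<lambda>y. y \<noteq> x" xs] by simp
qed auto

text \<open>A recursive form of chordlessness, so that explicit paths can be checked by
  \<open>simp\<close> and \<open>code_simp\<close>. Only pairs in list order are examined, which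
  suffices for a symmetric irreflexive relation.\<close>

fun induced :: "'a rel \<Rightarrow> 'a list \<Rightarrow> bool" where
  "induced E [] \<longleftrightarrow> True"
| "induced E [x] \<longleftrightarrow> True"
| "induced E (x # y # zs) \<longleftrightarrow> (x, y) \<in> E \<and> (\<forall>z\<in>set zs. (x, z) \<notin> E) \<and> induced E (y # zs)"

lemma induced_iff:
  "induced E p \<longleftrightarrow> successively (\<lambda>u v. (u, v) \<in> E) p \<and>
     (\<forall>j<length p. \<forall>i<j. (p ! i, p ! j) \<in> E \<longrightarrow> j = Suc i)"
proof (induction E p rule: induced.induct)
  case (3 E x y zs)
  have "(\<forall>j<length (x # y # zs). \<forall>i<j. ((x # y # zs) ! i, (x # y # zs) ! j) \<in> E \<longrightarrow> j = Suc i) \<longleftrightarrow>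
    (\<forall>j<length (y # zs). (x, (y # zs) ! j) \<in> E \<longrightarrow> j = 0) \<and>
    (\<forall>j<length (y # zs). \<forall>i<j. ((y # zs) ! i, (y # zs) ! j) \<in> E \<longrightarrow> j = Suc i)"
    by (auto simp: All_less_Suc2)
  also have "(\<forall>j<length (y # zs). (x, (y # zs) ! j) \<in> E \<longrightarrow> j = 0) \<longleftrightarrow> (\<forall>z\<in>set zs. (x, z) \<notin> E)"
    by (auto simp: All_less_Suc2 all_set_conv_all_nth)
  finally show ?case
    using 3 by auto
qed auto

context pair_graph
begin

lemma monophonic_path_iff_induced:
  "monophonic_path G p \<longleftrightarrow> p \<noteq> [] \<and> distinct p \<and> set p \<subseteq> pverts G \<and> induced (parcs G) p"
proof -
  have "(\<forall>i < length p. \<forall>j < length p. (p ! i, p ! j) \<in> parcs G \<longrightarrow> j = Suc i \<or> i = Suc j) \<longleftrightarrow>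
     (\<forall>j<length p. \<forall>i<j. (p ! i, p ! j) \<in> parcs G \<longrightarrow> j = Suc i)"
    (is "?L \<longleftrightarrow> ?R")
  proof
    assume R: ?R
    show ?L
    proof (intro allI impI)
      fix i j assume "i < length p" "j < length p" "(p ! i, p ! j) \<in> parcs G"
      then show "j = Suc i \<or> i = Suc j"
        using R arc_irrefl arc_sym by (cases i j rule: linorder_cases) auto
    qed
  next
    assume L: ?L
    show ?R
    proof (intro allI impI)
      fix i j assume "j < length p" "i < j" "(p ! i, p ! j) \<in> parcs G"
      then show "j = Suc i"
        using L[rule_format, of i j] by linarith
    qed
  qed
  then show ?thesis
    by (auto simp: monophonic_path_iff induced_iff)
qed

lemma monophonic_path_map:
  assumes "0 < n" "inj_on f {..<n}" "f ` {..<n} \<subseteq> pverts G"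
    "\<And>i j. \<lbrakk>i < j; j < n\<rbrakk> \<Longrightarrow> (f i, f j) \<in> parcs G \<longleftrightarrow> j = Suc i"
  shows "monophonic_path G (map f [0..<n])"
  using assms
  by (auto simp: monophonic_path_iff_induced induced_iff distinct_map atLeast0LessThan successively_conv_nth)

text \<open>On an induced path a vertex is adjacent only to its predecessor and its successor. Most
  refutations of induced paths below exhibit a third neighbour.\<close>

lemma monophonic_path_degree:
  assumes "monophonic_path G p" "{u, x, y, z} \<subseteq> set p" "x \<noteq> y" "x \<noteq> z" "y \<noteq> z"
    "(u, x) \<in> parcs G" "(u, y) \<in> parcs G" "(u, z) \<in> parcs G"
  shows False
proof -
  obtain m i j k where "m < length p" "i < length p" "j < length p" "k < length p"
    "p ! m = u" "p ! i = x" "p ! j = y" "p ! k = z"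
    using assms(2) by (auto simp: in_set_conv_nth)
  moreover from this have "i = Suc m \<or> m = Suc i" "j = Suc m \<or> m = Suc j" "k = Suc m \<or> m = Suc k"
    using assms(1,6-8) by (auto simp: monophonic_path_def)
  ultimately show False
    using assms(3-5) by auto
qed

text \<open>The middle one of the three vertices has both a predecessor and a successor on the
  path.\<close>

lemma monophonic_path_interior:
  assumes "monophonic_path G p" "{x, y, z} \<subseteq> set p" "x \<noteq> y" "x \<noteq> z" "y \<noteq> z"
  obtains w a b where "w \<in> {x, y, z}" "a \<in> set p" "b \<in> set p" "a \<noteq> b"
    "(w, a) \<in> parcs G" "(w, b) \<in> parcs G"
proof -
  obtain i j k where ijk: "i < j" "j < k" "k < length p" "{p ! i, p ! j, p ! k} = {x, y, z}"
    using ex_sorted_indices[OF assms(2-5)] .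
  have arc: "(p ! m, p ! Suc m) \<in> parcs G" if "Suc m < length p" for m
    using assms(1) that by (auto simp: monophonic_path_iff successively_conv_nth)
  obtain j' where j': "j = Suc j'" using ijk(1) by (cases j) auto
  show thesis
  proof
    show "p ! j \<in> {x, y, z}" using ijk(4) by blast
    show "p ! j' \<in> set p" "p ! Suc j \<in> set p" using ijk j' by auto
    show "p ! j' \<noteq> p ! Suc j"
      using assms(1) ijk j' by (auto simp: monophonic_path_iff nth_eq_iff_index_eq)
    show "(p ! j, p ! j') \<in> parcs G" "(p ! j, p ! Suc j) \<in> parcs G"
      using arc[of j'] arc[of j] arc_sym ijk j' by auto
  qed
qed

lemma monophonic_3:
  assumes "(x, y) \<in> parcs G" "(y, z) \<in> parcs G" "x \<noteq> z" "(x, z) \<notin> parcs G"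
  shows "monophonic_path G [x, y, z]"
  using assms in_arcsD1 in_arcsD2 arc_irrefl by (auto simp: monophonic_path_iff_induced)

text \<open>A walk shortens to a path with the same ends, so a shortcut need not be checked for
  repeated vertices.\<close>

lemma geodesic_le_walk:
  assumes "geodesic G p" "q \<noteq> []" "set q \<subseteq> pverts G" "successively (\<lambda>u v. (u, v) \<in> parcs G) q"
    "hd q = hd p" "last q = last p"
  shows "length p \<le> length q"
proof -
  have "vwalk q (with_proj G)"
    using assms by (auto simp: vwalk_def vwalk_arcs_subset_iff)
  then have "vpath (vwalk_to_vpath q) (with_proj G)"
    by (rule vwalk_to_vpath_vpath)
  then have "length p \<le> length (vwalk_to_vpath q)"
    using assms by (auto simp: geodesic_iff vwalk_to_vpath_hd vwalk_to_vpath_last)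
  then show ?thesis
    using length_vwalk_to_vpath[of q] by simp
qed

text \<open>If a geodesic met \<open>S\<close> three times, the segment from the first to the last
  of these vertices could be replaced by a connection with at most one inner vertex. This shortens
  the geodesic unless the three are consecutive, and then they violate \<open>no_P3\<close>.\<close>

lemma general_position_diameter_2:
  assumes S: "S \<subseteq> pverts G"
    and near: "\<And>x y. \<lbrakk>x \<in> S; y \<in> S; x \<noteq> y\<rbrakk> \<Longrightarrow>
      (x, y) \<in> parcs G \<or> (\<exists>u. (x, u) \<in> parcs G \<and> (u, y) \<in> parcs G)"
    and no_P3: "\<And>x y z. \<lbrakk>x \<in> S; y \<in> S; z \<in> S; (x, y) \<in> parcs G; (y, z) \<in> parcs G; x \<noteq> z\<rbrakk> \<Longrightarrow> False"
  shows "general_position G S"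
proof (rule general_positionI[OF S])
  fix p x y z assume p: "geodesic G p" and xyz: "{x, y, z} \<subseteq> set p" "{x, y, z} \<subseteq> S"
    "x \<noteq> y" "x \<noteq> z" "y \<noteq> z"
  then obtain i j k where ijk: "i < j" "j < k" "k < length p" "{p ! i, p ! j, p ! k} = {x, y, z}"
    using ex_sorted_indices by metis
  have inS: "p ! i \<in> S" "p ! j \<in> S" "p ! k \<in> S" using ijk(4) xyz(2) by auto
  have path: "distinct p" "set p \<subseteq> pverts G" "successively (\<lambda>u v. (u, v) \<in> parcs G) p"
    using p by (auto simp: geodesic_iff vpath_iff)
  have "p ! i \<noteq> p ! k" using path ijk by (auto simp: nth_eq_iff_index_eq)
  \<comment> \<open>\<open>us\<close> lists the inner vertices of the short connection, of which
    there is at most one.\<close>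
  then obtain us where us: "successively (\<lambda>u v. (u, v) \<in> parcs G) (p ! i # us @ [p ! k])" "length us \<le> 1"
    using near[OF inS(1,3)]
    by (metis append.simps(1,2) le_numeral_extra(3,4) length_Cons list.size(3) One_nat_def
        successively.simps(2,3) zero_le_one)
  define q where "q = take (Suc i) p @ us @ drop k p"
  have tk: "take (Suc i) p \<noteq> []" "drop k p \<noteq> []" "last (take (Suc i) p) = p ! i" "hd (drop k p) = p ! k"
    using ijk by (auto simp: take_Suc_conv_app_nth hd_drop_conv_nth)
  have sd: "successively (\<lambda>u v. (u, v) \<in> parcs G) (take (Suc i) p)"
    "successively (\<lambda>u v. (u, v) \<in> parcs G) (drop k p)"
    using path(3) by (metis append_take_drop_id successively_append_iff)+
  have "length p \<le> length q"
  proof (rule geodesic_le_walk[OF p])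
    show "q \<noteq> []" using ijk by (auto simp: q_def)
    show "set q \<subseteq> pverts G"
      using path(2) us in_arcsD1 in_arcsD2 set_take_subset[of "Suc i" p] set_drop_subset[of k p]
      by (cases us; cases "tl us") (auto simp: q_def)
    show "successively (\<lambda>u v. (u, v) \<in> parcs G) q"
      using sd tk us by (cases us) (auto simp: q_def successively_append_iff successively_Cons)
    show "hd q = hd p" "last q = last p"
      using tk ijk by (auto simp: q_def last_drop)
  qed
  then have "k = Suc (Suc i)" "j = Suc i" using ijk us(2) by (auto simp: q_def)
  then have "(p ! i, p ! j) \<in> parcs G" "(p ! j, p ! k) \<in> parcs G"
    using path(3) ijk(3) by (simp_all add: successively_conv_nth)
  then show False
    using no_P3 inS \<open>p ! i \<noteq> p ! k\<close> by blast
qed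

end

definition graph_on :: "'a set \<Rightarrow> ('a \<Rightarrow> 'a \<Rightarrow> bool) \<Rightarrow> 'a pair_pre_digraph" where
  "graph_on V adj = \<lparr>pverts = V, parcs = {(u, v). u \<in> V \<and> v \<in> V \<and> (adj u v \<or> adj v u)}\<rparr>"

lemma graph_on_simps [simp]:
  "pverts (graph_on V adj) = V"
  "(u, v) \<in> parcs (graph_on V adj) \<longleftrightarrow> u \<in> V \<and> v \<in> V \<and> (adj u v \<or> adj v u)"
  by (auto simp: graph_on_def)

lemma pair_graph_graph_on:
  assumes "finite V" "\<And>v. v \<in> V \<Longrightarrow> \<not> adj v v"
  shows "pair_graph (graph_on V adj)"
proof
  show "finite (parcs (graph_on V adj))"
    by (rule finite_subset[of _ "V \<times> V"]) (auto simp: graph_on_def assms(1))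
qed (use assms in \<open>auto simp: graph_on_def symmetric_def sym_def\<close>)

section \<open>Lower bounds for monophonic position number two\<close>

text \<open>Connectedness of a path: from \<open>a\<close> all positions are reached by steps up and
  down. The lemma serves to confine a path to a few vertices and so contradict a further vertex on
  it.\<close>

lemma (in pair_graph) monophonic_path_closed:
  assumes p: "monophonic_path G p" and A: "a \<in> set p" "a \<in> A"
    and closed: "\<And>x y. \<lbrakk>x \<in> A; x \<in> set p; y \<in> set p; (x, y) \<in> parcs G\<rbrakk> \<Longrightarrow> y \<in> A"
  shows "set p \<subseteq> A"
proof -
  have arc: "(p ! m, p ! Suc m) \<in> parcs G" if "Suc m < length p" for m
    using p that by (auto simp: monophonic_path_iff successively_conv_nth)
  obtain i where i: "i < length p" "p ! i = a"
    using A by (auto simp: in_set_conv_nth)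
  have up: "i + m < length p \<Longrightarrow> p ! (i + m) \<in> A" for m
  proof (induction m)
    case (Suc m)
    then show ?case using closed[of "p ! (i + m)" "p ! Suc (i + m)"] arc[of "i + m"] by simp
  qed (use i A in simp)
  have down: "m \<le> i \<Longrightarrow> p ! (i - m) \<in> A" for m
  proof (induction m)
    case (Suc m)
    then have eq: "Suc (i - Suc m) = i - m" by simp
    then have "(p ! (i - m), p ! (i - Suc m)) \<in> parcs G"
      using arc[of "i - Suc m"] arc_sym i by simp
    then show ?case using closed[of "p ! (i - m)" "p ! (i - Suc m)"] Suc i by simp
  qed (use i A in simp)
  show ?thesis
  proof
    fix x assume "x \<in> set p"
    then obtain j where "j < length p" "p ! j = x" by (auto simp: in_set_conv_nth)
    then show "x \<in> A"
      using up[of "j - i"] down[of "i - j"] by (cases "i \<le> j") auto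
  qed
qed

text \<open>The segment of \<open>p\<close> between the two vertices is a path, so a shortest one
  exists; this replaces a connectedness assumption.\<close>

lemma (in pair_graph) geodesic_between:
  assumes p: "monophonic_path G p" and xy: "x \<in> set p" "y \<in> set p"
  obtains q where "geodesic G q" "hd q = x" "last q = y"
proof -
  let ?P = "\<lambda>q. vpath q (with_proj G) \<and> hd q = x \<and> last q = y"
  have sub: "\<exists>q. vpath q (with_proj G) \<and> hd q = p ! i \<and> last q = p ! j" if "i \<le> j" "j < length p" for i j
  proof (intro exI conjI)
    have "p = take i p @ take (Suc j - i) (drop i p) @ drop (Suc j - i) (drop i p)"
      by (simp only: append_take_drop_id)
    then have "successively (\<lambda>u v. (u, v) \<in> parcs G) (take (Suc j - i) (drop i p))"
      using p unfolding monophonic_path_iff by (metis successively_append_iff)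
    then show "vpath (take (Suc j - i) (drop i p)) (with_proj G)"
      using p that by (auto simp: vpath_iff monophonic_path_iff dest!: in_set_takeD in_set_dropD)
    show "hd (take (Suc j - i) (drop i p)) = p ! i" "last (take (Suc j - i) (drop i p)) = p ! j"
      using that by (auto simp: hd_drop_conv_nth last_conv_nth)
  qed
  obtain i j where ij: "i < length p" "j < length p" "p ! i = x" "p ! j = y"
    using xy by (auto simp: in_set_conv_nth)
  have "\<exists>q. ?P q"
  proof (cases "i \<le> j")
    case True
    then show ?thesis using sub[of i j] ij by simp
  next
    case False
    then obtain q where q: "vpath q (with_proj G)" "hd q = y" "last q = x" using sub[of j i] ij by auto
    then have "q \<noteq> []" by (simp add: vpath_iff)
    then show ?thesis
      using q vpath_rev[of q] by (intro exI[of _ "rev q"]) (simp add: hd_rev last_rev)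
  qed
  then obtain q where q: "?P q" "\<And>r. ?P r \<Longrightarrow> length q \<le> length r"
    using ex_has_least_nat[of ?P _ length] by blast
  then have "geodesic G q" by (auto simp: geodesic_iff)
  then show thesis using that q(1) by blast
qed

section \<open>A general position set and its complement when every triple lies on an induced
  path\<close>

locale mp_2_partition = pair_graph G for G :: "'a pair_pre_digraph" +
  fixes S T
  assumes mp2: "mp G = 2" and S: "general_position G S" and card_S: "3 \<le> card S"
    and T: "T = pverts G - S"
begin

lemma S_V: "S \<subseteq> pverts G"
  using S by (simp add: general_position_def)

lemma finite_S: "finite S"
  using S_V pair_finite_verts by (rule finite_subset)

lemma finite_T: "finite T"
  using pair_finite_verts T by simp

lemma monophonic_through:
  assumes "{x, y, z} \<subseteq> pverts G" "x \<noteq> y" "x \<noteq> z" "y \<noteq> z"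
  obtains p where "monophonic_path G p" "x \<in> set p" "y \<in> set p" "z \<in> set p"
proof -
  have "2 \<le> card (pverts G)"
    using card_S card_mono[OF pair_finite_verts S_V] by simp
  then show thesis
    using mp2 mp_eq_2_iff assms that by (metis insert_subset)
qed

lemma third_vertex:
  obtains z where "z \<in> S" "z \<noteq> x" "z \<noteq> y"
proof -
  have "card {x, y} < card S"
    using card_S by (simp add: card_insert_if)
  then have "\<not> S \<subseteq> {x, y}"
    using card_mono[of "{x, y}" S] by auto
  then show thesis using that by blast
qed

lemma path_neighbour:
  assumes "monophonic_path G p" "x \<in> set p" "y \<in> set p" "x \<noteq> y"
  obtains u where "u \<in> set p" "(x, u) \<in> parcs G"
  using monophonic_path_closed[OF assms(1,2), of "{x}"] assms that by blast

lemma path_degree: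
  assumes "monophonic_path G p" "u \<in> set p" "x \<in> set p" "y \<in> set p" "z \<in> set p"
    "(x, u) \<in> parcs G" "(y, u) \<in> parcs G" "(z, u) \<in> parcs G"
  shows "x = y \<or> x = z \<or> y = z"
  using monophonic_path_degree[OF assms(1), of u x y z] assms arc_sym[of _ u] by auto

text \<open>On an induced path through a triangle, the first and the last of its vertices would be
  adjacent without being consecutive.\<close>

lemma triangle_free:
  assumes "(x, y) \<in> parcs G" "(y, z) \<in> parcs G" "(x, z) \<in> parcs G"
  shows False
proof -
  have d: "x \<noteq> y" "x \<noteq> z" "y \<noteq> z" and V: "{x, y, z} \<subseteq> pverts G"
    using assms arc_irrefl in_arcsD1 in_arcsD2 by auto
  obtain p where p: "monophonic_path G p" "x \<in> set p" "y \<in> set p" "z \<in> set p"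
    using monophonic_through[OF V d] .
  then have "{x, y, z} \<subseteq> set p" by simp
  then obtain i j k where ijk: "i < j" "j < k" "k < length p" "{p ! i, p ! j, p ! k} = {x, y, z}"
    using ex_sorted_indices d by metis
  have "p ! i \<in> {x, y, z}" "p ! k \<in> {x, y, z}" "p ! i \<noteq> p ! k"
    using ijk p(1) by (auto simp: monophonic_path_iff nth_eq_iff_index_eq)
  then have "(p ! i, p ! k) \<in> parcs G"
    using assms assms[THEN arc_sym] by auto
  moreover have "i < length p" using ijk by simp
  ultimately have "k = Suc i \<or> i = Suc k"
    using p(1) ijk(3) unfolding monophonic_path_def by blast
  then show False
    using ijk(1,2) by simp
qed

text \<open>As there are no triangles, distinct \<open>x\<close> and \<open>z\<close> would make
  \<open>[x, y, z]\<close> a geodesic with three vertices in \<open>S\<close>.\<close>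

lemma matching:
  assumes "x \<in> S" "y \<in> S" "z \<in> S" "(x, y) \<in> parcs G" "(y, z) \<in> parcs G"
  shows "x = z"
proof (rule ccontr)
  assume "x \<noteq> z"
  moreover from this have "(x, z) \<notin> parcs G" using triangle_free assms by blast
  ultimately have "geodesic G [x, y, z]" using geodesic_3 assms by blast
  then show False
    using general_positionD[OF S, of "[x, y, z]" x y z] assms arc_irrefl \<open>x \<noteq> z\<close> by auto
qed

lemma nonadjacent_vertex:
  assumes "x \<in> S"
  obtains s where "s \<in> S" "s \<noteq> x" "(x, s) \<notin> parcs G"
proof -
  obtain a where a: "a \<in> S" "a \<noteq> x" by (rule third_vertex)
  obtain b where b: "b \<in> S" "b \<noteq> x" "b \<noteq> a" by (rule third_vertex)
  show thesis
    using that a b matching[of a x b] assms arc_sym by blast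
qed

text \<open>\<open>G\<close> is connected, because any two vertices lie with a third one on an
  induced path.\<close>

lemma geodesic_from_to:
  assumes "x \<in> pverts G" "y \<in> pverts G" "x \<noteq> y"
  obtains q where "geodesic G q" "hd q = x" "last q = y"
proof -
  obtain z where "z \<in> S" "z \<noteq> x" "z \<noteq> y" by (rule third_vertex)
  then have "{x, y, z} \<subseteq> pverts G" "x \<noteq> z" "y \<noteq> z" using assms S_V by auto
  then obtain p where "monophonic_path G p" "x \<in> set p" "y \<in> set p"
    using monophonic_through assms(3) by metis
  then show thesis using geodesic_between that by metis
qed

definition N where "N v = {t \<in> T. (v, t) \<in> parcs G}"

lemma T_iff: "t \<in> T \<longleftrightarrow> t \<in> pverts G \<and> t \<notin> S"
  by (simp add: T)

lemma N_T: "N v \<subseteq> T"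
  by (auto simp: N_def)

lemma finite_N: "finite (N v)"
  using N_T finite_T by (rule finite_subset)

lemma N_arc: "t \<in> N v \<Longrightarrow> (v, t) \<in> parcs G" "t \<in> N v \<Longrightarrow> (t, v) \<in> parcs G"
  using arc_sym by (auto simp: N_def)

lemma arc_cases: "(v, u) \<in> parcs G \<Longrightarrow> u \<in> S \<or> u \<in> N v"
  using in_arcsD2 by (auto simp: N_def T_iff)

lemma N_not_S: "t \<in> N v \<Longrightarrow> t \<notin> S"
  by (simp add: N_def T_iff)

lemma N_disjoint: "(x, y) \<in> parcs G \<Longrightarrow> N x \<inter> N y = {}"
  using triangle_free N_arc by blast

text \<open>If all neighbours of \<open>x\<close> were in \<open>S\<close>, a geodesic from
  \<open>x\<close> to a nonadjacent vertex of \<open>S\<close> would have its second vertex in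
  \<open>S\<close> too.\<close>

lemma N_nonempty:
  assumes "x \<in> S"
  shows "N x \<noteq> {}"
proof
  assume empty: "N x = {}"
  obtain s where s: "s \<in> S" "s \<noteq> x" "(x, s) \<notin> parcs G"
    using nonadjacent_vertex[OF assms] .
  obtain q where q: "geodesic G q" "hd q = x" "last q = s"
    using geodesic_from_to[of x s] assms s S_V by blast
  obtain u q' where q': "q = x # u # q'"
  proof (cases q)
    case (Cons a r)
    then show ?thesis using q s that by (cases r) auto
  qed (use q in \<open>simp add: geodesic_iff vpath_iff\<close>)
  then have u: "(x, u) \<in> parcs G" using q(1) by (simp add: geodesic_iff vpath_iff)
  then have "u \<in> S" using arc_cases empty by blast
  moreover have "s \<in> set q" using q q' by (metis last_in_set list.discI)
  ultimately show False
    using general_positionD[OF S q(1), of x u s] assms s u arc_irrefl q' by auto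
qed

text \<open>
  For \<open>t \<in> N x \<inter> N y\<close> the path \<open>x, t, y, y'\<close> meets \<open>S\<close> in three vertices, so it is not a geodesic.
\<close>

lemma near_sym:
  assumes "y \<in> S" "y' \<in> S" "(y, y') \<in> parcs G" "x \<in> S" "x \<noteq> y" "x \<noteq> y'" "N x \<inter> N y \<noteq> {}"
  shows "N x \<inter> N y' \<noteq> {}"
proof
  assume empty: "N x \<inter> N y' = {}"
  obtain t where t: "t \<in> N x" "t \<in> N y" using assms(7) by blast
  have xy: "(x, y) \<notin> parcs G" "(x, y') \<notin> parcs G"
    using matching[of x y y'] matching[of x y' y] assms arc_sym by blast+
  have "(u, y') \<notin> parcs G" if "(x, u) \<in> parcs G" for u
  proof
    assume uy': "(u, y') \<in> parcs G"
    show False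
    proof (cases "u \<in> S")
      case True
      then have "u = y" using matching[of u y' y] uy' assms arc_sym by blast
      then show False using xy that by blast
    next
      case False
      then have "u \<in> N x" "u \<in> N y'" using arc_cases that uy' arc_sym by blast+
      then show False using empty by blast
    qed
  qed
  then have "geodesic G [x, t, y, y']"
    using geodesic_4[of x t y y'] t N_arc assms xy by blast
  then show False
    using general_positionD[OF S, of "[x, t, y, y']" x y y'] assms arc_irrefl by auto
qed

text \<open>
  On an induced path through \<open>x\<close>, \<open>y\<close> and \<open>z\<close>, a neighbour of \<open>x\<close> would have three neighbours.
\<close>

lemma not_dominated_twice:
  assumes V: "{x, y, z} \<subseteq> pverts G" "x \<noteq> y" "x \<noteq> z" "y \<noteq> z"
    and dom: "\<And>u. (x, u) \<in> parcs G \<Longrightarrow> (y, u) \<in> parcs G \<and> (z, u) \<in> parcs G"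
  shows False
proof -
  obtain p where p: "monophonic_path G p" "x \<in> set p" "y \<in> set p" "z \<in> set p"
    using monophonic_through[OF V] .
  obtain u where u: "u \<in> set p" "(x, u) \<in> parcs G"
    using path_neighbour[OF p(1,2,3) V(2)] .
  then show False
    using monophonic_path_degree[OF p(1), of u x y z] p V dom arc_sym by blast
qed

text \<open>Twins have the same neighbours on an induced path through both and a third vertex of
  \<open>S\<close>. Two common ones would close a 4-cycle, so there is just one, and it already has
  both twins as neighbours. This confines the path to three vertices and leaves no room for the
  third member of \<open>S\<close>.\<close>

lemma no_twins:
  assumes xy: "x \<in> S" "y \<in> S" "x \<noteq> y" and twins: "\<And>u. (x, u) \<in> parcs G \<longleftrightarrow> (y, u) \<in> parcs G"
  shows False
proof -
  obtain z where z: "z \<in> S" "z \<noteq> x" "z \<noteq> y" by (rule third_vertex)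
  have xz: "(x, z) \<notin> parcs G"
    using matching[of x z y] xy z twins arc_sym by blast
  have V: "{x, y, z} \<subseteq> pverts G" "x \<noteq> z" "y \<noteq> z" using xy z S_V by auto
  obtain p where p: "monophonic_path G p" "x \<in> set p" "y \<in> set p" "z \<in> set p"
    using monophonic_through[OF V(1) xy(3) V(2,3)] .
  obtain u where u: "u \<in> set p" "(x, u) \<in> parcs G"
    using path_neighbour[OF p(1,2,3) xy(3)] .
  have single: "v = u" if v: "v \<in> set p" "(x, v) \<in> parcs G" for v
  proof (rule ccontr)
    assume "v \<noteq> u"
    obtain i j m n where ij: "i < length p" "j < length p" "m < length p" "n < length p"
      "p ! i = x" "p ! j = y" "p ! m = u" "p ! n = v"
      using p u v by (auto simp: in_set_conv_nth)
    then have "m = Suc i \<or> i = Suc m" "n = Suc i \<or> i = Suc n" "m = Suc j \<or> j = Suc m" "n = Suc j \<or> j = Suc n"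
      using p(1) u v twins unfolding monophonic_path_def by metis+
    moreover have "i \<noteq> j" "m \<noteq> n" using ij \<open>v \<noteq> u\<close> xy by auto
    ultimately show False by linarith
  qed
  have "set p \<subseteq> {x, y, u}"
  proof (rule monophonic_path_closed[OF p(1,2)])
    fix a b assume ab: "a \<in> {x, y, u}" "a \<in> set p" "b \<in> set p" "(a, b) \<in> parcs G"
    show "b \<in> {x, y, u}"
    proof (cases "a = u")
      case True
      then show ?thesis
        using monophonic_path_degree[OF p(1), of u x y b] ab p u xy twins arc_sym by blast
    qed (use ab single twins in auto)
  qed simp
  then have "z = u" using p z by auto
  then show False using xz u by simp
qed

text \<open>If \<open>w\<close> had the same neighbours in \<open>T\<close> as \<open>v\<close>,
  then by \<open>near_sym\<close> it would share one with the partner \<open>v'\<close>; but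
  \<open>N v\<close> and \<open>N v'\<close> are disjoint.\<close>

lemma N_neq_if_matched:
  assumes "v \<in> S" "w \<in> S" "v \<noteq> w" "v' \<in> S" "(v, v') \<in> parcs G"
  shows "N v \<noteq> N w"
proof
  assume eq: "N v = N w"
  then have "w \<noteq> v'" using N_disjoint[OF assms(5)] N_nonempty[OF assms(1)] by auto
  then show False
    using near_sym[of v v' w] assms eq N_nonempty[OF assms(1)] N_disjoint[OF assms(5)] by auto
qed

text \<open>Vertices with equal \<open>N\<close> and no partner in \<open>S\<close> are twins; a
  partner is excluded by \<open>N_neq_if_matched\<close>. Hence \<open>S\<close> can be counted by
  the subsets of \<open>T\<close> that occur as neighbourhoods.\<close>

lemma inj_on_N: "inj_on N S"
proof (rule inj_onI, rule ccontr)
  fix v w assume vw: "v \<in> S" "w \<in> S" "N v = N w" "v \<noteq> w"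
  have "(v, u) \<in> parcs G \<longleftrightarrow> (w, u) \<in> parcs G" for u
    using arc_cases[of v u] arc_cases[of w u] N_arc(1) N_neq_if_matched[of v w u] N_neq_if_matched[of w v u] vw
    by metis
  then show False using no_twins vw by blast
qed

lemma card_le_types:
  assumes "A \<subseteq> S" "N ` A \<subseteq> F" "finite F"
  shows "card A \<le> card F"
  using card_mono[OF assms(3,2)] card_image[OF inj_on_subset[OF inj_on_N assms(1)]] by simp

end

section \<open>An edge inside the general position set\<close>

locale matched_pair = mp_2_partition +
  fixes y y'
  assumes y: "y \<in> S" "y' \<in> S" "(y, y') \<in> parcs G"
begin

lemma y_neq: "y \<noteq> y'"
  using y arc_irrefl by auto

definition others where "others = S - {y, y'}"

lemma card_others: "card S = card others + 2"
proof -
  have "card {y, y'} = 2" using y_neq by simp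
  then show ?thesis
    using card_Diff_subset[of "{y, y'}" S] card_mono[of S "{y, y'}"] y finite_S by (simp add: others_def)
qed

lemma others_S: "v \<in> others \<Longrightarrow> v \<in> S" "v \<in> others \<Longrightarrow> v \<noteq> y" "v \<in> others \<Longrightarrow> v \<noteq> y'"
  by (auto simp: others_def)

lemma finite_others: "finite others"
  using finite_S by (simp add: others_def)

lemma near_iff: "v \<in> others \<Longrightarrow> N v \<inter> N y \<noteq> {} \<longleftrightarrow> N v \<inter> N y' \<noteq> {}"
  using near_sym[OF y] near_sym[OF y(2,1)] y arc_sym others_S by metis

lemma partner_in_others:
  assumes "v \<in> others" "u \<in> S" "(v, u) \<in> parcs G"
  shows "u \<in> others"
  using matching[OF others_S(1)[OF assms(1)] y(1,2) _ y(3)] matching[OF others_S(1)[OF assms(1)] y(2,1) _ arc_sym[OF y(3)]]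
    assms others_S(2,3)[OF assms(1)] by (auto simp: others_def)

text \<open>A path vertex in \<open>N y\<close> would have the three neighbours \<open>y\<close>,
  \<open>z\<close> and \<open>w\<close>. So \<open>y\<close> is an end of the path, followed by
  \<open>y'\<close>, whose only other neighbour on the path is some \<open>r\<close> in
  \<open>N y'\<close>.\<close>

lemma common_superset_path:
  assumes zw: "z \<in> others" "w \<in> others" "z \<noteq> w" "N y \<subseteq> N z" "N y \<subseteq> N w"
  obtains p r where "monophonic_path G p" "{y, y', r, z, w} \<subseteq> set p" "r \<in> N y'"
    "set p \<inter> N y = {}" "set p \<inter> N y' = {r}"
proof -
  have V: "{y, z, w} \<subseteq> pverts G" "y \<noteq> z" "y \<noteq> w" using zw y others_S S_V by auto
  obtain p where p: "monophonic_path G p" "y \<in> set p" "z \<in> set p" "w \<in> set p"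
    using monophonic_through[OF V zw(3)] .
  have Ny: "set p \<inter> N y = {}"
  proof (rule equals0I)
    fix u assume "u \<in> set p \<inter> N y"
    then have u: "u \<in> set p" "(y, u) \<in> parcs G" "(z, u) \<in> parcs G" "(w, u) \<in> parcs G"
      using zw N_arc(1) by blast+
    then show False
      using path_degree[OF p(1) u(1) p(2-4) u(2-4)] V zw(3) by blast
  qed
  have y_nb: "u = y'" if "u \<in> set p" "(y, u) \<in> parcs G" for u
    using arc_cases[OF that(2)] Ny that(1) matching[OF _ y(1,2) arc_sym[OF that(2)] y(3)] by blast
  obtain u where "u \<in> set p" "(y, u) \<in> parcs G"
    using path_neighbour[OF p(1,2,3) V(2)] .
  then have y': "y' \<in> set p" using y_nb by blast
  have y'_nb: "u = y \<or> u \<in> N y'" if "(y', u) \<in> parcs G" for u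
    using arc_cases[OF that] matching[OF _ y(2,1) arc_sym[OF that] arc_sym[OF y(3)]] by blast
  have "\<exists>r \<in> set p. r \<in> N y'"
  proof (rule ccontr)
    assume "\<not> ?thesis"
    then have "set p \<subseteq> {y, y'}"
      using y_nb y'_nb by (intro monophonic_path_closed[OF p(1,2)]) blast+
    then show False using p zw others_S by blast
  qed
  then obtain r where r: "r \<in> set p" "r \<in> N y'" by blast
  have "v = r" if "v \<in> set p" "v \<in> N y'" for v
    using path_degree[OF p(1) y' p(2) r(1) that(1) y(3) N_arc(2)[OF r(2)] N_arc(2)[OF that(2)]]
      N_not_S[OF r(2)] N_not_S[OF that(2)] y(1) by blast
  then have "set p \<inter> N y' = {r}" using r by blast
  then show thesis using that p y' r Ny by blast
qed

text \<open>Otherwise the vertex \<open>r\<close> of \<open>common_superset_path\<close> has the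
  neighbours \<open>y'\<close>, \<open>z\<close> and \<open>w\<close> on the path.\<close>

lemma contains_both_unique:
  assumes "z \<in> others" "w \<in> others" "N y \<union> N y' \<subseteq> N z" "N y \<union> N y' \<subseteq> N w"
  shows "z = w"
proof (rule ccontr)
  assume "z \<noteq> w"
  then obtain p r where p: "monophonic_path G p" "{y, y', r, z, w} \<subseteq> set p" "r \<in> N y'"
    using common_superset_path[of z w] assms by (metis Un_subset_iff)
  then have r: "(y', r) \<in> parcs G" "(z, r) \<in> parcs G" "(w, r) \<in> parcs G"
    using assms N_arc(1) by blast+
  show False
    using path_degree[OF p(1) _ _ _ _ r] p(2) \<open>z \<noteq> w\<close> others_S(3) assms by auto
qed

text \<open>By the covering, \<open>r\<close> is the only neighbour in \<open>T\<close> that a path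
  vertex can have on the path of \<open>common_superset_path\<close>. Hence \<open>z\<close> and
  \<open>w\<close> are connected to \<open>r\<close> directly or through their partners in
  \<open>S\<close>, which gives \<open>r\<close> two neighbours besides \<open>y'\<close>.\<close>

lemma contains_unique_if_covering:
  assumes cover: "T = N y \<union> N y'" and zw: "z \<in> others" "w \<in> others" "N y \<subseteq> N z" "N y \<subseteq> N w"
  shows "z = w"
proof (rule ccontr)
  assume "z \<noteq> w"
  then obtain p r where p: "monophonic_path G p" "{y, y', r, z, w} \<subseteq> set p" "r \<in> N y'"
    "set p \<inter> N y = {}" "set p \<inter> N y' = {r}"
    using common_superset_path[of z w] zw by metis
  have in_T: "u = r" if "u \<in> set p" "u \<in> N x" for u x
    using that p(4,5) cover N_T[of x] by blast
  have reach: "\<exists>a\<in>set p. (r, a) \<in> parcs G \<and> (a = v \<or> a \<in> S \<and> (v, a) \<in> parcs G)"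
    if v: "v \<in> others" "v \<in> set p" for v
  proof (rule ccontr)
    assume no: "\<not> ?thesis"
    have "set p \<subseteq> insert v {a \<in> S. (v, a) \<in> parcs G}"
    proof (rule monophonic_path_closed[OF p(1) v(2)])
      fix x u assume x: "x \<in> insert v {a \<in> S. (v, a) \<in> parcs G}" "x \<in> set p"
        and u: "u \<in> set p" "(x, u) \<in> parcs G"
      have "u \<in> S"
      proof (rule ccontr)
        assume "u \<notin> S"
        then have "u = r" using arc_cases u in_T by blast
        then have "(r, x) \<in> parcs G" using u arc_sym by blast
        then show False using no x by blast
      qed
      moreover have "x \<in> S" using x v others_S by blast
      ultimately show "u \<in> insert v {a \<in> S. (v, a) \<in> parcs G}"
        using x u matching[of v x u] v others_S by blast
    qed simp
    then show False
      using p(2) partner_in_others[OF v(1), of y] others_S v y by blast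
  qed
  obtain a where a: "a \<in> set p" "(r, a) \<in> parcs G" "a = z \<or> a \<in> S \<and> (z, a) \<in> parcs G"
    using reach[of z] zw p(2) by blast
  obtain b where b: "b \<in> set p" "(r, b) \<in> parcs G" "b = w \<or> b \<in> S \<and> (w, b) \<in> parcs G"
    using reach[of w] zw p(2) by blast
  have zw_arc: "(z, w) \<notin> parcs G" "(w, z) \<notin> parcs G"
    using N_disjoint[of z w] N_disjoint[of w z] N_nonempty[OF y(1)] zw by blast+
  have "a \<noteq> b"
  proof
    assume "a = b"
    then have "(z, a) \<in> parcs G" "(a, w) \<in> parcs G" "a \<in> S"
      using a(3) b(3) zw_arc \<open>z \<noteq> w\<close> arc_sym[of w a] by auto
    then show False
      using matching[of z a w] zw others_S(1) \<open>z \<noteq> w\<close> by blast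
  qed
  moreover have "a \<noteq> y'" "b \<noteq> y'"
    using a(3) b(3) partner_in_others[of z y'] partner_in_others[of w y'] zw(1,2) others_S(3) y(2) by blast+
  ultimately show False
    using path_degree[OF p(1), of r y' a b] a(1) b(1) arc_sym[OF a(2)] arc_sym[OF b(2)] p(2) N_arc(1)[OF p(3)]
    by auto
qed

text \<open>By \<open>near_iff\<close> these vertices miss \<open>N y'\<close> as well, so their
  neighbourhoods are nonempty subsets of \<open>R\<close>; the \<open>1\<close> accounts for the
  empty set.\<close>

lemma card_far:
  assumes "finite R" "T - N y - N y' \<subseteq> R"
  shows "card {v \<in> others. N v \<inter> N y = {}} + 1 \<le> 2 ^ card R"
proof -
  have "card {v \<in> others. N v \<inter> N y = {}} \<le> card (Pow R - {{}})"
  proof (rule card_le_types)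
    show "N ` {v \<in> others. N v \<inter> N y = {}} \<subseteq> Pow R - {{}}"
    proof (rule image_subsetI)
      fix v assume "v \<in> {v \<in> others. N v \<inter> N y = {}}"
      then have v: "v \<in> others" "N v \<inter> N y = {}" by auto
      then have "N v \<inter> N y' = {}" using near_iff[OF v(1)] by simp
      then show "N v \<in> Pow R - {{}}"
        using v(2) N_T[of v] assms(2) N_nonempty[OF others_S(1)[OF v(1)]] by blast
    qed
    show "{v \<in> others. N v \<inter> N y = {}} \<subseteq> S" using others_S(1) by blast
  qed (use assms(1) in simp)
  moreover have "card (Pow R) = Suc (card (Pow R - {{}}))"
    using assms(1) by (intro card.remove) auto
  ultimately show ?thesis
    using card_Pow[OF assms(1)] by linarith
qed

lemma card_others_split: "card others = card {v \<in> others. N v \<inter> N y \<noteq> {}} + card {v \<in> others. N v \<inter> N y = {}}"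
proof -
  have "others = {v \<in> others. N v \<inter> N y \<noteq> {}} \<union> {v \<in> others. N v \<inter> N y = {}}" by blast
  then show ?thesis
    using card_Un_disjoint[of "{v \<in> others. N v \<inter> N y \<noteq> {}}" "{v \<in> others. N v \<inter> N y = {}}"] finite_others by auto
qed

text \<open>Meeting a singleton means containing it, so at most one vertex of \<open>others\<close>
  is near \<open>y\<close>, by \<open>contains_both_unique\<close>. It makes up for the empty set
  missing in \<open>card_far\<close>, and the summand \<open>2\<close> counts \<open>y\<close> and
  \<open>y'\<close>.\<close>

lemma card_S_le_if_singletons:
  assumes "N y = {t}" "N y' = {t'}"
  shows "card S \<le> 2 + 2 ^ card (T - {t, t'})"
proof -
  have "z = w" if "z \<in> others" "w \<in> others" "N z \<inter> N y \<noteq> {}" "N w \<inter> N y \<noteq> {}" for z w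
    using contains_both_unique[of z w] near_iff that assms by auto
  then have "card {v \<in> others. N v \<inter> N y \<noteq> {}} \<le> 1"
    using finite_others by (simp add: card_le_Suc0_iff_eq)
  moreover have "T - N y - N y' \<subseteq> T - {t, t'}" using assms by auto
  ultimately show ?thesis
    using card_far[of "T - {t, t'}"] finite_T card_others card_others_split by auto
qed

text \<open>By the covering and \<open>near_iff\<close>, every vertex of \<open>others\<close> meets
  the singleton \<open>N y\<close> and so contains it, which only one can do.\<close>

lemma card_S_le_if_covering_singleton:
  assumes "N y = {t}" "T = N y \<union> N y'"
  shows "card S \<le> 3"
proof -
  have "N y \<subseteq> N v" if "v \<in> others" for v
  proof -
    have "N v \<inter> N y \<noteq> {} \<or> N v \<inter> N y' \<noteq> {}"
      using N_T[of v] N_nonempty[OF others_S(1)[OF that]] assms(2) by blast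
    then show ?thesis
      using near_iff[OF that] assms(1) by auto
  qed
  then have "z = w" if "z \<in> others" "w \<in> others" for z w
    using contains_unique_if_covering[OF assms(2)] that by blast
  then have "card others \<le> 1"
    using finite_others by (simp add: card_le_Suc0_iff_eq)
  then show ?thesis using card_others by simp
qed

text \<open>The vertices of \<open>M\<close> all contain \<open>t1\<close>, so none has a partner in
  \<open>S\<close>: the partner would contain \<open>t1\<close> too. If \<open>M\<close> has two
  members, each contains \<open>t4\<close>, since otherwise the path of
  \<open>common_superset_path\<close> ends at \<open>z\<close> before reaching \<open>w\<close>.
  Members of \<open>M\<close> then differ only in a nonempty subset of \<open>N y'\<close>, which
  leaves three. Outside \<open>M\<close> the only possible neighbourhood is \<open>{t4}\<close>, and
  the total is \<open>2 + 3 + 1\<close>.\<close>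

lemma card_S_le_if_1_2_1:
  assumes Ny: "N y = {t1}" "card (N y') = 2" and T': "T = N y \<union> N y' \<union> {t4}"
  shows "card S \<le> 6"
proof -
  define M where "M = {v \<in> others. N v \<inter> N y \<noteq> {}}"
  have M: "v \<in> others" "N y \<subseteq> N v" "N v \<inter> N y' \<noteq> {}" if "v \<in> M" for v
    using that near_iff Ny by (auto simp: M_def)
  have unmatched: "u \<notin> S" if v: "v \<in> M" and u: "(v, u) \<in> parcs G" for u v
  proof
    assume "u \<in> S"
    then have "u \<in> others" using partner_in_others[OF M(1)[OF v] _ u] by blast
    then have "N y \<inter> N u \<noteq> {}"
      using near_sym[OF others_S(1)[OF M(1)[OF v]] \<open>u \<in> S\<close> u y(1)] M(1,2)[OF v] others_S(2) N_nonempty[OF y(1)]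
      by blast
    then have "N v \<inter> N u \<noteq> {}" using M(2)[OF v] by blast
    then show False using N_disjoint[OF u] by blast
  qed
  have t4: "t4 \<in> N z" if zw: "z \<in> M" "w \<in> M" "z \<noteq> w" for z w
  proof (rule ccontr)
    assume no: "t4 \<notin> N z"
    obtain p r where p: "monophonic_path G p" "{y, y', r, z, w} \<subseteq> set p" "r \<in> N y'"
      "set p \<inter> N y = {}" "set p \<inter> N y' = {r}"
      using common_superset_path[OF M(1)[OF zw(1)] M(1)[OF zw(2)] zw(3) M(2)[OF zw(1)] M(2)[OF zw(2)]] .
    have ps: "y \<in> set p" "y' \<in> set p" "r \<in> set p" "z \<in> set p" "w \<in> set p" using p(2) by auto
    have z_nb: "u = r" if "u \<in> set p" "(z, u) \<in> parcs G" for u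
    proof -
      have "u \<in> N z" using unmatched[OF zw(1) that(2)] arc_cases[OF that(2)] by blast
      then show ?thesis using T' N_T[of z] no p(4,5) that by blast
    qed
    then have rz: "(z, r) \<in> parcs G"
      using path_neighbour[OF p(1) ps(4,5) zw(3)] by metis
    have "set p \<subseteq> {y, y', r, z}"
    proof (rule monophonic_path_closed[OF p(1) ps(1)])
      fix a b assume a: "a \<in> {y, y', r, z}" and b: "b \<in> set p" "(a, b) \<in> parcs G"
      have "b \<in> {y, y'}" if "a = y"
        using that b(1) arc_cases[OF b(2)] p(4) matching[OF _ y(1,2) arc_sym[of y b] y(3)] b(2) by auto
      moreover have "b \<in> {y, r}" if "a = y'"
        using that b(1) arc_cases[OF b(2)] p(5) matching[OF _ y(2,1) arc_sym[of y' b] arc_sym[OF y(3)]] b(2)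
        by auto
      moreover have "b \<in> {y', z}" if "a = r"
        using path_degree[OF p(1) ps(3,2,4) b(1) N_arc(1)[OF p(3)] rz] that arc_sym[OF b(2)] M(1)[OF zw(1)] others_S(3)
        by blast
      ultimately show "b \<in> {y, y', r, z}" using a b z_nb by blast
    qed simp
    then have "w = r" using ps(5) zw(3) others_S(2,3)[OF M(1)[OF zw(2)]] by blast
    then show False using N_not_S[OF p(3)] others_S(1)[OF M(1)[OF zw(2)]] by blast
  qed
  have "card M \<le> 3"
  proof (cases "card M \<le> 1")
    case False
    have t4': "t4 \<in> N z" if "z \<in> M" for z
    proof -
      have "\<not> M \<subseteq> {z}" using False card_mono[of "{z}" M] by auto
      then show ?thesis using t4 that by blast
    qed
    have "inj_on (\<lambda>v. N v \<inter> N y') M"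
    proof (rule inj_onI)
      fix v w assume vw: "v \<in> M" "w \<in> M" "N v \<inter> N y' = N w \<inter> N y'"
      have eq: "N x = N y \<union> {t4} \<union> (N x \<inter> N y')" if "x \<in> M" for x
        using M(2)[OF that] t4'[OF that] N_T[of x] T' by blast
      have "N v = N w" using eq[OF vw(1)] eq[OF vw(2)] vw(3) by simp
      then show "v = w" using inj_onD[OF inj_on_N] others_S(1)[OF M(1)[OF vw(1)]] others_S(1)[OF M(1)[OF vw(2)]] by blast
    qed
    then have "card M = card ((\<lambda>v. N v \<inter> N y') ` M)" by (simp add: card_image)
    also have "\<dots> \<le> card (Pow (N y') - {{}})"
      by (rule card_mono) (use M finite_N in auto)
    also have "\<dots> = 3" using Ny finite_N by (simp add: card_Diff_singleton card_Pow)
    finally show ?thesis .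
  qed simp
  moreover have "card {v \<in> others. N v \<inter> N y = {}} + 1 \<le> 2"
    using card_far[of "{t4}"] T' by auto
  ultimately show ?thesis using card_others card_others_split by (simp add: M_def)
qed

end

section \<open>Extremal bounds for unshared families of small sets\<close>

lemma sum_list_of_bool:
  "distinct L \<Longrightarrow> (\<Sum>B\<leftarrow>L. of_bool (B \<in> F)) = card (F \<inter> set L)"
  by (induction L) (auto simp: Int_insert_right)

text \<open>
  By \<open>not_dominated_twice\<close> this holds for the family of the sets \<open>N x\<close> if \<open>S\<close> is independent.
\<close>

definition unshared :: "'a set set \<Rightarrow> bool" where
  "unshared F \<longleftrightarrow> (\<forall>A\<in>F. \<forall>B\<in>F. \<forall>C\<in>F. A \<subset> B \<and> A \<subset> C \<longrightarrow> B = C)"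

lemma unshared_sum:
  assumes "unshared F" "A \<in> F" "distinct L \<and> (\<forall>B\<in>set L. A \<subset> B)"
  shows "(\<Sum>B\<leftarrow>L. of_bool (B \<in> F)) \<le> (1::nat)"
proof -
  have "card (F \<inter> set L) \<le> Suc 0"
    using assms unfolding unshared_def by (subst card_le_Suc0_iff_eq) auto
  then show ?thesis
    using sum_list_of_bool[of L F] assms(3) by simp
qed

text \<open>The cardinality becomes a sum of 0/1 variables, one for each possible member. A member
  allows at most one proper superset in \<open>F\<close>; splitting on whether it belongs to
  \<open>F\<close> turns this into linear inequalities. The family of the sets with at least two
  elements attains the bound.\<close>

lemma card_unshared_3:
  assumes F: "unshared F" "F \<subseteq> Pow {0, 1, 2::nat} - {{}}"
  shows "card F \<le> 4"
proof -
  let ?x = "\<lambda>A. of_bool (A \<in> F) :: nat"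
  let ?L = "[{0}, {1}, {2}, {0, 1}, {0, 2}, {1, 2}, {0, 1, 2}] :: nat set list"
  have "Pow {0, 1, 2::nat} - {{}} \<subseteq> set ?L"
    by code_simp
  then have "F \<inter> set ?L = F" using F(2) by blast
  moreover have "distinct ?L" by code_simp
  ultimately have "card F = ?x {0} + ?x {1} + ?x {2} + ?x {0, 1} + ?x {0, 2} + ?x {1, 2} + ?x {0, 1, 2}"
    using sum_list_of_bool[of ?L F] by (simp del: of_bool_eq_0_iff)
  also have "\<dots> \<le> 4"
  proof -
    have u0: "?x {0, 1} + ?x {0, 2} + ?x {0, 1, 2} \<le> 1" if "{0} \<in> F"
    proof -
      have "distinct ([{0, 1}, {0, 2}, {0, 1, 2}] :: nat set list) \<and> (\<forall>B\<in>set [{0, 1}, {0, 2}, {0, 1, 2}]. {0} \<subset> (B::nat set))"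
        by code_simp
      from unshared_sum[OF F(1) that this] show ?thesis by (simp del: of_bool_eq_0_iff)
    qed
    have u1: "?x {0, 1} + ?x {1, 2} + ?x {0, 1, 2} \<le> 1" if "{1} \<in> F"
    proof -
      have "distinct ([{0, 1}, {1, 2}, {0, 1, 2}] :: nat set list) \<and> (\<forall>B\<in>set [{0, 1}, {1, 2}, {0, 1, 2}]. {1} \<subset> (B::nat set))"
        by code_simp
      from unshared_sum[OF F(1) that this] show ?thesis by (simp del: of_bool_eq_0_iff)
    qed
    have u2: "?x {0, 2} + ?x {1, 2} + ?x {0, 1, 2} \<le> 1" if "{2} \<in> F"
    proof -
      have "distinct ([{0, 2}, {1, 2}, {0, 1, 2}] :: nat set list) \<and> (\<forall>B\<in>set [{0, 2}, {1, 2}, {0, 1, 2}]. {2} \<subset> (B::nat set))"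
        by code_simp
      from unshared_sum[OF F(1) that this] show ?thesis by (simp del: of_bool_eq_0_iff)
    qed
    have le: "?x {0} \<le> 1"
      "?x {1} \<le> 1"
      "?x {2} \<le> 1"
      "?x {0, 1} \<le> 1"
      "?x {0, 2} \<le> 1"
      "?x {1, 2} \<le> 1"
      "?x {0, 1, 2} \<le> 1"
      by simp_all
    have c0: "?x {0} = 0 \<or> ?x {0} = 1 \<and> ?x {0, 1} + ?x {0, 2} + ?x {0, 1, 2} \<le> 1"
      using u0 by (cases "{0} \<in> F") simp_all
    have c1: "?x {1} = 0 \<or> ?x {1} = 1 \<and> ?x {0, 1} + ?x {1, 2} + ?x {0, 1, 2} \<le> 1"
      using u1 by (cases "{1} \<in> F") simp_all
    have c2: "?x {2} = 0 \<or> ?x {2} = 1 \<and> ?x {0, 2} + ?x {1, 2} + ?x {0, 1, 2} \<le> 1"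
      using u2 by (cases "{2} \<in> F") simp_all
    show ?thesis
      by (insert c0 c1 c2, elim disjE conjE; insert le; linarith)
  qed
  finally show ?thesis .
qed

text \<open>The labels \<open>0\<close> and \<open>1\<close> stand for two adjacent vertices of
  \<open>T\<close>; without triangles they have no common neighbour.\<close>

lemma card_unshared_4_edge:
  assumes F: "unshared F" "F \<subseteq> Pow {0, 1, 2, 3::nat} - {{}}" "\<And>A. A \<in> F \<Longrightarrow> \<not> {0, 1} \<subseteq> A"
  shows "card F \<le> 6"
proof -
  let ?x = "\<lambda>A. of_bool (A \<in> F) :: nat"
  let ?L = "[{0}, {1}, {2}, {3}, {0, 2}, {0, 3}, {1, 2}, {1, 3}, {2, 3}, {0, 2, 3}, {1, 2, 3}] :: nat set list"
  have "\<forall>A\<in>Pow {0, 1, 2, 3::nat} - {{}}. {0, 1} \<subseteq> A \<or> A \<in> set ?L"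
    by code_simp
  then have "F \<inter> set ?L = F" using F(2,3) by blast
  moreover have "distinct ?L" by code_simp
  ultimately have "card F = ?x {0} + ?x {1} + ?x {2} + ?x {3} + ?x {0, 2} + ?x {0, 3} + ?x {1, 2} + ?x {1, 3} + ?x {2, 3} + ?x {0, 2, 3} + ?x {1, 2, 3}"
    using sum_list_of_bool[of ?L F] by (simp del: of_bool_eq_0_iff)
  also have "\<dots> \<le> 6"
  proof -
    have u0: "?x {0, 2} + ?x {0, 3} + ?x {0, 2, 3} \<le> 1" if "{0} \<in> F"
    proof -
      have "distinct ([{0, 2}, {0, 3}, {0, 2, 3}] :: nat set list) \<and> (\<forall>B\<in>set [{0, 2}, {0, 3}, {0, 2, 3}]. {0} \<subset> (B::nat set))"
        by code_simp
      from unshared_sum[OF F(1) that this] show ?thesis by (simp del: of_bool_eq_0_iff)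
    qed
    have u1: "?x {1, 2} + ?x {1, 3} + ?x {1, 2, 3} \<le> 1" if "{1} \<in> F"
    proof -
      have "distinct ([{1, 2}, {1, 3}, {1, 2, 3}] :: nat set list) \<and> (\<forall>B\<in>set [{1, 2}, {1, 3}, {1, 2, 3}]. {1} \<subset> (B::nat set))"
        by code_simp
      from unshared_sum[OF F(1) that this] show ?thesis by (simp del: of_bool_eq_0_iff)
    qed
    have u2: "?x {0, 2} + ?x {1, 2} + ?x {2, 3} + ?x {0, 2, 3} + ?x {1, 2, 3} \<le> 1" if "{2} \<in> F"
    proof -
      have "distinct ([{0, 2}, {1, 2}, {2, 3}, {0, 2, 3}, {1, 2, 3}] :: nat set list) \<and> (\<forall>B\<in>set [{0, 2}, {1, 2}, {2, 3}, {0, 2, 3}, {1, 2, 3}]. {2} \<subset> (B::nat set))"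
        by code_simp
      from unshared_sum[OF F(1) that this] show ?thesis by (simp del: of_bool_eq_0_iff)
    qed
    have u3: "?x {0, 3} + ?x {1, 3} + ?x {2, 3} + ?x {0, 2, 3} + ?x {1, 2, 3} \<le> 1" if "{3} \<in> F"
    proof -
      have "distinct ([{0, 3}, {1, 3}, {2, 3}, {0, 2, 3}, {1, 2, 3}] :: nat set list) \<and> (\<forall>B\<in>set [{0, 3}, {1, 3}, {2, 3}, {0, 2, 3}, {1, 2, 3}]. {3} \<subset> (B::nat set))"
        by code_simp
      from unshared_sum[OF F(1) that this] show ?thesis by (simp del: of_bool_eq_0_iff)
    qed
    have u23: "?x {0, 2, 3} + ?x {1, 2, 3} \<le> 1" if "{2, 3} \<in> F"
    proof -
      have "distinct ([{0, 2, 3}, {1, 2, 3}] :: nat set list) \<and> (\<forall>B\<in>set [{0, 2, 3}, {1, 2, 3}]. {2, 3} \<subset> (B::nat set))"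
        by code_simp
      from unshared_sum[OF F(1) that this] show ?thesis by (simp del: of_bool_eq_0_iff)
    qed
    have le: "?x {0} \<le> 1"
      "?x {1} \<le> 1"
      "?x {2} \<le> 1"
      "?x {3} \<le> 1"
      "?x {0, 2} \<le> 1"
      "?x {0, 3} \<le> 1"
      "?x {1, 2} \<le> 1"
      "?x {1, 3} \<le> 1"
      "?x {2, 3} \<le> 1"
      "?x {0, 2, 3} \<le> 1"
      "?x {1, 2, 3} \<le> 1"
      by simp_all
    have c0: "?x {0} = 0 \<or> ?x {0} = 1 \<and> ?x {0, 2} + ?x {0, 3} + ?x {0, 2, 3} \<le> 1"
      using u0 by (cases "{0} \<in> F") simp_all
    have c1: "?x {1} = 0 \<or> ?x {1} = 1 \<and> ?x {1, 2} + ?x {1, 3} + ?x {1, 2, 3} \<le> 1"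
      using u1 by (cases "{1} \<in> F") simp_all
    have c2: "?x {2} = 0 \<or> ?x {2} = 1 \<and> ?x {0, 2} + ?x {1, 2} + ?x {2, 3} + ?x {0, 2, 3} + ?x {1, 2, 3} \<le> 1"
      using u2 by (cases "{2} \<in> F") simp_all
    have c3: "?x {3} = 0 \<or> ?x {3} = 1 \<and> ?x {0, 3} + ?x {1, 3} + ?x {2, 3} + ?x {0, 2, 3} + ?x {1, 2, 3} \<le> 1"
      using u3 by (cases "{3} \<in> F") simp_all
    have c23: "?x {2, 3} = 0 \<or> ?x {2, 3} = 1 \<and> ?x {0, 2, 3} + ?x {1, 2, 3} \<le> 1"
      using u23 by (cases "{2, 3} \<in> F") simp_all
    show ?thesis
      by (insert c0 c1 c2 c3 c23, elim disjE conjE; insert le; linarith)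
  qed
  finally show ?thesis .
qed

text \<open>The case of an independent \<open>T\<close>, where any two neighbourhoods of vertices of
  \<open>S\<close> meet. A disjoint pair contributes the inequality that at most one of its sets is
  in \<open>F\<close>.\<close>

lemma card_unshared_4_intersecting:
  assumes F: "unshared F" "F \<subseteq> Pow {0, 1, 2, 3::nat} - {{}}" "\<And>A B. A \<in> F \<Longrightarrow> B \<in> F \<Longrightarrow> A \<inter> B \<noteq> {}"
  shows "card F \<le> 6"
proof -
  let ?x = "\<lambda>A. of_bool (A \<in> F) :: nat"
  let ?L = "[{0}, {1}, {2}, {3}, {0, 1}, {0, 2}, {0, 3}, {1, 2}, {1, 3}, {2, 3}, {0, 1, 2}, {0, 1, 3}, {0, 2, 3}, {1, 2, 3}, {0, 1, 2, 3}] :: nat set list"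
  have "Pow {0, 1, 2, 3::nat} - {{}} \<subseteq> set ?L"
    by code_simp
  then have "F \<inter> set ?L = F" using F(2) by blast
  moreover have "distinct ?L" by code_simp
  ultimately have "card F = ?x {0} + ?x {1} + ?x {2} + ?x {3} + ?x {0, 1} + ?x {0, 2} + ?x {0, 3} + ?x {1, 2} + ?x {1, 3} + ?x {2, 3} + ?x {0, 1, 2} + ?x {0, 1, 3} + ?x {0, 2, 3} + ?x {1, 2, 3} + ?x {0, 1, 2, 3}"
    using sum_list_of_bool[of ?L F] by (simp del: of_bool_eq_0_iff)
  also have "\<dots> \<le> 6"
  proof -
    have u01: "?x {0, 1, 2} + ?x {0, 1, 3} + ?x {0, 1, 2, 3} \<le> 1" if "{0, 1} \<in> F"
    proof -
      have "distinct ([{0, 1, 2}, {0, 1, 3}, {0, 1, 2, 3}] :: nat set list) \<and> (\<forall>B\<in>set [{0, 1, 2}, {0, 1, 3}, {0, 1, 2, 3}]. {0, 1} \<subset> (B::nat set))"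
        by code_simp
      from unshared_sum[OF F(1) that this] show ?thesis by (simp del: of_bool_eq_0_iff)
    qed
    have u02: "?x {0, 1, 2} + ?x {0, 2, 3} + ?x {0, 1, 2, 3} \<le> 1" if "{0, 2} \<in> F"
    proof -
      have "distinct ([{0, 1, 2}, {0, 2, 3}, {0, 1, 2, 3}] :: nat set list) \<and> (\<forall>B\<in>set [{0, 1, 2}, {0, 2, 3}, {0, 1, 2, 3}]. {0, 2} \<subset> (B::nat set))"
        by code_simp
      from unshared_sum[OF F(1) that this] show ?thesis by (simp del: of_bool_eq_0_iff)
    qed
    have u03: "?x {0, 1, 3} + ?x {0, 2, 3} + ?x {0, 1, 2, 3} \<le> 1" if "{0, 3} \<in> F"
    proof -
      have "distinct ([{0, 1, 3}, {0, 2, 3}, {0, 1, 2, 3}] :: nat set list) \<and> (\<forall>B\<in>set [{0, 1, 3}, {0, 2, 3}, {0, 1, 2, 3}]. {0, 3} \<subset> (B::nat set))"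
        by code_simp
      from unshared_sum[OF F(1) that this] show ?thesis by (simp del: of_bool_eq_0_iff)
    qed
    have u12: "?x {0, 1, 2} + ?x {1, 2, 3} + ?x {0, 1, 2, 3} \<le> 1" if "{1, 2} \<in> F"
    proof -
      have "distinct ([{0, 1, 2}, {1, 2, 3}, {0, 1, 2, 3}] :: nat set list) \<and> (\<forall>B\<in>set [{0, 1, 2}, {1, 2, 3}, {0, 1, 2, 3}]. {1, 2} \<subset> (B::nat set))"
        by code_simp
      from unshared_sum[OF F(1) that this] show ?thesis by (simp del: of_bool_eq_0_iff)
    qed
    have u13: "?x {0, 1, 3} + ?x {1, 2, 3} + ?x {0, 1, 2, 3} \<le> 1" if "{1, 3} \<in> F"
    proof -
      have "distinct ([{0, 1, 3}, {1, 2, 3}, {0, 1, 2, 3}] :: nat set list) \<and> (\<forall>B\<in>set [{0, 1, 3}, {1, 2, 3}, {0, 1, 2, 3}]. {1, 3} \<subset> (B::nat set))"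
        by code_simp
      from unshared_sum[OF F(1) that this] show ?thesis by (simp del: of_bool_eq_0_iff)
    qed
    have u23: "?x {0, 2, 3} + ?x {1, 2, 3} + ?x {0, 1, 2, 3} \<le> 1" if "{2, 3} \<in> F"
    proof -
      have "distinct ([{0, 2, 3}, {1, 2, 3}, {0, 1, 2, 3}] :: nat set list) \<and> (\<forall>B\<in>set [{0, 2, 3}, {1, 2, 3}, {0, 1, 2, 3}]. {2, 3} \<subset> (B::nat set))"
        by code_simp
      from unshared_sum[OF F(1) that this] show ?thesis by (simp del: of_bool_eq_0_iff)
    qed
    have disj: "?x A + ?x B \<le> 1" if "A \<inter> B = {}" for A B
      using F(3)[of A B] that by (auto simp: of_bool_def)
    have d: "?x {0} + ?x {1, 2} \<le> 1"
      "?x {0} + ?x {1, 3} \<le> 1"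
      "?x {0} + ?x {2, 3} \<le> 1"
      "?x {0} + ?x {1, 2, 3} \<le> 1"
      "?x {1} + ?x {2, 3} \<le> 1"
      "?x {0, 1} + ?x {2} \<le> 1"
      "?x {0, 1} + ?x {3} \<le> 1"
      "?x {0, 1} + ?x {2, 3} \<le> 1"
      "?x {0, 2} + ?x {1} \<le> 1"
      "?x {0, 2} + ?x {3} \<le> 1"
      "?x {0, 2} + ?x {1, 3} \<le> 1"
      "?x {0, 3} + ?x {1} \<le> 1"
      "?x {0, 3} + ?x {2} \<le> 1"
      "?x {0, 3} + ?x {1, 2} \<le> 1"
      "?x {1, 2} + ?x {3} \<le> 1"
      "?x {1, 3} + ?x {2} \<le> 1"
      "?x {0, 1, 2} + ?x {3} \<le> 1"
      "?x {0, 1, 3} + ?x {2} \<le> 1"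
      "?x {0, 2, 3} + ?x {1} \<le> 1"
      by (rule disj; simp)+
    have le: "?x {0} \<le> 1"
      "?x {1} \<le> 1"
      "?x {2} \<le> 1"
      "?x {3} \<le> 1"
      "?x {0, 1} \<le> 1"
      "?x {0, 2} \<le> 1"
      "?x {0, 3} \<le> 1"
      "?x {1, 2} \<le> 1"
      "?x {1, 3} \<le> 1"
      "?x {2, 3} \<le> 1"
      "?x {0, 1, 2} \<le> 1"
      "?x {0, 1, 3} \<le> 1"
      "?x {0, 2, 3} \<le> 1"
      "?x {1, 2, 3} \<le> 1"
      "?x {0, 1, 2, 3} \<le> 1"
      by simp_all
    have c01: "?x {0, 1} = 0 \<or> ?x {0, 1} = 1 \<and> ?x {0, 1, 2} + ?x {0, 1, 3} + ?x {0, 1, 2, 3} \<le> 1"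
      using u01 by (cases "{0, 1} \<in> F") simp_all
    have c02: "?x {0, 2} = 0 \<or> ?x {0, 2} = 1 \<and> ?x {0, 1, 2} + ?x {0, 2, 3} + ?x {0, 1, 2, 3} \<le> 1"
      using u02 by (cases "{0, 2} \<in> F") simp_all
    have c03: "?x {0, 3} = 0 \<or> ?x {0, 3} = 1 \<and> ?x {0, 1, 3} + ?x {0, 2, 3} + ?x {0, 1, 2, 3} \<le> 1"
      using u03 by (cases "{0, 3} \<in> F") simp_all
    have c12: "?x {1, 2} = 0 \<or> ?x {1, 2} = 1 \<and> ?x {0, 1, 2} + ?x {1, 2, 3} + ?x {0, 1, 2, 3} \<le> 1"
      using u12 by (cases "{1, 2} \<in> F") simp_all
    have c13: "?x {1, 3} = 0 \<or> ?x {1, 3} = 1 \<and> ?x {0, 1, 3} + ?x {1, 2, 3} + ?x {0, 1, 2, 3} \<le> 1"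
      using u13 by (cases "{1, 3} \<in> F") simp_all
    have c23: "?x {2, 3} = 0 \<or> ?x {2, 3} = 1 \<and> ?x {0, 2, 3} + ?x {1, 2, 3} + ?x {0, 1, 2, 3} \<le> 1"
      using u23 by (cases "{2, 3} \<in> F") simp_all
    show ?thesis
      by (insert c01 c02 c03 c12 c13 c23, elim disjE conjE; insert le d; linarith)
  qed
  finally show ?thesis .
qed

section \<open>Matched pairs whose neighbourhoods cover the complement\<close>

context matched_pair
begin

lemma crosses_both_if_covering:
  assumes "T = N y \<union> N y'" "v \<in> others"
  shows "N v \<inter> N y \<noteq> {}" "N v \<inter> N y' \<noteq> {}"
proof -
  have "N v \<inter> N y \<noteq> {} \<or> N v \<inter> N y' \<noteq> {}"
    using N_T[of v] N_nonempty[OF others_S(1)[OF assms(2)]] assms(1) by blast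
  then show "N v \<inter> N y \<noteq> {}" "N v \<inter> N y' \<noteq> {}"
    using near_iff[OF assms(2)] by blast+
qed

lemma crossing_types:
  assumes T': "T = N y \<union> N y'" and Ny: "N y = {a, b}" "N y' = {c, d}" and v: "v \<in> others"
    and not: "\<not> N y \<subseteq> N v" "\<not> N y' \<subseteq> N v"
  shows "N v \<in> {{a, c}, {a, d}, {b, c}, {b, d}}"
proof -
  have "N v \<subseteq> {a, b, c, d}" "a \<in> N v \<or> b \<in> N v" "c \<in> N v \<or> d \<in> N v"
    "\<not> (a \<in> N v \<and> b \<in> N v)" "\<not> (c \<in> N v \<and> d \<in> N v)"
    using crosses_both_if_covering[OF T' v] N_T[of v] T' Ny not by auto
  then have "N v = {a, c} \<or> N v = {a, d} \<or> N v = {b, c} \<or> N v = {b, d}"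
    by blast
  then show ?thesis by simp
qed

text \<open>
  If \<open>p\<close> and \<open>q\<close> are adjacent, degrees rule out an induced path through \<open>y\<close>, \<open>p\<close> and \<open>r\<close>. Otherwise
  \<open>p, a, y, b, q\<close> is a geodesic unless \<open>b\<close> and \<open>c\<close> are adjacent, and then two vertices of
  \<open>others\<close> dominate \<open>r\<close>.
\<close>

lemma no_three_crossing_types:
  assumes d: "distinct [a, b, c, d]" and Ny: "N y = {a, b}" "N y' = {c, d}" and T': "T = N y \<union> N y'"
    and S': "p \<in> S" "q \<in> S" "r \<in> S" and types: "N p = {a, c}" "N q = {b, d}" "N r = {a, d}"
    and few: "card {v \<in> others. N y \<subseteq> N v} \<le> 1" "card {v \<in> others. N y' \<subseteq> N v} \<le> 1" and large: "7 \<le> card S"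
  shows False
proof -
  have O: "p \<in> others" "q \<in> others" "r \<in> others"
    using S' types Ny d by (auto simp: others_def doubleton_eq_iff)
  have neq: "p \<noteq> q" "p \<noteq> r" "q \<noteq> r"
    using types d by (auto simp: doubleton_eq_iff)
  have partner: "N u \<inter> N v = {}" "N u \<inter> {a, b} \<noteq> {}" "N u \<inter> {c, d} \<noteq> {}" "N u \<subseteq> {a, b, c, d}"
    if "v \<in> others" "u \<in> S" "(v, u) \<in> parcs G" for u v
    using crosses_both_if_covering[OF T' partner_in_others[OF that]] N_disjoint[OF that(3)] N_T[of u] T' Ny
    by auto
  have inj: "u = v" if "u \<in> S" "v \<in> S" "N u = N v" for u v
    using inj_onD[OF inj_on_N that(3)] that by blast
  \<comment> \<open>A partner of \<open>p\<close> avoids \<open>N p\<close> but meets both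
    \<open>{a, b}\<close> and \<open>{c, d}\<close>, so it has the complementary type, which belongs
    to \<open>q\<close> alone. The same reasoning gives the partners of \<open>q\<close> and
    \<open>r\<close>.\<close>
  have p_partner: "u = q" if "u \<in> S" "(p, u) \<in> parcs G" for u
  proof (rule inj[OF that(1) S'(2)])
    show "N u = N q" using partner[OF O(1) that] types d by auto
  qed
  have q_partner: "u = p" if "u \<in> S" "(q, u) \<in> parcs G" for u
  proof (rule inj[OF that(1) S'(1)])
    show "N u = N p" using partner[OF O(2) that] types d by auto
  qed
  have r_partner: "N u = {b, c}" if "u \<in> S" "(r, u) \<in> parcs G" for u
    using partner[OF O(3) that] types d by auto
  have arcs: "(y, a) \<in> parcs G" "(y, b) \<in> parcs G" "(y', c) \<in> parcs G" "(y', d) \<in> parcs G"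
    "(p, a) \<in> parcs G" "(p, c) \<in> parcs G" "(q, b) \<in> parcs G" "(q, d) \<in> parcs G"
    "(r, a) \<in> parcs G" "(r, d) \<in> parcs G"
    using N_arc(1) Ny types by auto
  have no_ab: "(a, b) \<notin> parcs G" "(a, c) \<notin> parcs G" "(a, d) \<notin> parcs G" "(b, d) \<notin> parcs G" "(c, d) \<notin> parcs G"
    using triangle_free[OF arcs(1) _ arcs(2)] triangle_free[OF arcs(5) _ arcs(6)]
      triangle_free[OF arcs(9) _ arcs(10)] triangle_free[OF arcs(7) _ arcs(8)]
      triangle_free[OF arcs(3) _ arcs(4)] by blast+
  show False
  proof (cases "(p, q) \<in> parcs G")
    case True
    have V: "{y, p, r} \<subseteq> pverts G" "y \<noteq> p" "y \<noteq> r" using y S' S_V O others_S by auto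
    obtain P where P: "monophonic_path G P" "y \<in> set P" "p \<in> set P" "r \<in> set P"
      using monophonic_through[OF V neq(2)] .
    note deg = path_degree[OF P(1)]
    have a: "a \<notin> set P"
      using deg[OF _ P(2-4) arcs(1,5,9)] V(2,3) neq(2) by blast
    have y_nb: "u = b \<or> u = y'" if "u \<in> set P" "(y, u) \<in> parcs G" for u
      using arc_cases[OF that(2)] matching[OF _ y(1,2) arc_sym[OF that(2)] y(3)] that(1) a Ny by auto
    have p_nb: "u = c \<or> u = q" if "u \<in> set P" "(p, u) \<in> parcs G" for u
      using arc_cases[OF that(2)] p_partner[OF _ that(2)] that(1) a types by auto
    have r_nb: "u = d \<or> u \<in> S" if "u \<in> set P" "(r, u) \<in> parcs G" for u
      using arc_cases[OF that(2)] that(1) a types by auto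
    define R where "R = {u \<in> S. (r, u) \<in> parcs G \<and> u \<in> set P}"
    have R: "N u = {b, c}" "(u, b) \<in> parcs G" "(u, c) \<in> parcs G" "(u, r) \<in> parcs G" "u \<in> set P"
      "u \<noteq> y" "u \<noteq> y'" "u \<noteq> p" "u \<noteq> q" if "u \<in> R" for u
    proof -
      show Nu: "N u = {b, c}" using r_partner that by (simp add: R_def)
      then show "(u, b) \<in> parcs G" "(u, c) \<in> parcs G" using N_arc(1)[of _ u] by auto
      show "(u, r) \<in> parcs G" "u \<in> set P" using that arc_sym by (auto simp: R_def)
      show "u \<noteq> y" "u \<noteq> y'" "u \<noteq> p" "u \<noteq> q"
        using Nu Ny types d by (auto simp: doubleton_eq_iff)
    qed
    \<comment> \<open>The contradiction is propositional in which of \<open>b\<close>,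
      \<open>c\<close>, \<open>d\<close>, \<open>y'\<close>, \<open>q\<close> and a partner of
      \<open>r\<close> are on the path. Fact \<open>1\<close> gives each of \<open>y\<close>,
      \<open>p\<close>, \<open>r\<close> a neighbour on it, \<open>2\<close> and \<open>3\<close>
      forbid third neighbours, and \<open>4\<close> gives a second neighbour to the middle one of
      the three.\<close>
    have 1: "b \<in> set P \<or> y' \<in> set P" "c \<in> set P \<or> q \<in> set P" "d \<in> set P \<or> R \<noteq> {}"
    proof -
      obtain u where "u \<in> set P" "(y, u) \<in> parcs G" using path_neighbour[OF P(1,2,3) V(2)] .
      then show "b \<in> set P \<or> y' \<in> set P" using y_nb by blast
      obtain u where "u \<in> set P" "(p, u) \<in> parcs G" using path_neighbour[OF P(1,3,2) V(2)[symmetric]] .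
      then show "c \<in> set P \<or> q \<in> set P" using p_nb by blast
      obtain u where "u \<in> set P" "(r, u) \<in> parcs G" using path_neighbour[OF P(1,4,2) V(3)[symmetric]] .
      then show "d \<in> set P \<or> R \<noteq> {}" using r_nb unfolding R_def by blast
    qed
    have O2: "y \<noteq> q" "y' \<noteq> q" "y' \<noteq> p" "y' \<noteq> r" using O others_S by auto
    have 2: "b \<in> set P \<Longrightarrow> q \<in> set P \<Longrightarrow> R = {}" "c \<in> set P \<Longrightarrow> y' \<in> set P \<Longrightarrow> R = {}"
      "\<not> (d \<in> set P \<and> y' \<in> set P \<and> q \<in> set P)"
    proof -
      show "R = {}" if "b \<in> set P" "q \<in> set P"
      proof (rule equals0I)
        fix u assume u: "u \<in> R"
        show False
          using deg[OF that(1) P(2) that(2) R(5)[OF u] arcs(2,7) R(2)[OF u]] O2(1) R(6,9)[OF u] by blast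
      qed
      show "R = {}" if "c \<in> set P" "y' \<in> set P"
      proof (rule equals0I)
        fix u assume u: "u \<in> R"
        show False
          using deg[OF that(1) P(3) that(2) R(5)[OF u] arcs(6,3) R(3)[OF u]] O2(3) R(7,8)[OF u] by blast
      qed
      show "\<not> (d \<in> set P \<and> y' \<in> set P \<and> q \<in> set P)"
        using deg[OF _ P(4) _ _ arcs(10,4,8)] O2(2,4) neq(3) by blast
    qed
    have 3: "\<not> (y' \<in> set P \<and> c \<in> set P \<and> d \<in> set P)" "\<not> (q \<in> set P \<and> b \<in> set P \<and> d \<in> set P)"
      "b \<in> set P \<Longrightarrow> c \<in> set P \<Longrightarrow> R = {}"
    proof -
      have "c \<notin> S" "b \<notin> S" "d \<notin> S"
        using N_not_S[of _ y] N_not_S[of _ y'] Ny by simp_all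
      then have n: "y \<noteq> c" "y \<noteq> d" "p \<noteq> b" "p \<noteq> d" "r \<noteq> b" "r \<noteq> c" "b \<noteq> d" "c \<noteq> d" "b \<noteq> c"
        using y(1) S' d by auto
      show "\<not> (y' \<in> set P \<and> c \<in> set P \<and> d \<in> set P)"
        using deg[OF _ P(2) _ _ y(3) arc_sym[OF arcs(3)] arc_sym[OF arcs(4)]] n by blast
      show "\<not> (q \<in> set P \<and> b \<in> set P \<and> d \<in> set P)"
        using deg[OF _ P(3) _ _ True arc_sym[OF arcs(7)] arc_sym[OF arcs(8)]] n by blast
      show "R = {}" if "b \<in> set P" "c \<in> set P"
      proof (rule equals0I)
        fix u assume u: "u \<in> R"
        show False
          using deg[OF R(5)[OF u] P(4) that arc_sym[OF R(4)[OF u]] arc_sym[OF R(2)[OF u]] arc_sym[OF R(3)[OF u]]] n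
          by blast
      qed
    qed
    have 4: "b \<in> set P \<and> y' \<in> set P \<or> c \<in> set P \<and> q \<in> set P \<or> d \<in> set P \<and> R \<noteq> {}"
    proof -
      have "{y, p, r} \<subseteq> set P" using P by simp
      then obtain w e f where w: "w \<in> {y, p, r}" "e \<in> set P" "f \<in> set P" "e \<noteq> f"
        "(w, e) \<in> parcs G" "(w, f) \<in> parcs G"
        using monophonic_path_interior[OF P(1) _ V(2,3) neq(2)] by metis
      have "e \<in> R \<or> e = d" "f \<in> R \<or> f = d" if "w = r"
        using r_nb[of e] r_nb[of f] w that by (auto simp: R_def)
      moreover have "e = f" if "e \<in> R" "f \<in> R"
        using matching[of e r f] that S' R(4) by (auto simp: R_def)
      ultimately show ?thesis
        using w y_nb[of e] y_nb[of f] p_nb[of e] p_nb[of f] by blast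
    qed
    show False using 1 2 3 4 by blast
  next
    case False
    then have unmatched: "u \<notin> S" if "(p, u) \<in> parcs G \<or> (q, u) \<in> parcs G" for u
      using p_partner[of u] q_partner[of u] that arc_sym by blast
    show False
    proof (cases "(b, c) \<in> parcs G")
      case False
      have bc: "(c, b) \<notin> parcs G" using False arc_sym by blast
      have p_nb: "u = a \<or> u = c" if "(p, u) \<in> parcs G" for u
        using arc_cases[OF that] unmatched that types by auto
      have q_nb: "u = b \<or> u = d" if "(q, u) \<in> parcs G" for u
        using arc_cases[OF that] unmatched that types by auto
      have "geodesic G [p, a, y, b, q]"
      proof (rule geodesic_5)
        show "(p, a) \<in> parcs G" "(a, y) \<in> parcs G" "(y, b) \<in> parcs G" "(b, q) \<in> parcs G"
          using arcs arc_sym by blast+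
        show "p \<noteq> q" "(p, q) \<notin> parcs G" by fact+
        show "(u, q) \<notin> parcs G" if "(p, u) \<in> parcs G" for u
          using p_nb[OF that] q_nb[of u] arc_sym[of u q] d by auto
        show "(u, t) \<notin> parcs G" if "(p, u) \<in> parcs G" "(t, q) \<in> parcs G" for u t
          using p_nb[OF that(1)] q_nb[OF arc_sym[OF that(2)]] no_ab bc by auto
      qed
      then show False
        using general_positionD[OF S, of _ p y q] S' y O others_S neq by fastforce
    next
      case True
      have bc: "\<not> {b, c} \<subseteq> N v" for v
        using triangle_free[OF _ True, of v] N_arc(1)[of _ v] by blast
      \<comment> \<open>Excluding \<open>{b, c}\<close> leaves three types in \<open>C\<close>, so
        with at least five vertices in \<open>others\<close> both \<open>A\<close> and
        \<open>B\<close> are nonempty. A member of \<open>A\<close> contains \<open>b\<close>, hence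
        not \<open>c\<close>, hence \<open>d\<close>; a member of \<open>B\<close> contains
        \<open>c\<close>, hence not \<open>b\<close>, hence \<open>a\<close>. Both thus contain
        \<open>N r\<close>.\<close>
      define A where "A = {v \<in> others. N y \<subseteq> N v}"
      define B where "B = {v \<in> others. N y' \<subseteq> N v}"
      define C where "C = {v \<in> others. \<not> N y \<subseteq> N v \<and> \<not> N y' \<subseteq> N v}"
      have fin: "finite A" "finite B" "finite C" using finite_others by (auto simp: A_def B_def C_def)
      have "N ` C \<subseteq> {{a, c}, {a, d}, {b, d}}"
        using crossing_types[OF T' Ny] bc by (fastforce simp: C_def)
      then have "card C \<le> card {{a, c}, {a, d}, {b, d}}"
        using others_S(1) by (intro card_le_types) (auto simp: C_def)
      also have "\<dots> \<le> 3" by (simp add: card_insert_if)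
      finally have "card C \<le> 3" .
      moreover have "others \<subseteq> A \<union> B \<union> C" by (auto simp: A_def B_def C_def)
      then have "card others \<le> card (A \<union> B \<union> C)" using fin by (intro card_mono) auto
      moreover have "card (A \<union> B \<union> C) \<le> card A + card B + card C"
        by (meson card_Un_le add_right_mono order_trans)
      moreover have "card A \<le> 1" "card B \<le> 1" using few by (simp_all add: A_def B_def)
      ultimately have "0 < card A" "0 < card B" using large card_others by linarith+
      then obtain v w where vw: "v \<in> A" "w \<in> B" by (metis card_gt_0_iff ex_in_conv)
      then have vw_O: "v \<in> others" "w \<in> others" by (auto simp: A_def B_def)
      have Nv: "b \<in> N v" "c \<notin> N v" "{a, d} \<subseteq> N v" 
        using vw(1) crosses_both_if_covering[OF T' vw_O(1)] bc[of v] Ny by (auto simp: A_def)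
      have Nw: "c \<in> N w" "{a, d} \<subseteq> N w"
        using vw(2) crosses_both_if_covering[OF T' vw_O(2)] bc[of w] Ny by (auto simp: B_def)
      have "r \<noteq> v" "r \<noteq> w" "v \<noteq> w" using Nv Nw types d by auto
      moreover have "{r, v, w} \<subseteq> pverts G" using S' vw_O others_S S_V by auto
      moreover have "u = a \<or> u = d" if "(r, u) \<in> parcs G" for u
        using arc_cases[OF that] r_partner[OF _ that] bc[of u] types by auto
      ultimately show False
        using not_dominated_twice[of r v w] Nv Nw N_arc(1) by blast
    qed
  qed
qed

text \<open>With seven vertices in \<open>S\<close> there are five in \<open>others\<close>, of
  which at most one contains \<open>N y\<close> and at most one contains \<open>N y'\<close>. The
  other three take one vertex from each pair. Any three of the four such types include a
  complementary pair, and this is the configuration of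
  \<open>no_three_crossing_types\<close>.\<close>

lemma card_S_le_if_2_2:
  assumes T': "T = N y \<union> N y'" and card: "card (N y) = 2" "card (N y') = 2"
  shows "card S \<le> 6"
proof (rule ccontr)
  assume "\<not> ?thesis"
  then have large: "7 \<le> card S" by simp
  interpret swap: matched_pair G S T y' y
    using y arc_sym by unfold_locales auto
  have swap_others: "swap.others = others" by (auto simp: swap.others_def others_def)
  obtain a b c d where Ny: "N y = {a, b}" "a \<noteq> b" "N y' = {c, d}" "c \<noteq> d"
    using card by (meson card_2_iff)
  have dist: "distinct [a, b, c, d]" using N_disjoint[OF y(3)] Ny by auto
  define A where "A = {v \<in> others. N y \<subseteq> N v}"
  define B where "B = {v \<in> others. N y' \<subseteq> N v}"
  define C where "C = {v \<in> others. \<not> N y \<subseteq> N v \<and> \<not> N y' \<subseteq> N v}"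
  have fin: "finite A" "finite B" "finite C" using finite_others by (auto simp: A_def B_def C_def)
  have A: "card A \<le> 1"
    using contains_unique_if_covering[OF T'] fin by (auto simp: A_def card_le_Suc0_iff_eq)
  have "T = N y' \<union> N y" using T' by blast
  then have B: "card B \<le> 1"
    using swap.contains_unique_if_covering fin swap_others by (auto simp: B_def card_le_Suc0_iff_eq)
  have "others \<subseteq> A \<union> B \<union> C" by (auto simp: A_def B_def C_def)
  then have "card others \<le> card (A \<union> B \<union> C)" using fin by (intro card_mono) auto
  also have "\<dots> \<le> card A + card B + card C"
    by (meson card_Un_le add_right_mono order_trans)
  finally have "3 \<le> card C" using A B large card_others by linarith
  then have card_NC: "3 \<le> card (N ` C)"
  proof -
    have "C \<subseteq> S" using others_S(1) by (auto simp: C_def)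
    then show ?thesis
      using card_image[OF inj_on_subset[OF inj_on_N]] \<open>3 \<le> card C\<close> by simp
  qed
  have NC: "N ` C \<subseteq> {{a, c}, {a, d}, {b, c}, {b, d}}"
    using crossing_types[OF T' Ny(1,3)] by (auto simp: C_def)
  have ex: "\<exists>v\<in>S. N v = X" if "X \<in> N ` C" for X
    using that others_S(1) by (auto simp: C_def)
  note AB = A[unfolded A_def] B[unfolded B_def]
  \<comment> \<open>Exchanging \<open>a\<close> with \<open>b\<close>, \<open>c\<close> with
    \<open>d\<close>, or both, carries each of the four triples of types to the excluded
    one.\<close>
  have swaps: "distinct [b, a, d, c]" "distinct [a, b, d, c]" "distinct [b, a, c, d]"
    "N y = {b, a}" "N y' = {d, c}" using dist Ny by auto
  have one: False if "{a, c} \<in> N ` C" "{b, d} \<in> N ` C" "{a, d} \<in> N ` C"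
    using no_three_crossing_types[OF dist Ny(1,3) T' _ _ _ _ _ _ AB large] ex that by metis
  have two: False if "{a, c} \<in> N ` C" "{b, d} \<in> N ` C" "{b, c} \<in> N ` C"
    using no_three_crossing_types[OF swaps(1,4,5) T' _ _ _ _ _ _ AB large] ex that by metis
  have three: False if "{a, d} \<in> N ` C" "{b, c} \<in> N ` C" "{a, c} \<in> N ` C"
    using no_three_crossing_types[OF swaps(2) Ny(1) swaps(5) T' _ _ _ _ _ _ AB large] ex that by metis
  have four: False if "{a, d} \<in> N ` C" "{b, c} \<in> N ` C" "{b, d} \<in> N ` C"
    using no_three_crossing_types[OF swaps(3,4) Ny(3) T' _ _ _ _ _ _ AB large] ex that by metis
  have "N ` C \<inter> {{a, c}, {a, d}, {b, c}, {b, d}} = N ` C" using NC by blast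
  moreover have "card (N ` C \<inter> {{a, c}, {a, d}, {b, c}, {b, d}}) \<le> 2"
    using one two three four
    by (cases "{a, c} \<in> N ` C"; cases "{a, d} \<in> N ` C"; cases "{b, c} \<in> N ` C"; cases "{b, d} \<in> N ` C")
      (simp_all add: Int_insert_right card_insert_if)
  ultimately show False using card_NC by simp
qed

text \<open>\<open>N y\<close> and \<open>N y'\<close> are disjoint, nonempty subsets of
  \<open>T\<close>, so few pairs of sizes remain. For \<open>card T = 4\<close> these are (1,1),
  (1,2), (1,3) and (2,2).\<close>

lemma card_S_le:
  assumes "card (N y) \<le> card (N y')"
  shows "card T = 2 \<Longrightarrow> card S \<le> 3" "card T = 3 \<Longrightarrow> card S \<le> 4" "card T = 4 \<Longrightarrow> card S \<le> 6"
proof -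
  have un: "card (N y \<union> N y') = card (N y) + card (N y')"
    using card_Un_disjoint[OF finite_N finite_N N_disjoint[OF y(3)]] .
  have sub: "N y \<union> N y' \<subseteq> T" using N_T by blast
  have le: "card (N y) + card (N y') \<le> card T" using card_mono[OF finite_T sub] un by simp
  have pos: "0 < card (N y)" using N_nonempty[OF y(1)] finite_N by (simp add: card_gt_0_iff)
  have cover: "T = N y \<union> N y'" if "card (N y) + card (N y') = card T"
    using card_subset_eq[OF finite_T sub] un that by simp
  have singleton: "\<exists>t. N v = {t}" if "card (N v) = 1" for v
    using that by (meson card_1_singletonE)
  have c1: "card S \<le> 3" if "card (N y) = 1" "card (N y) + card (N y') = card T"
    using card_S_le_if_covering_singleton cover that singleton by blast
  have c2: "card S \<le> 2 + 2 ^ (card T - 2)" if one: "card (N y) = 1" "card (N y') = 1"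
  proof -
    obtain t t' where t: "N y = {t}" "N y' = {t'}"
      using singleton[OF one(1)] singleton[OF one(2)] by blast
    then have "t \<noteq> t'" "{t, t'} \<subseteq> T" using N_disjoint[OF y(3)] sub by auto
    then have "card (T - {t, t'}) = card T - 2" using card_Diff_subset[of "{t, t'}" T] by simp
    then show ?thesis using card_S_le_if_singletons[OF t] by simp
  qed
  show "card S \<le> 3" if "card T = 2"
    using c1 that le pos assms by linarith
  show "card S \<le> 4" if T3: "card T = 3"
  proof (cases "card (N y) + card (N y') = 3")
    case True
    then show ?thesis using c1 T3 assms pos by linarith
  next
    case False
    then have "card (N y) = 1" "card (N y') = 1" using T3 le pos assms by linarith+
    then show ?thesis using c2 T3 by simp
  qed
  show "card S \<le> 6" if T4: "card T = 4"
  proof -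
    consider "card (N y) = 1" "card (N y') = 1" | "card (N y) = 1" "card (N y') = 2"
      | "card (N y) = 1" "card (N y') = 3" | "card (N y) = 2" "card (N y') = 2"
      using T4 le pos assms by linarith
    then show ?thesis
    proof cases
      case 1
      then show ?thesis using c2 T4 by simp
    next
      case 2
      obtain t where t: "N y = {t}" using singleton 2 by blast
      have "card (T - (N y \<union> N y')) = 1"
        using card_Diff_subset[OF _ sub] un 2 T4 finite_N by simp
      then obtain t4 where "T - (N y \<union> N y') = {t4}" by (meson card_1_singletonE)
      then have "T = N y \<union> N y' \<union> {t4}" using sub by blast
      then show ?thesis using card_S_le_if_1_2_1 t 2 by blast
    next
      case 3
      then show ?thesis using c1 T4 by simp
    next
      case 4
      then show ?thesis using card_S_le_if_2_2 cover T4 by simp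
    qed
  qed
qed

end

section \<open>Independent general position sets and the combined bounds\<close>

context mp_2_partition
begin

lemma card_independent_S_le:
  assumes indep: "\<And>x y. x \<in> S \<Longrightarrow> y \<in> S \<Longrightarrow> (x, y) \<notin> parcs G"
  shows "card T = 2 \<Longrightarrow> card S \<le> 3" "card T = 3 \<Longrightarrow> card S \<le> 4" "card T = 4 \<Longrightarrow> card S \<le> 6"
proof -
  have nb: "u \<in> N x" if "x \<in> S" "(x, u) \<in> parcs G" for x u
    using arc_cases[OF that(2)] indep that by blast
  have unsh: "z = w" if "x \<in> S" "z \<in> S" "w \<in> S" "N x \<subset> N z" "N x \<subset> N w" for x z w
  proof (rule ccontr)
    assume "z \<noteq> w"
    have "{x, z, w} \<subseteq> pverts G" "x \<noteq> z" "x \<noteq> w" using that S_V by auto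
    then show False
    proof (rule not_dominated_twice[OF _ _ _ \<open>z \<noteq> w\<close>])
      fix u assume "(x, u) \<in> parcs G"
      then have "u \<in> N x" by (rule nb[OF that(1)])
      then have "u \<in> N z" "u \<in> N w" using that(4,5) by blast+
      then show "(z, u) \<in> parcs G \<and> (w, u) \<in> parcs G" using N_arc(1)[of u z] N_arc(1)[of u w] by simp
    qed
  qed
  define F where "F = N ` S"
  have card_F: "card F = card S" by (simp add: F_def card_image inj_on_N)
  have F_T: "F \<subseteq> Pow T - {{}}" using N_T N_nonempty by (auto simp: F_def)
  have unshared_F: "unshared F" using unsh by (auto simp: unshared_def F_def)
  \<comment> \<open>Labelling \<open>T\<close> by numbers turns the family of neighbourhoods into
    one of sets of naturals, to which the explicit bounds apply.\<close>
  have transfer: "unshared ((`) f ` F)" "card ((`) f ` F) = card S" "(`) f ` F \<subseteq> Pow (f ` T) - {{}}"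
    if inj: "inj_on f T" for f :: "'a \<Rightarrow> nat"
  proof -
    have FT: "A \<subseteq> T" if "A \<in> F" for A using F_T that by blast
    have sub: "A \<subset> B" if "A \<in> F" "B \<in> F" "f ` A \<subset> f ` B" for A B
    proof -
      have "x \<in> B" if "x \<in> A" for x
        using inj_on_image_mem_iff[OF inj _ FT[OF \<open>B \<in> F\<close>], of x] FT[OF \<open>A \<in> F\<close>] that \<open>f ` A \<subset> f ` B\<close>
        by blast
      then show ?thesis using that(3) by auto
    qed
    show "unshared ((`) f ` F)"
      unfolding unshared_def
    proof (intro ballI impI)
      fix A' B' C' assume mem: "A' \<in> (`) f ` F" "B' \<in> (`) f ` F" "C' \<in> (`) f ` F"
        and less: "A' \<subset> B' \<and> A' \<subset> C'"
      obtain A B C where ABC: "A \<in> F" "B \<in> F" "C \<in> F" "A' = f ` A" "B' = f ` B" "C' = f ` C"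
        using mem by (elim imageE) simp
      have "A \<subset> B" "A \<subset> C"
        using sub[OF ABC(1,2)] sub[OF ABC(1,3)] less ABC(4-6) by simp_all
      then have "B = C"
        using unshared_F ABC(1-3) unfolding unshared_def by simp
      then show "B' = C'" using ABC by simp
    qed
    have "inj_on ((`) f) F"
      using FT inj by (intro inj_onI) (meson inj_on_image_eq_iff)
    then show "card ((`) f ` F) = card S" by (simp add: card_image card_F)
    show "(`) f ` F \<subseteq> Pow (f ` T) - {{}}" using F_T by auto
  qed
  show "card S \<le> 3" if "card T = 2"
  proof -
    have "card (Pow T) = Suc (card (Pow T - {{}}))"
      using finite_T by (intro card.remove) auto
    then have "card (Pow T - {{}}) = 3" using card_Pow[OF finite_T] that by simp
    then show ?thesis using card_mono[OF _ F_T] finite_T card_F by simp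
  qed
  show "card S \<le> 4" if T3: "card T = 3"
  proof -
    obtain f where "bij_betw f T {0..<3::nat}"
      using ex_bij_betw_finite_nat[OF finite_T] unfolding T3 by blast
    then have f: "inj_on f T" "f ` T = {0..<3}" by (auto simp: bij_betw_def)
    have "{0..<3::nat} = {0, 1, 2}" by auto
    then show ?thesis
      using card_unshared_3[OF transfer(1)[OF f(1)]] transfer(2,3)[OF f(1)] f(2) by simp
  qed
  have four: "{0..<4::nat} = {0, 1, 2, 3}" by auto
  \<comment> \<open>An edge in \<open>T\<close> forbids every set containing both of its ends; if
    \<open>T\<close> has no edge, the sets \<open>N x\<close> pairwise intersect. Either fact
    strengthens \<open>unshared\<close> enough.\<close>
  show "card S \<le> 6" if T4: "card T = 4"
  proof (cases "\<exists>s\<in>T. \<exists>t\<in>T. (s, t) \<in> parcs G")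
    case True
    then obtain s t where st: "s \<in> T" "t \<in> T" "(s, t) \<in> parcs G" by blast
    then have "s \<noteq> t" using arc_irrefl by blast
    then have "card (T - {s, t}) = 2" using st T4 by (simp add: card_Diff_subset)
    then obtain u v where uv: "T - {s, t} = {u, v}" "u \<noteq> v" by (meson card_2_iff)
    then have T': "T = {s, t, u, v}" using st by blast
    have dist: "distinct [s, t, u, v]" using uv \<open>s \<noteq> t\<close> by auto
    define f where "f = (\<lambda>_. 0::nat)(t := 1, u := 2, v := 3)"
    have f_vals: "f s = 0" "f t = 1" "f u = 2" "f v = 3" using dist by (auto simp: f_def)
    have inj: "inj_on f T" and im: "f ` T = {0, 1, 2, 3}"
      using dist f_vals unfolding T' by auto
    have "\<not> {0, 1} \<subseteq> A" if "A \<in> (`) f ` F" for A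
    proof
      assume "{0, 1} \<subseteq> A"
      moreover obtain x where x: "A = f ` N x" using \<open>A \<in> (`) f ` F\<close> by (auto simp: F_def)
      ultimately obtain s' t' where "s' \<in> N x" "f s' = 0" "t' \<in> N x" "f t' = 1" by fastforce
      then have "s \<in> N x" "t \<in> N x" using inj_onD[OF inj] N_T[of x] st f_vals by (metis subsetD)+
      then show False using triangle_free[OF _ st(3), of x] N_arc(1)[of _ x] by blast
    qed
    then show ?thesis
      using card_unshared_4_edge[OF transfer(1)[OF inj]] transfer(2,3)[OF inj] im by simp
  next
    case False
    \<comment> \<open>On a geodesic from \<open>x\<close> to \<open>y\<close> the second vertex is
      in \<open>T\<close>, as \<open>S\<close> is independent, and the third is in \<open>S\<close>,
      as \<open>T\<close> is independent. The third differs from \<open>y\<close> when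
      \<open>N x\<close> and \<open>N y\<close> are disjoint, and then three vertices of
      \<open>S\<close> lie on the geodesic.\<close>
    have meet: "N x \<inter> N y \<noteq> {}" if xy: "x \<in> S" "y \<in> S" for x y
    proof
      assume empty: "N x \<inter> N y = {}"
      then have "x \<noteq> y" using N_nonempty[OF xy(1)] by auto
      then obtain q where q: "geodesic G q" "hd q = x" "last q = y"
        using geodesic_from_to[of x y] xy S_V by blast
      have path: "distinct q" "set q \<subseteq> pverts G" "successively (\<lambda>u v. (u, v) \<in> parcs G) q" "q \<noteq> []"
        using q(1) by (auto simp: geodesic_iff vpath_iff)
      obtain t q' where q': "q = x # t # q'"
        using q path(4) \<open>x \<noteq> y\<close> by (cases q; cases "tl q") auto
      have t: "t \<in> N x" using nb[OF xy(1), of t] path(3) q' by simp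
      then have "t \<noteq> y" using N_not_S[OF t] xy(2) by auto
      then obtain w q'' where w: "q' = w # q''" using q(3) q' by (cases q') auto
      have tw: "(t, w) \<in> parcs G" using path(3) q' w by simp
      then have "w \<notin> T" using False t N_T[of x] by blast
      then have "w \<in> S" using path(2) q' w by (auto simp: T_iff)
      have "w \<noteq> y" using nb[OF xy(2) arc_sym, of t] tw t empty by blast
      moreover have "y \<in> set q" using q(3) path(4) last_in_set[of q] by simp
      ultimately show False
        using general_positionD[OF S q(1), of x w y] xy \<open>w \<in> S\<close> \<open>x \<noteq> y\<close> path(1) q' w by auto
    qed
    obtain f where "bij_betw f T {0..<4::nat}"
      using ex_bij_betw_finite_nat[OF finite_T] unfolding T4 by blast
    then have f: "inj_on f T" "f ` T = {0, 1, 2, 3}" using four by (auto simp: bij_betw_def)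
    have "A \<inter> B \<noteq> {}" if AB: "A \<in> (`) f ` F" "B \<in> (`) f ` F" for A B
    proof -
      obtain x y where "x \<in> S" "y \<in> S" "A = f ` N x" "B = f ` N y" using AB by (auto simp: F_def)
      then show ?thesis using meet[of x y] by auto
    qed
    then show ?thesis
      using card_unshared_4_intersecting[OF transfer(1)[OF f(1)]] transfer(2,3)[OF f(1)] f(2) by simp
  qed
qed

lemma card_S_bounds:
  shows "card T = 2 \<Longrightarrow> card S \<le> 3" "card T = 3 \<Longrightarrow> card S \<le> 4" "card T = 4 \<Longrightarrow> card S \<le> 6"
proof -
  have "(card T = 2 \<longrightarrow> card S \<le> 3) \<and> (card T = 3 \<longrightarrow> card S \<le> 4) \<and> (card T = 4 \<longrightarrow> card S \<le> 6)"
  proof (cases "\<exists>y\<in>S. \<exists>y'\<in>S. (y, y') \<in> parcs G")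
    case True
    then obtain y y' where y: "y \<in> S" "y' \<in> S" "(y, y') \<in> parcs G" by blast
    interpret A: matched_pair G S T y y' using y by unfold_locales
    interpret B: matched_pair G S T y' y using y arc_sym by unfold_locales
    show ?thesis
      using A.card_S_le B.card_S_le by (cases "card (N y) \<le> card (N y')") auto
  next
    case False
    then show ?thesis using card_independent_S_le by blast
  qed
  then show "card T = 2 \<Longrightarrow> card S \<le> 3" "card T = 3 \<Longrightarrow> card S \<le> 4" "card T = 4 \<Longrightarrow> card S \<le> 6"
    by blast+
qed

end

text \<open>For a largest \<open>S\<close>, a complement of 2, 3 or 4 vertices would limit
  \<open>S\<close> to 3, 4 or 6 vertices by \<open>card_S_bounds\<close>; smaller complements are
  excluded by \<open>order_ge_if_mp_less_gp\<close>.\<close>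

lemma (in pair_graph) order_ge_if_mp_eq_2:
  assumes "mp G = 2" "3 \<le> gp G"
  shows "gp G + 2 \<le> card (pverts G)" "3 < gp G \<Longrightarrow> gp G + 3 \<le> card (pverts G)"
    "4 < gp G \<Longrightarrow> gp G + 4 \<le> card (pverts G)" "6 < gp G \<Longrightarrow> gp G + 5 \<le> card (pverts G)"
proof -
  obtain S where gpS: "general_position G S" "card S = gp G"
    by (rule gp_attained)
  interpret mp_2_partition G S "pverts G - S"
    using gpS assms by unfold_locales auto
  show le: "gp G + 2 \<le> card (pverts G)"
    using order_ge_if_mp_less_gp assms by simp
  have "card (pverts G - S) = card (pverts G) - gp G"
    using card_Diff_subset[OF finite_S S_V] gpS(2) by simp
  then show "3 < gp G \<Longrightarrow> gp G + 3 \<le> card (pverts G)"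
    "4 < gp G \<Longrightarrow> gp G + 4 \<le> card (pverts G)" "6 < gp G \<Longrightarrow> gp G + 5 \<le> card (pverts G)"
    using card_S_bounds gpS(2) le by linarith+
qed

section \<open>Spiders with a hub\<close>

datatype spider_vertex = Hub | L nat | X nat | Y nat

instance spider_vertex :: countable
  by countable_datatype

text \<open>
  Without the hub the graph is a tree whose only branching vertex is \<open>L (3 * c - 1)\<close>: one
  leg \<open>L 0, \<dots>, L (3 * c - 1)\<close> and \<open>q\<close> legs of length one or two.
\<close>

fun spider_adj :: "nat \<Rightarrow> spider_vertex \<Rightarrow> spider_vertex \<Rightarrow> bool" where
  "spider_adj c Hub (L m) \<longleftrightarrow> m mod 3 \<noteq> 2"
| "spider_adj c Hub (X j) \<longleftrightarrow> True"
| "spider_adj c Hub (Y j) \<longleftrightarrow> True"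
| "spider_adj c (L m) (L n) \<longleftrightarrow> n = Suc m"
| "spider_adj c (L m) (X j) \<longleftrightarrow> Suc m = 3 * c"
| "spider_adj c (X i) (Y j) \<longleftrightarrow> i = j"
| "spider_adj c _ _ \<longleftrightarrow> False"

text \<open>\<open>c\<close> counts the blocks of three vertices on the long leg, and
  \<open>r\<close> the short legs that have length two. A block adds three to the order and two to
  the general position number, whereas every vertex of a short leg adds one to both;
  \<open>q + 1\<close> is the number of leaves of the tree.\<close>

locale spider =
  fixes c q r :: nat
  assumes c: "1 \<le> c" and q: "2 \<le> q" and r: "r \<le> q"
begin

definition V where "V = insert Hub (L ` {..<3 * c} \<union> X ` {..<q} \<union> Y ` {..<r})"

definition G where "G = graph_on V (spider_adj c)"

lemma V_simps [simp]:
  "Hub \<in> V" "L m \<in> V \<longleftrightarrow> m < 3 * c" "X j \<in> V \<longleftrightarrow> j < q" "Y j \<in> V \<longleftrightarrow> j < r"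
  by (auto simp: V_def)

lemma finite_V: "finite V"
  by (simp add: V_def)

lemma card_V: "card V = 3 * c + q + r + 1"
proof -
  have "card (L ` {..<3 * c} \<union> X ` {..<q} \<union> Y ` {..<r}) = 3 * c + q + r"
    by (subst card_Un_disjoint; (subst card_Un_disjoint)?) (auto simp: card_image inj_on_def)
  then show ?thesis
    by (simp add: V_def finite_V image_iff)
qed

sublocale pair_graph G
  unfolding G_def
proof (rule pair_graph_graph_on)
  show "\<not> spider_adj c v v" for v by (cases v) auto
qed (rule finite_V)

lemma pverts_G [simp]: "pverts G = V"
  by (simp add: G_def)

lemma arc_iff [simp]: "(u, v) \<in> parcs G \<longleftrightarrow> u \<in> V \<and> v \<in> V \<and> (spider_adj c u v \<or> spider_adj c v u)"
  by (simp add: G_def)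

definition N where "N = {v \<in> V. spider_adj c Hub v}"

lemma N_simps [simp]:
  "Hub \<notin> N" "L m \<in> N \<longleftrightarrow> m < 3 * c \<and> m mod 3 \<noteq> 2" "X j \<in> N \<longleftrightarrow> j < q" "Y j \<in> N \<longleftrightarrow> j < r"
  by (auto simp: N_def)

lemma N_V: "N \<subseteq> V"
  by (auto simp: N_def)

lemma hub_arc: "v \<in> N \<Longrightarrow> (v, Hub) \<in> parcs G" "v \<in> N \<Longrightarrow> (Hub, v) \<in> parcs G"
  by (auto simp: N_def)

text \<open>Leaving out the indices congruent to 2 modulo 3 cuts the long leg into single edges and
  separates it from the short legs, so the hub's neighbours induce a matching. The right-hand side
  is the only possible partner of \<open>x\<close>.\<close>

lemma arc_in_N:
  assumes "x \<in> N" "y \<in> N" "(x, y) \<in> parcs G"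
  shows "y = (case x of L m \<Rightarrow> L (if m mod 3 = 0 then m + 1 else m - 1) | X j \<Rightarrow> Y j | Y j \<Rightarrow> X j)"
  using assms by (cases x; cases y) (auto; presburger)+

lemma no_P3_in_N:
  assumes "x \<in> N" "y \<in> N" "z \<in> N" "(x, y) \<in> parcs G" "(y, z) \<in> parcs G" "x \<noteq> z"
  shows False
  using arc_in_N[of y x] arc_in_N[of y z] arc_sym assms by metis

lemma card_N: "card N = 2 * c + q + r"
proof -
  have fin: "finite N" using N_V finite_V by (rule finite_subset)
  have "card {m. m < 3 * c \<and> m mod 3 \<noteq> 2} = 2 * c"
  proof (induction c)
    case (Suc c)
    have "{m. m < 3 * Suc c \<and> m mod 3 \<noteq> 2} = {m. m < 3 * c \<and> m mod 3 \<noteq> 2} \<union> {3 * c, 3 * c + 1}"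
      by (auto simp: less_Suc_eq) presburger
    then show ?case
      using Suc by (simp add: card_insert_if)
  qed simp
  moreover have "N = L ` {m. m < 3 * c \<and> m mod 3 \<noteq> 2} \<union> X ` {..<q} \<union> Y ` {..<r}"
    using N_V by (auto simp: V_def)
  ultimately show ?thesis
    by (simp, subst card_Un_disjoint; (subst card_Un_disjoint)?) (auto simp: card_image inj_on_def)
qed

text \<open>A set avoiding the hub has at most two vertices in each block of the long leg, as a
  block is a geodesic. If the hub is in the set, its neighbours in the set are pairwise adjacent, so
  there are at most two of them; the hub and the \<open>c\<close> omitted vertices bring the total
  to at most \<open>c + 3\<close>, which is no larger.\<close>

lemma gp_G: "gp G = 2 * c + q + r"
proof (rule antisym)
  have "general_position G N"
  proof (rule general_position_diameter_2)
    show "N \<subseteq> pverts G" using N_V by simp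
    show "(x, y) \<in> parcs G \<or> (\<exists>u. (x, u) \<in> parcs G \<and> (u, y) \<in> parcs G)" if "x \<in> N" "y \<in> N" for x y
      using hub_arc that by blast
  qed (rule no_P3_in_N)
  then show "2 * c + q + r \<le> gp G"
    using card_le_gp card_N by force
next
  obtain S where S: "general_position G S" "card S = gp G"
    by (rule gp_attained)
  have SV: "S \<subseteq> V"
    using S(1) by (simp add: general_position_def)
  have fin: "finite S"
    using position_finite(1)[OF S(1)] .
  show "gp G \<le> 2 * c + q + r"
  proof (cases "Hub \<in> S")
    case False
    define T where "T i = {L (3 * i), L (3 * i + 1), L (3 * i + 2)}" for i
    have "card (S \<inter> T i) \<le> 2" if "i < c" for i
    proof -
      have "geodesic G [L (3 * i), L (3 * i + 1), L (3 * i + 2)]"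
        by (rule geodesic_3) (use that in auto)
      then have "card (S \<inter> set [L (3 * i), L (3 * i + 1), L (3 * i + 2)]) \<le> 2"
        using S(1) unfolding general_position_def by blast
      then show ?thesis by (simp add: T_def)
    qed
    then have "card (\<Union>i<c. S \<inter> T i) \<le> (\<Sum>i<c. 2)"
      by (intro order_trans[OF card_UN_le] sum_mono) auto
    moreover have "S \<subseteq> (\<Union>i<c. S \<inter> T i) \<union> (X ` {..<q} \<union> Y ` {..<r})"
    proof
      fix v assume v: "v \<in> S"
      show "v \<in> (\<Union>i<c. S \<inter> T i) \<union> (X ` {..<q} \<union> Y ` {..<r})"
      proof (cases v)
        case (L m)
        then have "m div 3 < c" using SV v by auto
        moreover have "m = 3 * (m div 3) \<or> m = 3 * (m div 3) + 1 \<or> m = 3 * (m div 3) + 2" by presburger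
        then have "v \<in> T (m div 3)" using L by (auto simp: T_def)
        ultimately show ?thesis using v by blast
      qed (use v SV False in auto)
    qed
    then have "card S \<le> card ((\<Union>i<c. S \<inter> T i) \<union> (X ` {..<q} \<union> Y ` {..<r}))"
      by (rule card_mono[rotated]) (auto simp: fin)
    moreover have "\<dots> \<le> card (\<Union>i<c. S \<inter> T i) + (card (X ` {..<q}) + card (Y ` {..<r}))"
      by (meson card_Un_le add_left_mono order_trans)
    moreover have "card (X ` {..<q}) \<le> q" "card (Y ` {..<r}) \<le> r"
      using card_image_le[of "{..<q}" X] card_image_le[of "{..<r}" Y] by simp_all
    ultimately show ?thesis using S(2) by simp
  next
    case True
    have adj: "(x, y) \<in> parcs G" if "x \<in> S \<inter> N" "y \<in> S \<inter> N" "x \<noteq> y" for x y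
      using general_positionD[OF S(1) geodesic_3[of x Hub y], of x Hub y] True that hub_arc N_simps
      by auto
    have N2: "card (S \<inter> N) \<le> 2"
    proof (rule ccontr)
      assume "\<not> ?thesis"
      then have "3 \<le> card (S \<inter> N)" by simp
      then obtain x y z where "x \<in> S \<inter> N" "y \<in> S \<inter> N" "z \<in> S \<inter> N" "x \<noteq> y" "x \<noteq> z" "y \<noteq> z"
        by (rule ex_three_distinct)
      then show False using no_P3_in_N[of x y z] adj by blast
    qed
    have "S \<subseteq> insert Hub ((S \<inter> N) \<union> (\<lambda>i. L (3 * i + 2)) ` {..<c})"
    proof
      fix v assume v: "v \<in> S"
      show "v \<in> insert Hub ((S \<inter> N) \<union> (\<lambda>i. L (3 * i + 2)) ` {..<c})"
      proof (cases v)
        case (L m)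
        show ?thesis
        proof (cases "m mod 3 = 2")
          case True
          then have "m = 3 * (m div 3) + 2" by presburger
          moreover have "m div 3 < c" using SV v L by auto
          ultimately show ?thesis using L by blast
        qed (use v SV L in auto)
      qed (use v SV in auto)
    qed
    then have "card S \<le> card (insert Hub ((S \<inter> N) \<union> (\<lambda>i. L (3 * i + 2)) ` {..<c}))"
      by (rule card_mono[rotated]) (auto simp: fin)
    also have "\<dots> \<le> Suc (card ((S \<inter> N) \<union> (\<lambda>i. L (3 * i + 2)) ` {..<c}))"
      by (rule card_insert_le_m1[THEN order_trans]) auto
    also have "\<dots> \<le> Suc (card (S \<inter> N) + card ((\<lambda>i. L (3 * i + 2)) ` {..<c}))"
      by (simp add: card_Un_le)
    also have "\<dots> \<le> Suc (2 + c)"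
      using N2 card_image_le[of "{..<c}" "\<lambda>i. L (3 * i + 2)"] by simp
    finally show ?thesis using S(2) c q by simp
  qed
qed

definition leaves where "leaves = insert (L 0) ((\<lambda>j. if j < r then Y j else X j) ` {..<q})"

lemma leaves_N: "leaves \<subseteq> N"
  using c r by (auto simp: leaves_def)

lemma card_leaves: "card leaves = q + 1"
proof -
  have "card ((\<lambda>j. if j < r then Y j else X j) ` {..<q}) = q"
    by (subst card_image) (auto simp: inj_on_def)
  moreover have "L 0 \<notin> (\<lambda>j. if j < r then Y j else X j) ` {..<q}"
    by auto
  ultimately show ?thesis
    unfolding leaves_def by (subst card_insert_disjoint) simp_all
qed

lemma leaf_degree:
  assumes "w \<in> leaves" "(w, a) \<in> parcs G" "(w, b) \<in> parcs G" "a \<noteq> Hub" "b \<noteq> Hub"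
  shows "a = b"
  using assms c by (cases a; cases b) (auto simp: leaves_def split: if_splits)

text \<open>The middle one of three leaves on an induced path has two neighbours there. A leaf has
  only one neighbour besides the hub, so the hub is on the path, adjacent to all three.\<close>

lemma monophonic_leaves: "monophonic_position G leaves"
proof (rule monophonic_positionI)
  fix p x y z assume p: "monophonic_path G p" and xyz: "{x, y, z} \<subseteq> set p" "{x, y, z} \<subseteq> leaves"
    and d: "x \<noteq> y" "x \<noteq> z" "y \<noteq> z"
  obtain w a b where w: "w \<in> {x, y, z}" "a \<in> set p" "b \<in> set p" "a \<noteq> b"
    "(w, a) \<in> parcs G" "(w, b) \<in> parcs G"
    using monophonic_path_interior[OF p xyz(1) d] .
  then have "Hub \<in> set p"
    using leaf_degree[of w a b] xyz(2) by auto
  then show False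
    using monophonic_path_degree[OF p, of Hub x y z] d xyz leaves_N hub_arc(2) by auto
qed (use leaves_N N_V in auto)

text \<open>The branching vertex counts as part of leg \<open>0\<close>; the value at
  \<open>Hub\<close> is only a default.\<close>

fun leg where
  "leg Hub = 0" | "leg (L m) = 0" | "leg (X j) = Suc j" | "leg (Y j) = Suc j"

definition long_path where
  "long_path j = map (\<lambda>m. if m < 3 * c then L m else if m = 3 * c then X j else Y j)
     [0..<(if j < r then 3 * c + 2 else 3 * c + 1)]"

lemma monophonic_long_path:
  assumes "j < q"
  shows "monophonic_path G (long_path j)"
  unfolding long_path_def using assms c r
  by (intro monophonic_path_map) (auto simp: inj_on_def split: if_splits)

lemma set_long_path:
  assumes "v \<in> V" "v \<noteq> Hub" "leg v = 0 \<or> leg v = Suc j"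
  shows "v \<in> set (long_path j)"
proof (cases v)
  case (Y i)
  then show ?thesis
    using assms by (auto simp: long_path_def intro!: image_eqI[of _ _ "3 * c + 1"])
next
  case (X i)
  then show ?thesis
    using assms by (auto simp: long_path_def intro!: image_eqI[of _ _ "3 * c"])
next
  case (L m)
  then show ?thesis
    using assms by (auto simp: long_path_def intro!: image_eqI[of _ _ m])
qed (use assms in auto)

definition short_path where
  "short_path i j = (if i < r then [Y i] else []) @ [X i, L (3 * c - 1), X j] @ (if j < r then [Y j] else [])"

lemma monophonic_short_path:
  assumes "i < q" "j < q" "i \<noteq> j"
  shows "monophonic_path G (short_path i j)"
  using assms c by (auto simp: short_path_def monophonic_path_iff_induced)

lemma set_short_path:
  assumes "v \<in> V" "leg v = Suc i \<or> leg v = Suc j"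
  shows "v \<in> set (short_path i j)"
  using assms by (cases v) (auto simp: short_path_def)

text \<open>Among \<open>q + 2\<close> vertices two lie on the same one of the \<open>q + 1\<close>
  legs. With any third vertex they occupy at most two legs, and two legs always lie on a common
  induced path of the tree.\<close>

lemma monophonic_position_without_hub:
  assumes S: "monophonic_position G S" "Hub \<notin> S"
  shows "card S \<le> q + 1"
proof (rule ccontr)
  assume "\<not> ?thesis"
  then have large: "q + 2 \<le> card S" by simp
  have SV: "S \<subseteq> V"
    using S(1) by (simp add: monophonic_position_def)
  have fin: "finite S"
    using position_finite(2)[OF S(1)] .
  have leg_le: "leg v \<le> q" if "v \<in> V" for v
    using that r by (cases v) auto
  have "leg ` S \<subseteq> {..q}" using leg_le SV by auto
  then have "card (leg ` S) < card S"
    using card_mono[of "{..q}" "leg ` S"] large by simp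
  then have "\<not> inj_on leg S" using pigeonhole by blast
  then obtain s t where st: "s \<in> S" "t \<in> S" "s \<noteq> t" "leg s = leg t"
    by (auto simp: inj_on_def)
  have "card {s, t} < card S" using large q st by simp
  then obtain u where u: "u \<in> S" "u \<noteq> s" "u \<noteq> t"
    by (metis card_mono finite.emptyI finite.insertI insertCI not_le subsetI)
  have "\<exists>p. monophonic_path G p \<and> {s, t, u} \<subseteq> set p"
  proof (cases "leg s = 0 \<or> leg u = 0 \<or> leg u = leg s")
    case True
    \<comment> \<open>If all three vertices are on leg \<open>0\<close>, truncated subtraction gives
      \<open>j = 0\<close>, and any short leg will do.\<close>
    define j where "j = (if leg s \<noteq> 0 then leg s - 1 else leg u - 1)"
    have "j < q"
      using leg_le[of s] leg_le[of u] st u SV q by (auto simp: j_def)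
    moreover have "{s, t, u} \<subseteq> set (long_path j)"
      using True st u S SV by (auto simp: j_def intro!: set_long_path)
    ultimately show ?thesis using monophonic_long_path by blast
  next
    case False
    then obtain i j where ij: "leg s = Suc i" "leg u = Suc j"
      by (metis not0_implies_Suc)
    then have "{s, t, u} \<subseteq> set (short_path i j)"
      using st u SV by (auto intro!: set_short_path)
    moreover have "i < q" "j < q" "i \<noteq> j"
      using ij leg_le[of s] leg_le[of u] st u SV False by auto
    ultimately show ?thesis using monophonic_short_path by blast
  qed
  then show False
    using monophonic_positionD[OF S(1)] st u by metis
qed

text \<open>Members adjacent to the hub are pairwise adjacent, hence at most two. Of the omitted
  vertices \<open>L (3 * i + 2)\<close> at most one is a member, because two of them lie on an
  induced path through the hub. If one is a member, every member in \<open>N\<close> must be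
  adjacent to \<open>L (3 * i + 1)\<close>, and only one vertex of \<open>N\<close> is.\<close>

lemma monophonic_position_with_hub:
  assumes S: "monophonic_position G S" "Hub \<in> S"
  shows "card S \<le> 3"
proof -
  have SV: "S \<subseteq> V"
    using S(1) by (simp add: monophonic_position_def)
  have fin: "finite S"
    using position_finite(2)[OF S(1)] .
  have adj: "(x, y) \<in> parcs G" if "x \<in> S \<inter> N" "y \<in> S \<inter> N" "x \<noteq> y" for x y
    using monophonic_positionD[OF S(1) monophonic_3[of x Hub y], of x Hub y] S(2) that hub_arc N_simps
    by auto
  have outer: "\<exists>i<c. v = L (3 * i + 2)" if v: "v \<in> S - N" "v \<noteq> Hub" for v
  proof (cases v)
    case (L m)
    then have "m mod 3 = 2" "m < 3 * c" using v SV by auto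
    then have "m = 3 * (m div 3) + 2" "m div 3 < c" by presburger+
    then show ?thesis using L by blast
  qed (use v SV in auto)
  have single: "v = w" if v: "v \<in> S - N" "v \<noteq> Hub" and w: "w \<in> S - N" "w \<noteq> Hub" for v w
  proof (rule ccontr)
    assume "v \<noteq> w"
    obtain i j where ij: "i < c" "j < c" "v = L (3 * i + 2)" "w = L (3 * j + 2)"
      using outer v w by metis
    have P: "monophonic_path G [L (3 * i + 2), L (3 * i + 1), Hub, L (3 * j + 1), L (3 * j + 2)]"
      using ij \<open>v \<noteq> w\<close> by (auto simp: monophonic_path_iff_induced; presburger)
    then show False
      using monophonic_positionD[OF S(1) P, of v Hub w] ij \<open>v \<noteq> w\<close> v w S(2) by auto
  qed
  have outer_N: "(L (3 * i + 1), x) \<in> parcs G" if "L (3 * i + 2) \<in> S" "i < c" "x \<in> S \<inter> N" for i x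
  proof (rule ccontr)
    assume no: "(L (3 * i + 1), x) \<notin> parcs G"
    have m2: "Suc (Suc (3 * i)) mod 3 = 2" by presburger
    then have "L (3 * i + 2) \<notin> N" by simp
    then have x: "x \<in> V" "x \<in> S" "x \<noteq> Hub" "(Hub, x) \<in> parcs G" "x \<noteq> L (3 * i + 2)"
      using that(3) N_V hub_arc by (auto simp del: arc_iff)
    show False
    proof (cases "(L (3 * i + 2), x) \<in> parcs G")
      case True
      have P: "monophonic_path G [L (3 * i + 2), x, Hub]"
        by (rule monophonic_3) (use True x arc_sym m2 in auto)
      then show False
        using monophonic_positionD[OF S(1) P, of "L (3 * i + 2)" x Hub] x that S(2) by auto
    next
      case False
      have "x \<noteq> L (3 * i + 1)" using False that by auto
      then have P: "monophonic_path G [L (3 * i + 2), L (3 * i + 1), Hub, x]"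
        using x no False that(2) m2 by (auto simp: monophonic_path_iff_induced)
      then show False
        using monophonic_positionD[OF S(1) P, of "L (3 * i + 2)" Hub x] x that S(2) by auto
    qed
  qed
  show ?thesis
  proof (cases "\<exists>v. v \<in> S - N \<and> v \<noteq> Hub")
    case True
    then obtain i where i: "i < c" "L (3 * i + 2) \<in> S" using outer by blast
    have "x = y" if "x \<in> S \<inter> N" "y \<in> S \<inter> N" for x y
      using no_P3_in_N[of x "L (3 * i + 1)" y] outer_N[OF i(2,1)] that i arc_sym by fastforce
    then have "card (S \<inter> N) \<le> 1"
      using fin by (metis One_nat_def card_le_Suc0_iff_eq finite_Int)
    moreover have "Suc (Suc (3 * i)) mod 3 = 2" by presburger
    then have "S \<subseteq> {Hub, L (3 * i + 2)} \<union> (S \<inter> N)"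
      using single[of "L (3 * i + 2)"] i by auto
    then have "card S \<le> card ({Hub, L (3 * i + 2)} \<union> (S \<inter> N))"
      by (rule card_mono[rotated]) (simp add: fin)
    moreover have "\<dots> \<le> card {Hub, L (3 * i + 2)} + card (S \<inter> N)"
      by (rule card_Un_le)
    ultimately show ?thesis by simp
  next
    case False
    have N2: "card (S \<inter> N) \<le> 2"
    proof (rule ccontr)
      assume "\<not> ?thesis"
      then have "3 \<le> card (S \<inter> N)" by simp
      then obtain x y z where "x \<in> S \<inter> N" "y \<in> S \<inter> N" "z \<in> S \<inter> N" "x \<noteq> y" "x \<noteq> z" "y \<noteq> z"
        by (rule ex_three_distinct)
      then show False using no_P3_in_N[of x y z] adj by blast
    qed
    have "card S \<le> card (insert Hub (S \<inter> N))"
      by (rule card_mono) (use False fin in auto)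
    then show ?thesis
      using N2 fin by (simp add: card_insert_if)
  qed
qed

lemma mp_G: "mp G = q + 1"
proof (rule antisym)
  obtain S where S: "monophonic_position G S" "card S = mp G"
    by (rule mp_attained)
  then show "mp G \<le> q + 1"
    using monophonic_position_without_hub[of S] monophonic_position_with_hub[of S] q
    by (cases "Hub \<in> S") simp_all
  show "q + 1 \<le> mp G"
    using card_le_mp[OF monophonic_leaves] card_leaves by simp
qed

end

lemma \<mu>_le_spider:
  assumes "1 \<le> c" "2 \<le> q" "r \<le> q"
  shows "\<mu> (q + 1) (2 * c + q + r) \<le> enat (3 * c + q + r + 1)"
proof -
  interpret spider c q r using assms by unfold_locales
  show ?thesis
    using \<mu>_le_order[OF pair_graph mp_G gp_G] card_V by simp
qed

lemma \<mu>_eq_add_2: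
  assumes "3 \<le> a" "a < b" "b \<le> 2 * a"
  shows "\<mu> a b = enat (b + 2)"
proof (rule antisym)
  \<comment> \<open>A single block suffices: with \<open>q = a - 1\<close> the value
    \<open>b\<close> determines \<open>r = b - a - 1\<close>, and \<open>b \<le> 2 * a\<close> says
    that \<open>r \<le> q\<close>.\<close>
  show "\<mu> a b \<le> enat (b + 2)"
    using \<mu>_le_spider[of 1 "a - 1" "b - a - 1"] assms by simp
  show "enat (b + 2) \<le> \<mu> a b"
    using assms by (intro \<mu>_ge) (auto dest: pair_graph.order_ge_if_mp_less_gp)
qed

lemma \<mu>_le_of_double_less:
  assumes "3 \<le> a" "2 * a < b"
  shows "\<mu> a b \<le> enat (b - a + 2 + (b + 1) div 2)"
proof -
  \<comment> \<open>The order of the spider exceeds \<open>b\<close> by \<open>c + 1\<close>, so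
    \<open>c\<close> should be small. With \<open>q = a - 1\<close>, the bound
    \<open>r \<le> a - 1\<close> forces \<open>2 * c \<ge> b - 2 * a + 2\<close>; the
    \<open>c\<close> chosen here is the least solution, and \<open>r\<close> is \<open>a - 1\<close>
    for even \<open>b\<close> and \<open>a - 2\<close> for odd \<open>b\<close>.\<close>
  define h where "h = (b + 1) div 2"
  define c where "c = h - a + 1"
  define r where "r = b - h - c"
  have h: "b + 1 = 2 * h \<or> b = 2 * h"
    unfolding h_def by linarith
  then have le: "a \<le> h" "c \<le> b - h" "h \<le> b"
    using assms unfolding c_def by linarith+
  have "c + a = h + 1" "r + c + h = b" "(a - 1) + 1 = a" "b - a + a = b"
    using le assms by (simp_all add: c_def r_def)
  then have "2 * c + (a - 1) + r = b" "3 * c + (a - 1) + r + 1 = b - a + 2 + h" "r \<le> a - 1"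
    using h by linarith+
  moreover have "1 \<le> c"
    by (simp add: c_def)
  ultimately show ?thesis
    using \<mu>_le_spider[of c "a - 1" r] assms by (simp add: h_def)
qed

section \<open>Graphs of monophonic position number two\<close>

text \<open>Antipodal vertices are at distance three in the whole graph, so any four consecutive
  vertices form a geodesic. Each vertex lies on four of these six geodesics; four chosen vertices
  would therefore put three on one of them.\<close>

lemma (in pair_graph) card_general_position_hexagon:
  assumes S: "general_position G S" and d: "distinct [u, v, w, x, y, z]"
    and arcs: "(u, v) \<in> parcs G" "(v, w) \<in> parcs G" "(w, x) \<in> parcs G"
      "(x, y) \<in> parcs G" "(y, z) \<in> parcs G" "(z, u) \<in> parcs G"
    and far: "(u, x) \<notin> parcs G" "(v, y) \<notin> parcs G" "(w, z) \<notin> parcs G"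
      "\<And>t. (u, t) \<in> parcs G \<Longrightarrow> (t, x) \<notin> parcs G"
      "\<And>t. (v, t) \<in> parcs G \<Longrightarrow> (t, y) \<notin> parcs G"
      "\<And>t. (w, t) \<in> parcs G \<Longrightarrow> (t, z) \<notin> parcs G"
  shows "card (S \<inter> {u, v, w, x, y, z}) \<le> 3"
proof -
  have far': "(x, u) \<notin> parcs G" "(y, v) \<notin> parcs G" "(z, w) \<notin> parcs G"
      "\<And>t. (x, t) \<in> parcs G \<Longrightarrow> (t, u) \<notin> parcs G"
      "\<And>t. (y, t) \<in> parcs G \<Longrightarrow> (t, v) \<notin> parcs G"
      "\<And>t. (z, t) \<in> parcs G \<Longrightarrow> (t, w) \<notin> parcs G"
    using far arc_sym by blast+
  have no3: "\<not> (a \<in> S \<and> b \<in> S \<and> c \<in> S) \<and> \<not> (a \<in> S \<and> b \<in> S \<and> e \<in> S) \<and>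
      \<not> (a \<in> S \<and> c \<in> S \<and> e \<in> S) \<and> \<not> (b \<in> S \<and> c \<in> S \<and> e \<in> S)"
    if "geodesic G [a, b, c, e]" for a b c e
  proof -
    have "distinct [a, b, c, e]" using that by (simp add: geodesic_iff vpath_iff)
    then show ?thesis
      using general_positionD[OF S that, of a b c] general_positionD[OF S that, of a b e]
        general_positionD[OF S that, of a c e] general_positionD[OF S that, of b c e]
      by auto
  qed
  have "geodesic G [u, v, w, x]" "geodesic G [v, w, x, y]" "geodesic G [w, x, y, z]"
    "geodesic G [x, y, z, u]" "geodesic G [y, z, u, v]" "geodesic G [z, u, v, w]"
    using geodesic_4[OF arcs(1,2,3) _ far(1,4)] geodesic_4[OF arcs(2,3,4) _ far(2,5)]
      geodesic_4[OF arcs(3,4,5) _ far(3,6)] geodesic_4[OF arcs(4,5,6) _ far'(1,4)]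
      geodesic_4[OF arcs(5,6,1) _ far'(2,5)] geodesic_4[OF arcs(6,1,2) _ far'(3,6)] d
    by auto
  note this[THEN no3]
  then show ?thesis
    using d
    by (cases "u \<in> S"; cases "v \<in> S"; cases "w \<in> S"; cases "x \<in> S"; cases "y \<in> S"; cases "z \<in> S")
      (simp_all add: Int_insert_right)
qed

datatype layered_vertex = C nat | S nat nat | Q nat

instance layered_vertex :: countable
  by countable_datatype

fun layered_adj :: "layered_vertex \<Rightarrow> layered_vertex \<Rightarrow> bool" where
  "layered_adj (C d) (S c i) \<longleftrightarrow> c \<noteq> d"
| "layered_adj (Q j) (S c i) \<longleftrightarrow> j = i \<or> j = Suc i"
| "layered_adj _ _ \<longleftrightarrow> False"

fun rank :: "layered_vertex \<Rightarrow> nat" where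
  "rank (C d) = 0" | "rank (S c i) = 1" | "rank (Q j) = 2"

text \<open>
  The vertex \<open>S c i\<close> has colour \<open>c < 3\<close> and lies in row \<open>i \<le> l\<close>; colour 2 occurs only in the
  rows of \<open>Z\<close>. Any two of them share one of the neighbours \<open>C 0\<close>, \<open>C 1\<close>, \<open>C 2\<close>. The vertex \<open>Q j\<close>
  is joined to the rows \<open>j - 1\<close> and \<open>j\<close>.
\<close>

locale layered =
  fixes l :: nat and Z :: "nat set"
  assumes l: "2 \<le> l" and Z: "1 \<in> Z" "Z \<subseteq> {0, 1}"
begin

definition V where
  "V = C ` {..<3} \<union> S 0 ` {..l} \<union> S 1 ` {..l} \<union> S 2 ` Z \<union> Q ` {1..l}"

definition G where "G = graph_on V layered_adj"

lemma V_simps [simp]: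
  "C d \<in> V \<longleftrightarrow> d < 3" "Q j \<in> V \<longleftrightarrow> 1 \<le> j \<and> j \<le> l"
  "S c i \<in> V \<longleftrightarrow> c < 2 \<and> i \<le> l \<or> c = 2 \<and> i \<in> Z"
  by (auto simp: V_def less_2_cases_iff)

lemma Z_cases: "i \<in> Z \<Longrightarrow> i = 0 \<or> i = 1"
  using Z by auto

lemma finite_Z: "finite Z"
  using Z by (auto intro: finite_subset)

lemma finite_V: "finite V"
  by (simp add: V_def finite_Z)

sublocale pair_graph G
  unfolding G_def
proof (rule pair_graph_graph_on)
  show "\<not> layered_adj v v" for v by (cases v) auto
qed (rule finite_V)

lemma pverts_G [simp]: "pverts G = V"
  by (simp add: G_def)

lemma arc_iff [simp]: "(u, v) \<in> parcs G \<longleftrightarrow> u \<in> V \<and> v \<in> V \<and> (layered_adj u v \<or> layered_adj v u)"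
  by (simp add: G_def)

definition W where "W = S 0 ` {..l} \<union> S 1 ` {..l} \<union> S 2 ` Z"

lemma card_W: "card W = 2 * l + 2 + card Z"
  unfolding W_def using finite_Z
  by (subst card_Un_disjoint; (subst card_Un_disjoint)?) (auto simp: card_image inj_on_def)

lemma card_V: "card V = 3 * l + 5 + card Z"
proof -
  have "V = W \<union> (C ` {..<3} \<union> Q ` {1..l})" by (auto simp: V_def W_def)
  moreover have "card (W \<union> (C ` {..<3} \<union> Q ` {1..l})) = card W + (3 + l)"
    by (subst card_Un_disjoint; (subst card_Un_disjoint)?)
      (auto simp: W_def finite_Z card_image inj_on_def)
  ultimately show ?thesis by (simp add: card_W)
qed

text \<open>The vertices \<open>S c i\<close> are independent, and two of them have a common
  neighbour \<open>C d\<close> with \<open>d\<close> different from both colours. For the upper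
  bound the vertices are split into \<open>l\<close> geodesics with at most two chosen vertices
  each, a hexagon formed by \<open>C 0\<close>, \<open>C 1\<close>, \<open>C 2\<close> and one
  \<open>S\<close> vertex of each colour with at most three, and the remaining
  \<open>card Z - 1\<close> vertices of colour 2.\<close>

lemma gp_G: "gp G = 2 * l + 2 + card Z"
proof (rule antisym)
  have "general_position G W"
  proof (rule general_position_diameter_2)
    fix x y assume "x \<in> W" "y \<in> W"
    then obtain a i b j where xy: "x = S a i" "y = S b j" "a < 3" "b < 3" "x \<in> V" "y \<in> V"
      by (auto simp: W_def)
    have "\<exists>d<3. d \<noteq> a \<and> d \<noteq> b" by presburger
    then obtain d where "d < 3" "d \<noteq> a" "d \<noteq> b" by blast
    then have "(x, C d) \<in> parcs G" "(C d, y) \<in> parcs G" using xy by auto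
    then show "(x, y) \<in> parcs G \<or> (\<exists>u. (x, u) \<in> parcs G \<and> (u, y) \<in> parcs G)" by blast
  qed (auto simp: W_def V_def)
  then show "2 * l + 2 + card Z \<le> gp G"
    using card_le_gp card_W by force
next
  obtain X where X: "general_position G X" "card X = gp G"
    by (rule gp_attained)
  have XV: "X \<subseteq> V"
    using X(1) by (simp add: general_position_def)
  have fin: "finite X"
    using position_finite(1)[OF X(1)] .
  define T where "T i = {S 0 i, Q i, S 1 i}" for i
  define H where "H = {C 2, S 0 0, C 1, S 2 1, C 0, S 1 0}"
  have "card (X \<inter> T i) \<le> 2" if "i \<in> {1..l}" for i
  proof -
    have "geodesic G [S 0 i, Q i, S 1 i]"
      by (rule geodesic_3) (use that in auto)
    then have "card (X \<inter> set [S 0 i, Q i, S 1 i]) \<le> 2"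
      using X(1) unfolding general_position_def by blast
    then show ?thesis by (simp add: T_def)
  qed
  then have "card (\<Union>i\<in>{1..l}. X \<inter> T i) \<le> (\<Sum>i\<in>{1..l}. 2)"
    by (intro order_trans[OF card_UN_le] sum_mono) auto
  moreover have "card (X \<inter> H) \<le> 3"
    unfolding H_def
    by (rule card_general_position_hexagon[OF X(1)]) (use Z in \<open>auto elim!: layered_adj.elims\<close>)
  moreover have "card (S 2 ` (Z - {1})) \<le> card Z - 1"
    using card_image_le[of "Z - {1}" "S 2"] finite_Z Z by simp
  moreover have "X \<subseteq> ((\<Union>i\<in>{1..l}. X \<inter> T i) \<union> (X \<inter> H)) \<union> S 2 ` (Z - {1})"
  proof
    fix v assume v: "v \<in> X"
    then have "v \<in> V" using XV by blast
    then show "v \<in> ((\<Union>i\<in>{1..l}. X \<inter> T i) \<union> (X \<inter> H)) \<union> S 2 ` (Z - {1})"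
    proof (cases v)
      case (C d)
      then have "d = 0 \<or> d = 1 \<or> d = 2" using \<open>v \<in> V\<close> by auto
      then show ?thesis using C v by (auto simp: H_def)
    next
      case (S c i)
      then consider "c = 0" "i = 0" | "c = 1" "i = 0" | "c < 2" "i \<in> {1..l}" | "c = 2" "i \<in> Z"
        using \<open>v \<in> V\<close> by force
      then show ?thesis
      proof cases
        case 3
        then have "v \<in> T i" using S by (auto simp: T_def less_2_cases_iff)
        then show ?thesis using 3 v by blast
      qed (use S v in \<open>auto simp: H_def\<close>)
    next
      case (Q j)
      then have "v \<in> T j" "j \<in> {1..l}" using \<open>v \<in> V\<close> by (auto simp: T_def)
      then show ?thesis using v by blast
    qed
  qed
  then have "card X \<le> card (((\<Union>i\<in>{1..l}. X \<inter> T i) \<union> (X \<inter> H)) \<union> S 2 ` (Z - {1}))"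
    by (rule card_mono[rotated]) (auto simp: fin finite_Z)
  moreover have "\<dots> \<le> card (\<Union>i\<in>{1..l}. X \<inter> T i) + card (X \<inter> H) + card (S 2 ` (Z - {1}))"
    by (meson card_Un_le add_right_mono order_trans)
  moreover have "1 \<le> card Z"
    using Z finite_Z by (metis One_nat_def Suc_leI card_gt_0_iff empty_iff)
  ultimately show "gp G \<le> 2 * l + 2 + card Z"
    using X(2) by simp
qed

section \<open>Induced paths through all triples of a layered graph\<close>

definition on_path where "on_path A \<longleftrightarrow> (\<exists>p. monophonic_path G p \<and> A \<subseteq> set p)"

lemma on_pathI: "monophonic_path G p \<Longrightarrow> A \<subseteq> set p \<Longrightarrow> on_path A"
  by (auto simp: on_path_def)

lemma other_colour: obtains x where "x < 2" "x \<noteq> (a::nat)"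
  using that[of 0] that[of 1] by (cases "a = 0") auto

lemma on_path_CCCSS:
  assumes "a < 3" "b < 3" "d < 3" "a \<noteq> b" "a \<noteq> d" "b \<noteq> d" "S a i \<in> V" "S b j \<in> V"
  shows "on_path {C a, C b, C d, S a i, S b j}"
  by (rule on_pathI[of "[C b, S a i, C d, S b j, C a]"])
    (use assms in \<open>auto simp: monophonic_path_iff_induced\<close>)

lemma third_colour: obtains d where "d < 3" "d \<noteq> (a::nat)" "d \<noteq> b"
proof -
  have "\<exists>d<3. d \<noteq> a \<and> d \<noteq> b" by presburger
  then show thesis using that by blast
qed

lemma on_path_mono: "on_path B \<Longrightarrow> A \<subseteq> B \<Longrightarrow> on_path A"
  by (auto simp: on_path_def)

text \<open>A row \<open>i\<close> is attached to \<open>Q i\<close> and \<open>Q (Suc i)\<close>,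
  except that row 0 has only \<open>Q 1\<close> and row \<open>l\<close> only \<open>Q l\<close>.
  Hence some \<open>Q\<close> separates row \<open>i\<close> from row \<open>j\<close> unless
  \<open>i\<close> is such an extreme row and \<open>j\<close> is next to it; then
  \<open>l \<ge> 2\<close> gives a \<open>Q\<close> attached to \<open>j\<close> and not to
  \<open>i\<close>.\<close>

lemma separating_Q:
  assumes "i \<le> l" "j \<le> l" "i \<noteq> j"
  obtains q where "1 \<le> q" "q \<le> l" "q = i \<or> q = Suc i" "q \<noteq> j" "q \<noteq> Suc j"
  | q where "1 \<le> q" "q \<le> l" "q = j \<or> q = Suc j" "q \<noteq> i" "q \<noteq> Suc i"
      "i = 0 \<and> j = 1 \<or> i = l \<and> Suc j = l"
proof -
  consider "i < j" "1 \<le> i" | "i = 0" "j = 1" | "i = 0" "2 \<le> j" | "j < i" "i < l"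
    | "i = l" "Suc j = l" | "i = l" "Suc j < l"
    using assms by linarith
  then show thesis
    using that(1)[of i] that(1)[of "Suc i"] that(2)[of 2] that(2)[of "l - 1"] assms l
    by cases auto
qed

lemma on_path_C_S_S:
  assumes "C e \<in> V" "S a i \<in> V" "S b j \<in> V" "S a i \<noteq> S b j"
  shows "on_path {C e, S a i, S b j}"
proof (cases "a = b")
  case False
  obtain d where d: "d < 3" "d \<noteq> a" "d \<noteq> b" by (rule third_colour)
  have ab: "a < 3" "b < 3" using assms by auto
  have "e = a \<or> e = b \<or> e = d"
    using assms(1) ab d False by simp linarith
  then show ?thesis
    using on_path_CCCSS[OF ab d(1) False] d assms by (auto intro: on_path_mono)
next
  case b: True
  then have ij: "i \<noteq> j" "i \<le> l" "j \<le> l" using assms Z_cases l by fastforce+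
  show ?thesis
  proof (cases "e = a")
    case False
    then show ?thesis
      using assms b by (intro on_pathI[of "[S a i, C e, S a j]"]) (auto simp: monophonic_path_iff_induced)
  next
    case True
    obtain x where x: "x < 2" "x \<noteq> a" by (rule other_colour)
    from ij(2,3,1) show ?thesis
    proof (cases rule: separating_Q)
      case (1 q)
      then show ?thesis
        using assms b x True ij
        by (intro on_pathI[of "[S a j, C x, S a i, Q q, S x i, C a]"])
          (auto simp: monophonic_path_iff_induced)
    next
      case (2 q)
      then show ?thesis
        using assms b x True ij
        by (intro on_pathI[of "[S a i, C x, S a j, Q q, S x j, C a]"])
          (auto simp: monophonic_path_iff_induced)
    qed
  qed
qed

lemma on_path_C_C_Q:
  assumes "C a \<in> V" "C b \<in> V" "a \<noteq> b" "Q q \<in> V"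
  shows "on_path {C a, C b, Q q}"
proof -
  \<comment> \<open>A row not attached to \<open>Q q\<close>: row 0 is attached only to
    \<open>Q 1\<close>, and row \<open>l\<close>, where \<open>l \<ge> 2\<close>, only to
    \<open>Q l\<close>.\<close>
  define r where "r = (if 2 \<le> q then 0 else l)"
  have r: "r \<le> l" "q \<noteq> r" "q \<noteq> Suc r" using assms l by (auto simp: r_def)
  have two: "on_path {C x, C 2, Q q}" if "x < 2" for x
  proof -
    obtain y where "y < 2" "y \<noteq> x" by (rule other_colour)
    then show ?thesis
      using that r assms
      by (intro on_pathI[of "[C x, S y r, C 2, S x q, Q q]"]) (auto simp: monophonic_path_iff_induced)
  qed
  have zero_one: "on_path {C 0, C 1, Q q}"
    using assms
    by (intro on_pathI[of "[C 1, S 0 q, Q q, S 1 q, C 0]"]) (auto simp: monophonic_path_iff_induced)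
  have "a = 0 \<or> a = 1 \<or> a = 2" "b = 0 \<or> b = 1 \<or> b = 2" using assms by auto
  then show ?thesis
    using assms(3) two[of 0] two[of 1] zero_one by (auto simp: insert_commute)
qed

lemma on_path_C_S_Q:
  assumes "C e \<in> V" "S a i \<in> V" "Q q \<in> V"
  shows "on_path {C e, S a i, Q q}"
proof -
  have i: "i \<le> l" using assms Z_cases l by fastforce
  consider "q = i \<or> q = Suc i" "e \<noteq> a" | "q = i \<or> q = Suc i" "e = a"
    | "q \<noteq> i" "q \<noteq> Suc i" "e \<noteq> a" | "q \<noteq> i" "q \<noteq> Suc i" "e = a" "a < 2"
    | "q \<noteq> i" "q \<noteq> Suc i" "e = a" "a = 2"
    using assms by fastforce
  then show ?thesis
  proof cases
    case 1
    then show ?thesis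
      using assms by (intro on_pathI[of "[C e, S a i, Q q]"]) (auto simp: monophonic_path_iff_induced)
  next
    case 2
    obtain x where "x < 2" "x \<noteq> a" by (rule other_colour)
    then show ?thesis
      using assms 2 i
      by (intro on_pathI[of "[S a i, Q q, S x i, C a]"]) (auto simp: monophonic_path_iff_induced)
  next
    case 3
    obtain x where "x < 2" "x \<noteq> e" by (rule other_colour)
    then show ?thesis
      using assms 3
      by (intro on_pathI[of "[S a i, C e, S x q, Q q]"]) (auto simp: monophonic_path_iff_induced)
  next
    case 4
    obtain x where "x < 2" "x \<noteq> a" by (rule other_colour)
    then show ?thesis
      using assms 4
      by (intro on_pathI[of "[S a i, C x, S a q, Q q, S x q, C a]"])
        (auto simp: monophonic_path_iff_induced)
  next
    case 5
    then show ?thesis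
      using assms i
      by (intro on_pathI[of "[Q q, S 0 q, C 2, S 1 i, C 0, S 2 i]"])
        (auto simp: monophonic_path_iff_induced)
  qed
qed

lemma on_path_C_Q_Q:
  assumes "C e \<in> V" "Q q \<in> V" "Q r \<in> V" "q \<noteq> r"
  shows "on_path {C e, Q q, Q r}"
proof -
  obtain x where x: "x < 2" "x \<noteq> e" by (rule other_colour)
  have less: "on_path {C e, Q q, Q r}" if "q < r" "Q q \<in> V" "Q r \<in> V" for q r
    using assms(1) x that
    by (intro on_pathI[of "[Q q, S x (q - 1), C e, S x r, Q r]"]) (auto simp: monophonic_path_iff_induced)
  show ?thesis
    using less[of q r] less[of r q] assms by (cases "q < r") (auto intro: on_path_mono)
qed

text \<open>The path runs through the rows as \<open>S (f 0) 0\<close>, \<open>Q 1\<close>,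
  \<open>S (f 1) 1\<close>, \<open>Q 2\<close> and so on, with a free choice of colour in each row.
  It serves all triples of \<open>S\<close> and \<open>Q\<close> vertices in which no two
  \<open>S\<close> vertices share a row.\<close>

lemma on_path_zigzag:
  assumes "\<And>i. i \<le> l \<Longrightarrow> S (f i) i \<in> V"
  shows "on_path ((\<lambda>i. S (f i) i) ` {..l} \<union> Q ` {1..l})"
proof -
  define g where "g m = (if even m then S (f (m div 2)) (m div 2) else Q (Suc (m div 2)))" for m
  have gV: "g m \<in> V" if "m < 2 * l + 1" for m
  proof (cases "even m")
    case True
    moreover have "m div 2 \<le> l" using that by linarith
    ultimately show ?thesis using assms[of "m div 2"] by (simp add: g_def)
  next
    case False
    then show ?thesis using that by (auto simp: g_def elim!: oddE)
  qed
  have "monophonic_path G (map g [0..<2 * l + 1])"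
  proof (rule monophonic_path_map)
    show "inj_on g {..<2 * l + 1}"
      by (auto simp: inj_on_def g_def elim!: evenE oddE split: if_splits)
    show "g ` {..<2 * l + 1} \<subseteq> pverts G"
      using gV by auto
    fix i j assume "i < j" "j < 2 * l + 1"
    moreover from this have "g i \<in> V" "g j \<in> V"
      using gV by simp_all
    ultimately show "(g i, g j) \<in> parcs G \<longleftrightarrow> j = Suc i"
      by (auto simp: g_def elim!: evenE oddE; presburger)
  qed simp
  moreover have "S (f i) i \<in> set (map g [0..<2 * l + 1])" if "i \<le> l" for i
    using that by (auto simp: g_def intro!: image_eqI[of _ _ "2 * i"])
  moreover have "Q j \<in> set (map g [0..<2 * l + 1])" if "1 \<le> j" "j \<le> l" for j
    using that by (auto simp: g_def intro!: image_eqI[of _ _ "2 * j - 1"])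
  ultimately show ?thesis
    by (intro on_pathI[of "map g [0..<2 * l + 1]"]) (fastforce simp del: upt_Suc set_map)+
qed

lemma on_path_three_colours:
  assumes "a \<noteq> b" "a \<noteq> d" "b \<noteq> d" "S a i \<in> V" "S b j \<in> V" "S d k \<in> V"
  shows "on_path {S a i, S b j, S d k}"
  using assms
  by (intro on_pathI[of "[S a i, C d, S b j, C a, S d k]"]) (auto simp: monophonic_path_iff_induced)

lemma on_path_same_row_S:
  assumes "a \<noteq> b" "i \<noteq> j" "S a i \<in> V" "S b i \<in> V" "S a j \<in> V"
  shows "on_path {S a i, S b i, S a j}"
proof -
  have ij: "i \<le> l" "j \<le> l" using assms Z_cases l by fastforce+
  then show ?thesis using assms(2)
  proof (cases rule: separating_Q)
    case (1 q)
    then show ?thesis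
      using assms
      by (intro on_pathI[of "[S a j, C b, S a i, Q q, S b i]"]) (auto simp: monophonic_path_iff_induced)
  next
    case (2 q)
    \<comment> \<open>Colour 2 is the only obstacle. It does not occur in row
      \<open>l \<ge> 2\<close>, so here \<open>b = 2\<close> forces \<open>i = 0\<close> and
      \<open>j = 1\<close>, and row 1 has this colour.\<close>
    then have "S b j \<in> V" using assms ij Z_cases Z l by force
    then show ?thesis
      using assms 2
      by (intro on_pathI[of "[S a i, C b, S a j, Q q, S b j, C a, S b i]"])
        (auto simp: monophonic_path_iff_induced)
  qed
qed

lemma on_path_same_row_Q:
  assumes "a \<noteq> b" "S a i \<in> V" "S b i \<in> V" "Q q \<in> V"
  shows "on_path {S a i, S b i, Q q}"
proof -
  have i: "i \<le> l" using assms Z_cases l by fastforce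
  obtain e where e: "e < 2" "e \<noteq> a" by (rule other_colour)
  consider "q = i \<or> q = Suc i" | "Suc i < q" | "q < i" by linarith
  then show ?thesis
  proof cases
    case 1
    then show ?thesis
      using assms by (intro on_pathI[of "[S a i, Q q, S b i]"]) (auto simp: monophonic_path_iff_induced)
  next
    case 2
    \<comment> \<open>\<open>Q r\<close> is attached to row \<open>i\<close>; the maximum is there
      because row 0 has only \<open>Q 1\<close>.\<close>
    define r where "r = max i 1"
    have "r = i \<or> r = Suc i" "1 \<le> r" "r < q" using 2 by (auto simp: r_def)
    then show ?thesis
      using assms e 2
      by (intro on_pathI[of "[Q q, S e q, C a, S b i, Q r, S a i]"]) (auto simp: monophonic_path_iff_induced)
  next
    case 3
    then show ?thesis
      using assms e i
      by (intro on_pathI[of "[Q q, S e (q - 1), C a, S b i, Q i, S a i]"])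
        (auto simp: monophonic_path_iff_induced)
  qed
qed

lemma on_path_S_S_Q:
  assumes "S a i \<in> V" "S b j \<in> V" "S a i \<noteq> S b j" "Q q \<in> V"
  shows "on_path {S a i, S b j, Q q}"
proof (cases "i = j")
  case False
  define f where "f = (\<lambda>_. 0::nat)(i := a, j := b)"
  have "on_path ((\<lambda>i. S (f i) i) ` {..l} \<union> Q ` {1..l})"
    by (rule on_path_zigzag) (use assms False in \<open>auto simp: f_def\<close>)
  moreover have "S a i = S (f i) i" "S b j = S (f j) j" "i \<le> l" "j \<le> l"
    using False assms Z_cases l by (auto simp: f_def dest!: Z_cases)
  ultimately show ?thesis
    using assms by (auto elim!: on_path_mono)
qed (use on_path_same_row_Q assms in auto)

lemma on_path_S_Q_Q:
  assumes "S a i \<in> V" "Q q \<in> V" "Q r \<in> V"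
  shows "on_path {S a i, Q q, Q r}"
proof -
  define f where "f = (\<lambda>_. 0::nat)(i := a)"
  have "on_path ((\<lambda>i. S (f i) i) ` {..l} \<union> Q ` {1..l})"
    by (rule on_path_zigzag) (use assms in \<open>auto simp: f_def\<close>)
  moreover have "S a i = S (f i) i" "i \<le> l"
    using assms Z_cases l by (auto simp: f_def dest!: Z_cases)
  ultimately show ?thesis
    using assms by (auto elim!: on_path_mono)
qed

lemma on_path_Q_Q_Q:
  assumes "Q q \<in> V" "Q r \<in> V" "Q s \<in> V"
  shows "on_path {Q q, Q r, Q s}"
  using on_path_zigzag[of "\<lambda>_. 0"] assms by (auto elim!: on_path_mono)

lemma on_path_S_S_S:
  assumes "S a i \<in> V" "S b j \<in> V" "S d k \<in> V" "S a i \<noteq> S b j" "S a i \<noteq> S d k" "S b j \<noteq> S d k"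
  shows "on_path {S a i, S b j, S d k}"
proof -
  have same: "on_path {S a i, S b i, S d k}"
    if prems: "S a i \<in> V" "S b i \<in> V" "S d k \<in> V" "a \<noteq> b" "S a i \<noteq> S d k" "S b i \<noteq> S d k" for a b d i k
  proof -
    consider "d \<noteq> a" "d \<noteq> b" | "d = a" "k \<noteq> i" | "d = b" "k \<noteq> i" using prems by auto
    then show ?thesis
      using on_path_three_colours[of a b d i i k] on_path_same_row_S[of a b i k]
        on_path_same_row_S[of b a i k] prems
      by cases (auto simp: insert_commute)
  qed
  consider "i = j" | "i = k" | "j = k" | "i \<noteq> j" "i \<noteq> k" "j \<noteq> k" by blast
  then show ?thesis
  proof cases
    case 4
    define f where "f = (\<lambda>_. 0::nat)(i := a, j := b, k := d)"
    have "on_path ((\<lambda>i. S (f i) i) ` {..l} \<union> Q ` {1..l})"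
      by (rule on_path_zigzag) (use assms 4 in \<open>auto simp: f_def\<close>)
    moreover have "S a i = S (f i) i" "S b j = S (f j) j" "S d k = S (f k) k" "i \<le> l" "j \<le> l" "k \<le> l"
      using 4 assms Z_cases l by (auto simp: f_def dest!: Z_cases)
    ultimately show ?thesis
      using assms by (auto elim!: on_path_mono)
  next
    case 1
    then show ?thesis
      using assms by (intro on_path_mono[OF same[of a i b d k]]) auto
  next
    case 2
    then show ?thesis
      using assms by (intro on_path_mono[OF same[of a i d b j]]) auto
  next
    case 3
    then show ?thesis
      using assms by (intro on_path_mono[OF same[of b j d a i]]) auto
  qed
qed

lemma on_path_C_C:
  assumes "C a \<in> V" "C b \<in> V" "a \<noteq> b"
  shows "C d \<in> V \<Longrightarrow> on_path {C a, C b, C d}" "S d i \<in> V \<Longrightarrow> on_path {C a, C b, S d i}"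
proof -
  have all: "on_path {C 0, C 1, C 2, S d i}" if "S d i \<in> V" for d i
  proof -
    obtain e where e: "e < 2" "e \<noteq> d" by (rule other_colour)
    obtain x where x: "x < 3" "x \<noteq> d" "x \<noteq> e" by (rule third_colour)
    have d: "d < 3" using that by auto
    then have "{d, e, x} = {0, 1, 2}" using e x by auto
    then have "C ` {d, e, x} = C ` {0, 1, 2}" by simp
    then have "{C 0, C 1, C 2, S d i} \<subseteq> {C d, C e, C x, S d i, S e 0}"
      unfolding image_insert image_empty by blast
    then show ?thesis
      using on_path_CCCSS[of d e x i 0] e x d that by (auto elim!: on_path_mono)
  qed
  have "y \<in> {0, 1, 2}" if "C y \<in> V" for y using that by auto
  then have sub: "{C a, C b} \<subseteq> {C 0, C 1, C 2}" "C d \<in> V \<Longrightarrow> C d \<in> {C 0, C 1, C 2}"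
    using assms by blast+
  show "C d \<in> V \<Longrightarrow> on_path {C a, C b, C d}"
    using all[of 0 0] sub by (auto elim!: on_path_mono)
  show "S d i \<in> V \<Longrightarrow> on_path {C a, C b, S d i}"
    using all[of d i] sub by (auto elim!: on_path_mono)
qed

lemma on_path_three:
  assumes "x \<in> V" "y \<in> V" "z \<in> V" "x \<noteq> y" "x \<noteq> z" "y \<noteq> z"
  shows "on_path {x, y, z}"
proof -
  \<comment> \<open>Sorting by \<open>rank\<close> leaves ten combinations of kinds, each treated by
    one of the preceding lemmas.\<close>
  have sorted: "on_path {x, y, z}"
    if "x \<in> V" "y \<in> V" "z \<in> V" "x \<noteq> y" "x \<noteq> z" "y \<noteq> z" "rank x \<le> rank y" "rank y \<le> rank z" for x y z
    using that
    by (cases x; cases y; cases z)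
      (simp_all del: V_simps add: on_path_C_C on_path_C_C_Q on_path_C_S_S on_path_C_S_Q on_path_C_Q_Q
        on_path_S_S_S on_path_S_S_Q on_path_S_Q_Q on_path_Q_Q_Q)
  consider "rank x \<le> rank y \<and> rank y \<le> rank z" | "rank x \<le> rank z \<and> rank z \<le> rank y"
    | "rank y \<le> rank x \<and> rank x \<le> rank z" | "rank y \<le> rank z \<and> rank z \<le> rank x"
    | "rank z \<le> rank x \<and> rank x \<le> rank y" | "rank z \<le> rank y \<and> rank y \<le> rank x"
    by linarith
  then show ?thesis
    using sorted[of x y z] sorted[of x z y] sorted[of y x z] sorted[of y z x] sorted[of z x y] sorted[of z y x] assms
    by cases (simp_all add: insert_commute)
qed

lemma mp_G: "mp G = 2"
  using on_path_three card_V by (subst mp_eq_2_iff) (auto simp: on_path_def)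

end

lemma \<mu>_2_le_layered:
  assumes "7 \<le> b"
  shows "\<mu> 2 b \<le> enat ((3 * b + 1) div 2 + 1)"
proof -
  \<comment> \<open>Each further row raises \<open>b\<close> by two and the order by three, and the
    second element of \<open>Z\<close> adjusts the parity of \<open>b\<close>. The requirement
    \<open>2 \<le> l\<close> amounts to \<open>7 \<le> b\<close>, so smaller values need separate
    graphs.\<close>
  define l where "l = (b - 3) div 2"
  define Z where "Z = (if even b then {0, 1} else {1::nat})"
  interpret layered l Z using assms by unfold_locales (auto simp: l_def Z_def)
  have card_Z: "card Z = (if even b then 2 else 1)" by (simp add: Z_def)
  have "2 * l + 2 + card Z = b"
    using assms by (auto simp: l_def card_Z elim!: evenE oddE)
  moreover from this have "3 * l + 5 + card Z = (3 * b + 1) div 2 + 1"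
    by (auto simp: card_Z split: if_splits)
  ultimately show ?thesis
    using \<mu>_le_order[OF pair_graph mp_G gp_G] unfolding pverts_G card_V by metis
qed

section \<open>Four small graphs\<close>

definition list_graph :: "nat \<Rightarrow> (nat \<times> nat) list \<Rightarrow> nat pair_pre_digraph" where
  "list_graph n es = \<lparr>pverts = set [0..<n], parcs = set (es @ map prod.swap es)\<rparr>"

text \<open>A certificate for \<open>mp G = 2\<close>; the ranges are written as lists so that
  \<open>code_simp\<close> can evaluate it.\<close>

definition covers_triples :: "nat \<Rightarrow> (nat \<times> nat) list \<Rightarrow> nat list list \<Rightarrow> bool" where
  "covers_triples n es ps \<longleftrightarrow>
     (\<forall>p\<in>set ps. p \<noteq> [] \<and> distinct p \<and> (\<forall>x\<in>set p. x < n) \<and> induced (set (es @ map prod.swap es)) p) \<and>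
     (\<forall>z\<in>set [0..<n]. \<forall>y\<in>set [0..<z]. \<forall>x\<in>set [0..<y]. \<exists>p\<in>set ps. x \<in> set p \<and> y \<in> set p \<and> z \<in> set p)"

text \<open>The hypotheses of \<open>general_position_diameter_2\<close> in executable form.\<close>

definition pairwise_near :: "nat \<Rightarrow> (nat \<times> nat) list \<Rightarrow> nat list \<Rightarrow> bool" where
  "pairwise_near n es xs \<longleftrightarrow> (let E = set (es @ map prod.swap es) in
     distinct xs \<and> (\<forall>x\<in>set xs. x < n \<and> (\<forall>y\<in>set xs. x \<noteq> y \<longrightarrow>
       (x, y) \<in> E \<or> (\<exists>u\<in>set [0..<n]. (x, u) \<in> E \<and> (u, y) \<in> E)) \<and>
       (\<forall>y\<in>set xs. \<forall>z\<in>set xs. (x, y) \<in> E \<and> (y, z) \<in> E \<longrightarrow> x = z)))"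

locale small_graph =
  fixes n :: nat and es :: "(nat \<times> nat) list" and G
  assumes n: "2 \<le> n" and es: "\<forall>(u, v)\<in>set es. u < n \<and> v < n \<and> u \<noteq> v"
  defines "G \<equiv> list_graph n es"
begin

sublocale pair_graph G
proof
  show "finite (pverts G)" "finite (parcs G)" by (simp_all add: G_def list_graph_def)
  show "symmetric (with_proj G)"
    by (auto simp: G_def list_graph_def symmetric_def sym_def)
qed (use es in \<open>auto simp: G_def list_graph_def\<close>)

lemma pverts_G: "pverts G = {..<n}"
  by (auto simp: G_def list_graph_def)

lemma parcs_G: "parcs G = set (es @ map prod.swap es)"
  by (simp add: G_def list_graph_def)

lemma mp_eq_2:
  assumes "covers_triples n es ps"
  shows "mp G = 2"
proof (subst mp_eq_2_iff)
  have path: "monophonic_path G p" if "p \<in> set ps" for p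
    using assms that unfolding covers_triples_def monophonic_path_iff_induced pverts_G parcs_G by blast
  have sorted: "\<exists>p. monophonic_path G p \<and> {x, y, z} \<subseteq> set p" if "x < y" "y < z" "z < n" for x y z
  proof -
    have "z \<in> set [0..<n]" "y \<in> set [0..<z]" "x \<in> set [0..<y]" using that by simp_all
    then obtain p where "p \<in> set ps" "x \<in> set p" "y \<in> set p" "z \<in> set p"
      using assms unfolding covers_triples_def by blast
    then show ?thesis using path by blast
  qed
  show "\<forall>x\<in>pverts G. \<forall>y\<in>pverts G. \<forall>z\<in>pverts G. x \<noteq> y \<and> x \<noteq> z \<and> y \<noteq> z \<longrightarrow>
    (\<exists>p. monophonic_path G p \<and> {x, y, z} \<subseteq> set p)"
  proof (intro ballI impI)
    fix x y z assume "x \<in> pverts G" "y \<in> pverts G" "z \<in> pverts G" and d: "x \<noteq> y \<and> x \<noteq> z \<and> y \<noteq> z"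
    then have lt: "x < n" "y < n" "z < n" by (simp_all add: pverts_G)
    from d consider "x < y \<and> y < z" | "x < z \<and> z < y" | "y < x \<and> x < z"
      | "y < z \<and> z < x" | "z < x \<and> x < y" | "z < y \<and> y < x"
      by linarith
    then show "\<exists>p. monophonic_path G p \<and> {x, y, z} \<subseteq> set p"
      using lt sorted[of x y z] sorted[of x z y] sorted[of y x z] sorted[of y z x] sorted[of z x y] sorted[of z y x]
      by cases (simp_all add: conj_ac)
  qed
qed (use n in \<open>simp add: pverts_G\<close>)

lemma length_le_gp:
  assumes "pairwise_near n es xs"
  shows "length xs \<le> gp G"
proof -
  have "general_position G (set xs)"
    using assms unfolding pairwise_near_def Let_def parcs_G[symmetric]
    by (intro general_position_diameter_2) (auto simp: pverts_G)
  then show ?thesis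
    using card_le_gp assms by (fastforce simp: pairwise_near_def distinct_card)
qed

lemma gp_le:
  assumes "\<And>X. general_position G X \<Longrightarrow> card X \<le> k"
  shows "gp G \<le> k"
  using gp_attained assms by metis

end

text \<open>The graph is the 5-cycle: any four of its vertices include three consecutive ones, which
  form a geodesic.\<close>

lemma \<mu>_2_3_le: "\<mu> 2 3 \<le> 5"
proof -
  define es :: "(nat \<times> nat) list" where
    "es = [(0, 1), (1, 2), (2, 3), (3, 4), (4, 0)]"
  define H where "H = list_graph 5 es"
  interpret small_graph 5 es H
    by unfold_locales (simp_all add: es_def H_def)
  note arcs = parcs_G[unfolded es_def]
  have "covers_triples 5 es [[0, 1, 2, 3], [0, 4, 3, 2], [1, 0, 4, 3], [1, 2, 3, 4]]"
    unfolding es_def by code_simp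
  then have "mp H = 2"
    by (rule mp_eq_2)
  moreover have "pairwise_near 5 es [0, 1, 3]"
    unfolding es_def by code_simp
  then have "3 \<le> gp H"
    using length_le_gp by fastforce
  moreover have "gp H \<le> 3"
  proof (rule gp_le)
    fix X assume X: "general_position H X"
    have sub: "X \<subseteq> {..<5}" using X by (simp add: general_position_def pverts_G)
    have geo: "geodesic H [0, 1, 2]" "geodesic H [1, 2, 3]"
      "geodesic H [2, 3, 4]" "geodesic H [3, 4, 0]"
      "geodesic H [4, 0, 1]"
      by (rule geodesic_3; simp add: arcs)+
    have "X \<inter> {0, 1, 2, 3, 4} = X" using sub by (auto simp: numeral_eq_Suc less_Suc_eq)
    moreover have "card (X \<inter> {0, 1, 2, 3, 4}) \<le> 3"
      using general_positionD[OF X geo(1), of 0 1 2] general_positionD[OF X geo(2), of 1 2 3]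
        general_positionD[OF X geo(3), of 2 3 4] general_positionD[OF X geo(4), of 3 4 0]
        general_positionD[OF X geo(5), of 4 0 1]
      by (cases "0 \<in> X"; cases "1 \<in> X"; cases "2 \<in> X"; cases "3 \<in> X"; cases "4 \<in> X")
        (simp_all add: Int_insert_right)
    ultimately show "card X \<le> 3" by simp
  qed
  ultimately show ?thesis
    using \<mu>_le_order[OF pair_graph] by (fastforce simp: pverts_G numeral_eq_enat)
qed

text \<open>The graph is the 3-cube without one vertex, that is, a hexagon and a vertex
  \<open>6\<close> joined to every other vertex of it. The set in general position is the larger
  class of the bipartition.\<close>

lemma \<mu>_2_4_le: "\<mu> 2 4 \<le> 7"
proof -
  define es :: "(nat \<times> nat) list" where
    "es = [(0, 1), (1, 2), (2, 3), (3, 4), (4, 5), (5, 0), (6, 0), (6, 2), (6, 4)]"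
  define H where "H = list_graph 7 es"
  interpret small_graph 7 es H
    by unfold_locales (simp_all add: es_def H_def)
  note arcs = parcs_G[unfolded es_def]
  have "covers_triples 7 es [[0, 1, 2, 3, 4], [1, 2, 6, 4, 5], [3, 2, 6, 0, 5], [1, 0, 5, 4, 3], [1, 0, 6, 4, 3]]"
    unfolding es_def by code_simp
  then have "mp H = 2"
    by (rule mp_eq_2)
  moreover have "pairwise_near 7 es [1, 3, 5, 6]"
    unfolding es_def by code_simp
  then have "4 \<le> gp H"
    using length_le_gp by fastforce
  moreover have "gp H \<le> 4"
  proof (rule gp_le)
    fix X assume X: "general_position H X"
    have sub: "X \<subseteq> {..<7}" using X by (simp add: general_position_def pverts_G)
    have "card (X \<inter> {0, 1, 2, 3, 4, 5}) \<le> 3"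
      by (rule card_general_position_hexagon[OF X]) (auto simp: arcs)
    moreover have "X \<subseteq> X \<inter> {0, 1, 2, 3, 4, 5} \<union> X \<inter> {6}"
      using sub by (auto simp: numeral_eq_Suc less_Suc_eq)
    then have "card X \<le> card (X \<inter> {0, 1, 2, 3, 4, 5}) + card (X \<inter> {6})"
      by (intro order_trans[OF card_mono card_Un_le]) auto
    moreover have "card (X \<inter> {6}) \<le> 1"
      by (simp add: Int_insert_right)
    ultimately show "card X \<le> 4" by linarith
  qed
  ultimately show ?thesis
    using \<mu>_le_order[OF pair_graph] by (fastforce simp: pverts_G numeral_eq_enat)
qed

text \<open>A hexagon with copies \<open>6\<close> and \<open>7\<close> of its vertices
  \<open>1\<close> and \<open>5\<close>. By \<open>no_twins\<close> a copy must not keep exactly the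
  neighbours of the original; the vertex \<open>8\<close>, joined to \<open>3\<close>,
  \<open>6\<close> and \<open>7\<close>, tells them apart.\<close>

lemma \<mu>_2_5_le: "\<mu> 2 5 \<le> 9"
proof -
  define es :: "(nat \<times> nat) list" where
    "es = [(0, 1), (1, 2), (2, 3), (3, 4), (4, 5), (5, 0), (6, 0), (6, 2), (7, 0), (7, 4), (8, 3), (8, 6), (8, 7)]"
  define H where "H = list_graph 9 es"
  interpret small_graph 9 es H
    by unfold_locales (simp_all add: es_def H_def)
  note arcs = parcs_G[unfolded es_def]
  have "covers_triples 9 es [[1, 2, 6, 8, 7, 4, 5], [1, 0, 5, 4, 3, 8], [2, 3, 8, 7, 0, 5], [0, 6, 2, 3, 4], [1, 0, 6, 8, 3, 4], [1, 0, 7, 4, 3], [0, 1, 2, 3, 4], [3, 2, 6, 0, 5], [3, 2, 6, 0, 7]]"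
    unfolding es_def by code_simp
  then have "mp H = 2"
    by (rule mp_eq_2)
  moreover have "pairwise_near 9 es [1, 3, 5, 6, 7]"
    unfolding es_def by code_simp
  then have "5 \<le> gp H"
    using length_le_gp by fastforce
  moreover have "gp H \<le> 5"
  proof (rule gp_le)
    fix X assume X: "general_position H X"
    have sub: "X \<subseteq> {..<9}" using X by (simp add: general_position_def pverts_G)
    have "card (X \<inter> {0, 1, 2, 3, 4, 5}) \<le> 3"
      by (rule card_general_position_hexagon[OF X]) (auto simp: arcs)
    moreover have "geodesic H [6, 8, 7]"
      by (rule geodesic_3) (simp_all add: arcs)
    then have "card (X \<inter> set [6, 8, 7]) \<le> 2"
      using X unfolding general_position_def by blast
    moreover have "X \<subseteq> X \<inter> {0, 1, 2, 3, 4, 5} \<union> X \<inter> set [6, 8, 7]"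
      using sub by (auto simp: numeral_eq_Suc less_Suc_eq)
    then have "card X \<le> card (X \<inter> {0, 1, 2, 3, 4, 5}) + card (X \<inter> set [6, 8, 7])"
      by (intro order_trans[OF card_mono card_Un_le]) auto
    ultimately show "card X \<le> 5" by linarith
  qed
  ultimately show ?thesis
    using \<mu>_le_order[OF pair_graph] by (fastforce simp: pverts_G numeral_eq_enat)
qed

text \<open>The graph for \<open>b = 5\<close> with a copy \<open>9\<close> of the vertex
  \<open>3\<close>; the vertex \<open>8\<close> is adjacent to \<open>3\<close> but not to
  \<open>9\<close>.\<close>

lemma \<mu>_2_6_le: "\<mu> 2 6 \<le> 10"
proof -
  define es :: "(nat \<times> nat) list" where
    "es = [(0, 1), (1, 2), (2, 3), (3, 4), (4, 5), (5, 0), (6, 0), (6, 2), (7, 0), (7, 4), (8, 3), (8, 6), (8, 7), (9, 2), (9, 4)]"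
  define H where "H = list_graph 10 es"
  interpret small_graph 10 es H
    by unfold_locales (simp_all add: es_def H_def)
  note arcs = parcs_G[unfolded es_def]
  have "covers_triples 10 es [[1, 0, 6, 8, 3, 4, 9], [1, 2, 6, 8, 7, 4, 5], [5, 0, 7, 8, 3, 2, 9], [0, 1, 2, 3, 4], [1, 0, 5, 4, 3, 8], [1, 0, 7, 4, 3], [1, 2, 9, 4, 5], [3, 2, 6, 0, 5], [6, 0, 7, 4, 9], [5, 0, 6, 2, 9], [1, 0, 7, 4, 9], [3, 2, 6, 0, 7]]"
    unfolding es_def by code_simp
  then have "mp H = 2"
    by (rule mp_eq_2)
  moreover have "pairwise_near 10 es [1, 3, 5, 6, 7, 9]"
    unfolding es_def by code_simp
  then have "6 \<le> gp H"
    using length_le_gp by fastforce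
  moreover have "gp H \<le> 6"
  proof (rule gp_le)
    fix X assume X: "general_position H X"
    have sub: "X \<subseteq> {..<10}" using X by (simp add: general_position_def pverts_G)
    have "card (X \<inter> {0, 1, 2, 3, 4, 5}) \<le> 3"
      by (rule card_general_position_hexagon[OF X]) (auto simp: arcs)
    moreover have "geodesic H [6, 8, 7]"
      by (rule geodesic_3) (simp_all add: arcs)
    then have "card (X \<inter> set [6, 8, 7]) \<le> 2"
      using X unfolding general_position_def by blast
    moreover have "X \<subseteq> X \<inter> {0, 1, 2, 3, 4, 5} \<union> X \<inter> set [6, 8, 7] \<union> X \<inter> {9}"
      using sub by (auto simp: numeral_eq_Suc less_Suc_eq)
    then have "card X \<le> card (X \<inter> {0, 1, 2, 3, 4, 5}) + card (X \<inter> set [6, 8, 7]) + card (X \<inter> {9})"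
      by (intro order_trans[OF card_mono order_trans[OF card_Un_le add_mono[OF card_Un_le order_refl]]]) auto
    moreover have "card (X \<inter> {9}) \<le> 1"
      by (simp add: Int_insert_right)
    ultimately show "card X \<le> 6" by linarith
  qed
  ultimately show ?thesis
    using \<mu>_le_order[OF pair_graph] by (fastforce simp: pverts_G numeral_eq_enat)
qed

section \<open>The bounds for monophonic position number two\<close>

lemma \<mu>_2_le:
  assumes "4 \<le> b"
  shows "\<mu> 2 b \<le> enat ((3 * b + 1) div 2 + 1)"
proof -
  consider "b = 4" | "b = 5" | "b = 6" | "7 \<le> b"
    using assms by linarith
  then show ?thesis
    using \<mu>_2_4_le \<mu>_2_5_le \<mu>_2_6_le \<mu>_2_le_layered[of b]
    by cases (simp_all add: numeral_eq_enat)
qed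

lemma \<mu>_2_ge:
  assumes "4 \<le> b" "b \<le> 8"
  shows "enat ((3 * b + 1) div 2 + 1) \<le> \<mu> 2 b"
proof (rule \<mu>_ge)
  fix G :: "nat pair_pre_digraph"
  assume G: "pair_graph G" "mp G = 2" "gp G = b"
  consider "b = 4" | "b = 5" | "b = 6" | "b = 7" | "b = 8"
    using assms by linarith
  then show "(3 * b + 1) div 2 + 1 \<le> card (pverts G)"
    using pair_graph.order_ge_if_mp_eq_2[OF G(1,2)] G(3) by cases simp_all
qed

lemma \<mu>_2_3: "\<mu> 2 3 = 5"
proof (rule antisym[OF \<mu>_2_3_le])
  have "enat 5 \<le> \<mu> 2 3"
    by (rule \<mu>_ge) (use pair_graph.order_ge_if_mp_less_gp in force)
  then show "5 \<le> \<mu> 2 3"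
    by (simp add: numeral_eq_enat)
qed

lemma nat_ceiling_half: "nat \<lceil>real n / 2\<rceil> = (n + 1) div 2"
proof -
  have "\<lceil>real n / 2\<rceil> = int ((n + 1) div 2)"
    by (rule ceiling_unique; cases "even n") (auto elim!: evenE oddE)
  then show ?thesis by simp
qed

theorem theorem2p7:
  shows "(\<forall>a::nat. 2 \<le> a \<longrightarrow> \<mu> a a = enat a) \<and>
    (\<mu> 2 3 = 5 \<and>
     (\<forall>b::nat. 4 \<le> b \<longrightarrow> \<mu> 2 b \<le> enat (nat \<lceil>3 * real b / 2\<rceil> + 1)) \<and>
     (\<forall>b::nat. 4 \<le> b \<and> b \<le> 8 \<longrightarrow> \<mu> 2 b = enat (nat \<lceil>3 * real b / 2\<rceil> + 1))) \<and>
    (\<forall>a b::nat. 3 \<le> a \<and> a < b \<and> real b / 2 \<le> real a \<longrightarrow> \<mu> a b = enat (b + 2)) \<and>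
    (\<forall>a b::nat. 3 \<le> a \<and> real a < real b / 2 \<longrightarrow>
       \<mu> a b \<le> enat (b - a + 2 + nat \<lceil>real b / 2\<rceil>))"
proof (intro conjI allI impI)
  fix a :: nat
  show "\<mu> a a = enat a"
    by (rule \<mu>_diag)
next
  show "\<mu> 2 3 = 5"
    by (rule \<mu>_2_3)
next
  fix b :: nat
  assume "4 \<le> b"
  then show "\<mu> 2 b \<le> enat (nat \<lceil>3 * real b / 2\<rceil> + 1)"
    using \<mu>_2_le[of b] nat_ceiling_half[of "3 * b"] by simp
next
  fix b :: nat
  assume "4 \<le> b \<and> b \<le> 8"
  then show "\<mu> 2 b = enat (nat \<lceil>3 * real b / 2\<rceil> + 1)"
    using \<mu>_2_le[of b] \<mu>_2_ge[of b] nat_ceiling_half[of "3 * b"] by (simp add: antisym)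
next
  fix a b :: nat
  assume "3 \<le> a \<and> a < b \<and> real b / 2 \<le> real a"
  then show "\<mu> a b = enat (b + 2)"
    by (intro \<mu>_eq_add_2) linarith+
next
  fix a b :: nat
  assume "3 \<le> a \<and> real a < real b / 2"
  then have "3 \<le> a" "2 * a < b"
    by linarith+
  then show "\<mu> a b \<le> enat (b - a + 2 + nat \<lceil>real b / 2\<rceil>)"
    using \<mu>_le_of_double_less[of a b] by (simp add: nat_ceiling_half)
qed

end
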